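(* Assume conditions (C1)--(C4) listed in the context. Then, as $n\to\infty$, uniformly in $j\in[k]$, $$ \mathcal K_j=\begin{cases} \dfrac{c_n}{1-c_n-\alpha_n}+o_{a.s.}(1), & \text{if } j\notin \mathbf j_*,\\[2ex] (1+\delta_{j})\left[\dfrac{c_n}{1-c_n-\alpha_n}+o_{a.s.}(1)\right], & \text{if } j\in \mathbf j_*. \end{cases} $$ That is, almost surely, $$\max_{j\in[k]\setminus\mathbf j_*}\left|\mathcal K_j-\frac{c_n}{1-c_n-\alpha_n}\right|\to0 \quad\text{and}\quad \max_{j\in\mathbf j_*}\left|\frac{\mathcal K_j}{1+\delta_{j}}-\frac{c_n}{1-c_n-\alpha_n}\right|\to 0 .$$
   Context: Model. For each $n$ let $p=p(n)$, $k=k(n)$, $[k]=\{1,\dots,k\}$, and consider the multivariate linear regression model $\mathbf Y=\mathbf X\mathbf\Theta+\mathbf E\mathbf\Sigma^{1/2}$, where $\mathbf Y$ is the $n\times p$ response matrix, $\mathbf X=(\mathbf x_1,\dots,\mathbf x_k)$ is a non-random $n\times k$ matrix, $\mathbf\Theta=(\boldsymbol\theta_1,\dots,\boldsymbol\theta_k)'$ is a non-random $k\times p$ matrix (its $j$th row is $\boldsymbol\theta_j'$), $\mathbf\Sigma$ is a non-random $p\times p$ covariance matrix of full rank, and $\mathbf E=(e_{ij})_{1\le i\le n,1\le j\le p}$. All of these depend on $n$, the errors $e_{ij}$ being taken from one double array $\{e_{ij}:i,j\ge1\}$. The true model is a subset $\mathbf j_*\subset[k]$ (possibly depending on $n$)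 such that $\boldsymbol\theta_j=\mathbf 0$ for all $j\in[k]\setminus\mathbf j_*$, so that $\mathbf Y=\mathbf X_{\mathbf j_*}\mathbf\Theta_{\mathbf j_*}+\mathbf E\mathbf\Sigma^{1/2}$, where $\mathbf X_{\mathbf j}=(\mathbf x_j,j\in\mathbf j)$ and $\mathbf\Theta_{\mathbf j}=(\boldsymbol\theta_j,j\in\mathbf j)'$. KOO statistics. For $\mathbf j\subset[k]$ let $\mathbf P_{\mathbf j}=\mathbf X_{\mathbf j}(\mathbf X_{\mathbf j}'\mathbf X_{\mathbf j})^{-1}\mathbf X_{\mathbf j}'$, $\mathbf Q_{\mathbf j}=\mathbf I_n-\mathbf P_{\mathbf j}$, $\widehat{\mathbf\Sigma}_{\mathbf j}=\frac1n\mathbf Y'\mathbf Q_{\mathbf j}\mathbf Y$. Write $\mathbf Q=\mathbf Q_{[k]}$, $\widehat{\mathbf\Sigma}=\widehat{\mathbf\Sigma}_{[k]}$, and for a single index $j\in[k]$, $\mathbf Q_j=\mathbf Q_{[k]\setminus\{j\}}$, $\widehat{\mathbf\Sigma}_j=\widehat{\mathbf\Sigma}_{[k]\setminus\{j\}}$. The KOO (knock-one-out) statistic is $\mathcal K_j=\operatorname{tr}(\widehat{\mathbf\Sigma}^{-1}\widehat{\mathbf\Sigma}_j)-p$. Put $c_n=p/n$, $\alpha_n=k/n$, and $\delta_j=\delta_{nj}=p^{-1}\,\mathbf x_j'\mathbf Q_j\mathbf x_j\,\boldsymbol\theta_j'\mathbf\Sigma^{-1}\boldsymbol\theta_j$.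 Conditions. (C1) As $\min\{k,p,n\}\to\infty$, $c_n\to c\in(0,1)$ and $\alpha_n\to\alpha\in[0,1)$ with $\alpha+c<1$. (C2) The true model satisfies $\mathbf j_*\subset[k]$, and $|\mathbf j_*|$ is allowed to diverge as $k\to\infty$. (C3) The entries $e_{ij}$ of $\mathbf E$ are i.i.d. with zero mean, unit variance and finite fourth moment; $\tau=\mathbb E e_{ij}^4-3\in(-\infty,\infty)$. (C4) $\mathbf X'\mathbf X$ is positive definite for all $n>k+p$. Notation: $o_{a.s.}(1)$ denotes a scalar sequence converging to $0$ almost surely. *)

theory Defs
  imports
    "HOL-Probability.Probability"
    "Jordan_Normal_Form.Matrix"
    "Jordan_Normal_Form.Gauss_Jordan_Elimination"
    "Jordan_Normal_Form.DL_Rank"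
    "Jordan_Normal_Form.DL_Submatrix"
begin

(* HOL-Analysis and Jordan_Normal_Form both claim the infix syntax for the scalar product and for
   vector indexing; only the latter's is wanted here. *)
unbundle no inner_syntax
unbundle no vec_syntax

text \<open>Matrices and vectors have dimensions varying with the sample size, so they are the explicitly
  dimensioned ones of \<open>Jordan_Normal_Form\<close>. These are indexed from 0; accordingly the index set
  \<open>[k] = {1, \<dots>, k}\<close> is rendered as \<open>{..<k}\<close>, and the double array of errors is indexed from 0.\<close>

definition mat_trace :: "real mat \<Rightarrow> real" where
  "mat_trace A = (\<Sum>i<dim_row A. A $$ (i, i))"

text \<open>A total inverse; the value 0 for singular matrices is an arbitrary convention.\<close>
definition mat_inv :: "real mat \<Rightarrow> real mat" where
  "mat_inv A = (case mat_inverse A of Some B \<Rightarrow> B | None \<Rightarrow> 0\<^sub>m (dim_row A) (dim_col A))"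

definition pos_semidef :: "nat \<Rightarrow> real mat \<Rightarrow> bool" where
  "pos_semidef m A \<longleftrightarrow> A \<in> carrier_mat m m \<and> transpose_mat A = A \<and>
     (\<forall>v \<in> carrier_vec m. v \<bullet> (A *\<^sub>v v) \<ge> 0)"

definition pos_def :: "nat \<Rightarrow> real mat \<Rightarrow> bool" where
  "pos_def m A \<longleftrightarrow> A \<in> carrier_mat m m \<and> transpose_mat A = A \<and>
     (\<forall>v \<in> carrier_vec m. v \<noteq> 0\<^sub>v m \<longrightarrow> v \<bullet> (A *\<^sub>v v) > 0)"

text \<open>\<open>R\<close> is the matrix \<open>S\<^sup>1\<^sup>/\<^sup>2\<close>: the unique positive semidefinite square root of \<open>S\<close>.\<close>
definition is_mat_sqrt :: "nat \<Rightarrow> real mat \<Rightarrow> real mat \<Rightarrow> bool" where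
  "is_mat_sqrt m S R \<longleftrightarrow> pos_semidef m R \<and> R * R = S"

definition full_rank_covariance :: "nat \<Rightarrow> real mat \<Rightarrow> bool" where
  "full_rank_covariance m S \<longleftrightarrow> pos_semidef m S \<and> vec_space.rank m S = m"

definition error_mat :: "(nat \<Rightarrow> nat \<Rightarrow> 'a \<Rightarrow> real) \<Rightarrow> nat \<Rightarrow> nat \<Rightarrow> 'a \<Rightarrow> real mat" where
  "error_mat e n p \<omega> = mat n p (\<lambda>(i, j). e i j \<omega>)"

definition col_submat :: "real mat \<Rightarrow> nat set \<Rightarrow> real mat" where
  "col_submat X J = submatrix X UNIV J"

definition proj_mat :: "real mat \<Rightarrow> nat set \<Rightarrow> real mat" where
  "proj_mat X J =
     (let XJ = col_submat X J
      in XJ * mat_inv (transpose_mat XJ * XJ) * transpose_mat XJ)"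

definition resid_mat :: "real mat \<Rightarrow> nat set \<Rightarrow> real mat" where
  "resid_mat X J = 1\<^sub>m (dim_row X) - proj_mat X J"

definition Sigma_hat :: "real mat \<Rightarrow> real mat \<Rightarrow> nat set \<Rightarrow> real mat" where
  "Sigma_hat X Y J =
     (1 / real (dim_row X)) \<cdot>\<^sub>m (transpose_mat Y * resid_mat X J * Y)"

definition koo_stat :: "real mat \<Rightarrow> real mat \<Rightarrow> nat \<Rightarrow> real" where
  "koo_stat X Y j =
     mat_trace (mat_inv (Sigma_hat X Y {..<dim_col X}) * Sigma_hat X Y ({..<dim_col X} - {j}))
     - real (dim_col Y)"

text \<open>The noncentrality \<open>\<delta>\<^sub>j = p\<^sup>-\<^sup>1 (x\<^sub>j' Q\<^sub>j x\<^sub>j) (\<theta>\<^sub>j' S\<^sup>-\<^sup>1 \<theta>\<^sub>j)\<close>, where \<open>T\<close> is the coefficient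
  matrix with rows \<open>\<theta>\<^sub>j'\<close> and \<open>S\<close> the covariance matrix.\<close>
definition koo_delta :: "real mat \<Rightarrow> real mat \<Rightarrow> real mat \<Rightarrow> nat \<Rightarrow> real" where
  "koo_delta X T S j =
     (1 / real (dim_col T))
     * (col X j \<bullet> (resid_mat X ({..<dim_col X} - {j}) *\<^sub>v col X j))
     * (row T j \<bullet> (mat_inv S *\<^sub>v row T j))"

text \<open>The maximum of a nonnegative function over a finite set, with value 0 on the empty set.\<close>
definition max_over :: "nat set \<Rightarrow> (nat \<Rightarrow> real) \<Rightarrow> real" where
  "max_over J f = Max (insert 0 (f ` J))"

end

theory Submission
  imports Defs "HOL-Real_Asymp.Real_Asymp"
begin

text \<open>
  Knocking out \<open>x\<^sub>j\<close> enlarges the residual projection \<open>Q\<close> by \<open>u u'\<close>, where \<open>u\<close> is the normalised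
  residual of \<open>x\<^sub>j\<close>; hence \<open>K\<^sub>j = v' (E' Q E)\<^sup>-\<^sup>1 v\<close> with \<open>v = w + E' u\<close> and \<open>|w|\<^sup>2 = p \<delta>\<^sub>j\<close>. Adding the
  columns \<open>e\<^sub>0, e\<^sub>1, \<dots>\<close> of \<open>E\<close> one at a time gives \<open>1 + K\<^sub>j = |f\<^sub>p|\<^sup>2\<close>, where
  \<open>|f\<^sub>i\<^sub>+\<^sub>1|\<^sup>2 = |f\<^sub>i|\<^sup>2 + (w\<^sub>i + f\<^sub>i \<cdot> e\<^sub>i)\<^sup>2 / (e\<^sub>i' R\<^sub>i e\<^sub>i)\<close>, \<open>|f\<^sub>0| = 1\<close>, and \<open>R\<^sub>i\<close> projects
  onto the part of the range of \<open>Q\<close> orthogonal to the first \<open>i\<close> columns. Both \<open>f\<^sub>i\<close> and \<open>R\<^sub>i\<close> are functions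
  of the earlier columns, so \<open>e\<^sub>i' R\<^sub>i e\<^sub>i\<close> concentrates at the rank \<open>n - k - i\<close> of \<open>R\<^sub>i\<close>, and the numerator has
  conditional mean \<open>w\<^sub>i\<^sup>2 + |f\<^sub>i|\<^sup>2\<close>. Multiplied by \<open>n - k - i\<close> the recursion telescopes up to a martingale, and
  \<open>(n - k - p) |f\<^sub>p|\<^sup>2\<close> is close to \<open>n - k + p \<delta>\<^sub>j\<close>. In this way no lower bound for the eigenvalues of
  \<open>E' Q E\<close> is needed.

  With only four moments, a union bound over the \<open>k p\<close> pairs of a variable and a column needs truncation.
  Almost surely all entries are eventually below \<open>\<eta> \<surd>n\<close>; the entries between \<open>n\<^sup>3\<^sup>/\<^sup>1\<^sup>0\<close> and \<open>\<eta> \<surd>n\<close> carry a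
  negligible part of the norm of every column; and for the remaining ones exponential moments give
  summable probabilities.
\<close>

section \<open>Sequential orthogonalisation\<close>

text \<open>The covariance drops out because the statistic is unchanged when \<open>Y\<close> is
  multiplied on the right by an invertible matrix. It survives only in the vector \<open>w\<close>,
  of which nothing but the norm is known, so \<open>w\<close> may be concentrated on a few columns.
  The obstacle is a circle: the fluctuation of the telescoped sum can be bounded only while the
  squared norms of the \<open>f_i\<close> stay below a multiple of \<open>1 + \<delta>\<close>, and
  this is what the sum is meant to show. So the sum is stopped at the first exceedance and bounded
  for every past; a deterministic argument then excludes exceedances. Dividing by the threshold
  makes the bounds uniform in \<open>\<delta>\<close>, which may be arbitrarily large. Exponential
  moments are taken at two scales. Linear and quadratic forms in truncated columns admit exponents
  that are powers of \<open>n\<close> and give stretched exponential probabilities, which survive a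
  union over all pairs. Large entries and the martingale admit only exponents of order
  \<open>log n / n\<close>, hence only polynomial probabilities, but occur in at most
  \<open>n\<close> events each. Vectors are plain functions because a column of errors is then a
  point of a product space.\<close>

definition ip :: "nat \<Rightarrow> (nat \<Rightarrow> real) \<Rightarrow> (nat \<Rightarrow> real) \<Rightarrow> real" where
  "ip n a b = (\<Sum>l<n. a l * b l)"

definition mv :: "nat \<Rightarrow> (nat \<Rightarrow> nat \<Rightarrow> real) \<Rightarrow> (nat \<Rightarrow> real) \<Rightarrow> nat \<Rightarrow> real" where
  "mv n R v a = ip n (R a) v"

definition orth_proj :: "nat \<Rightarrow> (nat \<Rightarrow> nat \<Rightarrow> real) \<Rightarrow> bool" where
  "orth_proj n R \<longleftrightarrow> (\<forall>a<n. \<forall>b<n. R a b = R b a) \<and>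
     (\<forall>a<n. \<forall>b<n. (\<Sum>l<n. R a l * R l b) = R a b)"

definition tr :: "nat \<Rightarrow> (nat \<Rightarrow> nat \<Rightarrow> real) \<Rightarrow> real" where
  "tr n R = (\<Sum>a<n. R a a)"

text \<open>For \<open>v\<close> in the kernel of the projection \<open>R\<close> the denominator is 0 and, since \<open>x / 0 = 0\<close>, \<open>R\<close> is left
  unchanged; thus deflation preserves orthogonal projections unconditionally.\<close>
definition deflate :: "nat \<Rightarrow> (nat \<Rightarrow> nat \<Rightarrow> real) \<Rightarrow> (nat \<Rightarrow> real) \<Rightarrow> nat \<Rightarrow> nat \<Rightarrow> real" where
  "deflate n R v a b = R a b - mv n R v a * mv n R v b / ip n v (mv n R v)"

primrec res :: "nat \<Rightarrow> (nat \<Rightarrow> nat \<Rightarrow> real) \<Rightarrow> (nat \<Rightarrow> nat \<Rightarrow> real) \<Rightarrow> nat \<Rightarrow> nat \<Rightarrow> nat \<Rightarrow> real" where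
  "res n Q x 0 = Q"
| "res n Q x (Suc i) = deflate n (res n Q x i) (x i)"

text \<open>The pivots of Gaussian elimination on the Gram matrix \<open>x_a' Q x_b\<close>, written
  as squared lengths of residuals.\<close>

definition pivot :: "nat \<Rightarrow> (nat \<Rightarrow> nat \<Rightarrow> real) \<Rightarrow> (nat \<Rightarrow> nat \<Rightarrow> real) \<Rightarrow> nat \<Rightarrow> real" where
  "pivot n Q x i = ip n (x i) (mv n (res n Q x i) (x i))"

text \<open>As long as the pivots do not vanish, \<open>fit n Q u w x i\<close> is the point of \<open>u\<close> plus the span of
  \<open>Q x\<^sub>0, \<dots>, Q x\<^sub>i\<^sub>-\<^sub>1\<close> whose scalar products with \<open>x\<^sub>0, \<dots>, x\<^sub>i\<^sub>-\<^sub>1\<close> are \<open>- w\<^sub>0, \<dots>, - w\<^sub>i\<^sub>-\<^sub>1\<close>.\<close>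
primrec fit :: "nat \<Rightarrow> (nat \<Rightarrow> nat \<Rightarrow> real) \<Rightarrow> (nat \<Rightarrow> real) \<Rightarrow> (nat \<Rightarrow> real) \<Rightarrow>
    (nat \<Rightarrow> nat \<Rightarrow> real) \<Rightarrow> nat \<Rightarrow> nat \<Rightarrow> real" where
  "fit n Q u w x 0 = u"
| "fit n Q u w x (Suc i) = (\<lambda>a. fit n Q u w x i a -
     (w i + ip n (fit n Q u w x i) (x i)) / pivot n Q x i * mv n (res n Q x i) (x i) a)"

abbreviation fit_sq where
  "fit_sq n Q u w x i \<equiv> ip n (fit n Q u w x i) (fit n Q u w x i)"

text \<open>The numerator of the recursion minus \<open>(w i)^2\<close> and minus
  \<open>fit_sq\<close>. For a standardised column independent of the past this is the numerator
  minus its conditional mean.\<close>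

abbreviation drift where
  "drift n Q u w x i \<equiv> 2 * w i * ip n (fit n Q u w x i) (x i) + (ip n (fit n Q u w x i) (x i))\<^sup>2
     - fit_sq n Q u w x i"

section \<open>Scalar products, orthogonal projections and their deflation\<close>

lemma ip_commute: "ip n a b = ip n b a"
  by (simp add: ip_def mult.commute)

lemma ip_cong: "(\<And>l. l < n \<Longrightarrow> a l = a' l) \<Longrightarrow> (\<And>l. l < n \<Longrightarrow> b l = b' l) \<Longrightarrow> ip n a b = ip n a' b'"
  by (simp add: ip_def)

lemma ip_self_nonneg: "0 \<le> ip n a a"
  by (simp add: ip_def sum_nonneg)

lemma ip_self_eq_0D: "ip n a a = 0 \<Longrightarrow> l < n \<Longrightarrow> a l = 0"
  by (simp add: ip_def sum_nonneg_eq_0_iff)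

lemma ip_diff_left: "ip n (\<lambda>l. a l - b l) c = ip n a c - ip n b c"
  by (simp add: ip_def left_diff_distrib sum_subtractf)

lemma ip_diff_right: "ip n c (\<lambda>l. a l - b l) = ip n c a - ip n c b"
  by (simp add: ip_def right_diff_distrib sum_subtractf)

lemma ip_scale_left: "ip n (\<lambda>l. t * a l) c = t * ip n a c"
  by (simp add: ip_def sum_distrib_left mult.assoc)

lemma ip_scale_right: "ip n c (\<lambda>l. t * a l) = t * ip n c a"
  by (simp add: ip_def sum_distrib_left mult.left_commute)

lemma ip_sum_right: "ip n c (\<lambda>l. \<Sum>m\<in>I. t m * x m l) = (\<Sum>m\<in>I. t m * ip n c (x m))"
  unfolding ip_def sum_distrib_left
  by (subst sum.swap) (simp add: mult.left_commute)

lemma ip_zero_right: "(\<And>l. l < n \<Longrightarrow> b l = 0) \<Longrightarrow> ip n a b = 0"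
  by (simp add: ip_def)

lemma mv_cong: "(\<And>l. l < n \<Longrightarrow> v l = v' l) \<Longrightarrow> mv n R v a = mv n R v' a"
  by (simp add: mv_def ip_def)

lemma mv_diff: "mv n R (\<lambda>l. a l - b l) c = mv n R a c - mv n R b c"
  by (simp add: mv_def ip_diff_right)

lemma mv_scale: "mv n R (\<lambda>l. t * a l) c = t * mv n R a c"
  by (simp add: mv_def ip_scale_right)

lemma orth_projD_sym: "orth_proj n R \<Longrightarrow> a < n \<Longrightarrow> b < n \<Longrightarrow> R a b = R b a"
  by (auto simp: orth_proj_def)

lemma orth_projD_idem: "orth_proj n R \<Longrightarrow> a < n \<Longrightarrow> b < n \<Longrightarrow> (\<Sum>l<n. R a l * R l b) = R a b"
  unfolding orth_proj_def by blast

lemma ip_mv_sym: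
  assumes "orth_proj n R" shows "ip n (mv n R a) b = ip n a (mv n R b)"
proof -
  have "ip n (mv n R a) b = (\<Sum>l<n. \<Sum>m<n. R l m * a m * b l)"
    by (simp add: ip_def mv_def sum_distrib_right)
  also have "\<dots> = (\<Sum>m<n. \<Sum>l<n. R l m * a m * b l)"
    by (rule sum.swap)
  also have "\<dots> = (\<Sum>m<n. \<Sum>l<n. a m * (R m l * b l))"
    by (intro sum.cong refl) (auto simp: orth_projD_sym[OF assms])
  also have "\<dots> = ip n a (mv n R b)"
    by (simp add: ip_def mv_def sum_distrib_left)
  finally show ?thesis .
qed

lemma mv_mv:
  assumes "orth_proj n R" "a < n" shows "mv n R (mv n R v) a = mv n R v a"
proof -
  have "mv n R (mv n R v) a = (\<Sum>l<n. \<Sum>m<n. R a l * R l m * v m)"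
    by (simp add: ip_def mv_def sum_distrib_left mult.assoc)
  also have "\<dots> = (\<Sum>m<n. (\<Sum>l<n. R a l * R l m) * v m)"
    by (subst sum.swap) (simp add: sum_distrib_right)
  also have "\<dots> = mv n R v a"
    using assms by (simp add: orth_projD_idem mv_def ip_def)
  finally show ?thesis .
qed

lemma ip_mv_self:
  assumes "orth_proj n R" shows "ip n v (mv n R v) = ip n (mv n R v) (mv n R v)"
proof -
  have "ip n (mv n R v) (mv n R v) = ip n v (mv n R (mv n R v))"
    by (rule ip_mv_sym[OF assms])
  also have "\<dots> = ip n v (mv n R v)"
    by (rule ip_cong) (auto simp: mv_mv[OF assms])
  finally show ?thesis by simp
qed

lemma mv_deflate:
  "mv n (deflate n R v) z a = mv n R z a - mv n R v a * ip n (mv n R v) z / ip n v (mv n R v)"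
proof -
  define q where "q = mv n R v"
  have "mv n (deflate n R v) z a = ip n (\<lambda>l. R a l - q a / ip n v q * q l) z"
    unfolding mv_def[of n "deflate n R v"] by (rule ip_cong) (simp_all add: deflate_def q_def)
  also have "\<dots> = mv n R z a - q a / ip n v q * ip n q z"
    by (simp only: ip_diff_left ip_scale_left mv_def)
  finally show ?thesis by (simp add: q_def)
qed

text \<open>The vector \<open>q = R v\<close> lies in the range of \<open>R\<close> and
  \<open>ip n v q\<close> is its squared length, so the matrix subtracted is the orthogonal
  projection onto the line through \<open>q\<close>.\<close>

lemma orth_proj_deflate:
  assumes R: "orth_proj n R" shows "orth_proj n (deflate n R v)"
proof (cases "ip n v (mv n R v) = 0")
  case True
  then have "deflate n R v = R" by (auto simp: deflate_def fun_eq_iff)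
  with R show ?thesis by simp
next
  case False
  define q where "q = mv n R v"
  define M where "M = ip n v q"
  have M: "M \<noteq> 0" using False by (simp add: M_def q_def)
  have qq: "(\<Sum>l<n. q l * q l) = M"
    using ip_mv_self[OF R, of v] by (simp add: M_def q_def ip_def)
  have Rq: "(\<Sum>l<n. R a l * q l) = q a" if "a < n" for a
    using mv_mv[OF R that, of v] by (simp add: q_def mv_def ip_def)
  have qR: "(\<Sum>l<n. q l * R l b) = q b" if "b < n" for b
  proof -
    have "(\<Sum>l<n. q l * R l b) = (\<Sum>l<n. R b l * q l)"
      by (intro sum.cong refl) (use that in \<open>auto simp: orth_projD_sym[OF R] mult.commute\<close>)
    then show ?thesis using Rq[OF that] by simp
  qed
  have d: "deflate n R v a b = R a b - q a * q b / M" for a b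
    by (simp add: deflate_def q_def M_def)
  have "(\<Sum>l<n. (R a l - q a * q l / M) * (R l b - q l * q b / M)) = R a b - q a * q b / M"
    if "a < n" "b < n" for a b
  proof -
    have "(\<Sum>l<n. (R a l - q a * q l / M) * (R l b - q l * q b / M)) =
      (\<Sum>l<n. R a l * R l b - (q b / M) * (R a l * q l) - (q a / M) * (q l * R l b)
          + (q a * q b / M\<^sup>2) * (q l * q l))"
      using M by (intro sum.cong refl) (simp add: field_simps power2_eq_square)
    also have "\<dots> = R a b - (q b / M) * q a - (q a / M) * q b + (q a * q b / M\<^sup>2) * M"
      by (simp only: sum.distrib sum_subtractf sum_distrib_left[symmetric]
          orth_projD_idem[OF R that] Rq[OF that(1)] qR[OF that(2)] qq)
    also have "\<dots> = R a b - q a * q b / M"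
      using M by (simp add: field_simps power2_eq_square)
    finally show ?thesis .
  qed
  then show ?thesis
    using orth_projD_sym[OF R] by (auto simp: orth_proj_def d mult.commute)
qed

lemma orth_proj_res: "orth_proj n Q \<Longrightarrow> orth_proj n (res n Q x i)"
  by (induction i) (auto intro: orth_proj_deflate)

lemma tr_deflate:
  assumes "orth_proj n R" "ip n v (mv n R v) \<noteq> 0"
  shows "tr n (deflate n R v) = tr n R - 1"
proof -
  have "tr n (deflate n R v) = tr n R - ip n (mv n R v) (mv n R v) / ip n v (mv n R v)"
    by (simp add: tr_def deflate_def ip_def sum_subtractf sum_divide_distrib)
  with assms show ?thesis by (simp add: ip_mv_self)
qed

text \<open>The trace of a projection is its rank, and every nonzero pivot uses up one dimension.
  This is the value about which the pivots concentrate.\<close>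

lemma tr_res:
  assumes "orth_proj n Q" "\<And>m. m < i \<Longrightarrow> pivot n Q x m \<noteq> 0"
  shows "tr n (res n Q x i) = tr n Q - real i"
  using assms(2)
proof (induction i)
  case (Suc i)
  then show ?case
    using tr_deflate[OF orth_proj_res[OF assms(1), of x i], of "x i"]
    by (simp add: pivot_def)
qed simp

section \<open>Invariants of the recursion and the normal equations\<close>

lemma pivot_eq: "orth_proj n Q \<Longrightarrow> pivot n Q x i = ip n (mv n (res n Q x i) (x i)) (mv n (res n Q x i) (x i))"
  by (simp add: pivot_def ip_mv_self[OF orth_proj_res])

lemma pivot_nonneg: "orth_proj n Q \<Longrightarrow> 0 \<le> pivot n Q x i"
  by (simp add: pivot_eq ip_self_nonneg)

lemma pivot_eq_0D: "orth_proj n Q \<Longrightarrow> pivot n Q x i = 0 \<Longrightarrow> a < n \<Longrightarrow> mv n (res n Q x i) (x i) a = 0"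
  by (auto simp: pivot_eq dest: ip_self_eq_0D)

text \<open>The vector \<open>u\<close> starts in the kernel of \<open>Q\<close>, and each step
  moves \<open>fit\<close> only along the direction that is removed from the projection at the same
  time. This invariant makes the steps orthogonal to the current \<open>fit\<close>.\<close>

lemma mv_res_fit:
  assumes Q: "orth_proj n Q" and u: "\<And>a. a < n \<Longrightarrow> mv n Q u a = 0" and "a < n"
  shows "mv n (res n Q x i) (fit n Q u w x i) a = 0"
  using \<open>a < n\<close>
proof (induction i arbitrary: a)
  case 0
  then show ?case by (simp add: u)
next
  case (Suc i)
  define R where "R = res n Q x i"
  define f where "f = fit n Q u w x i"
  define q where "q = mv n R (x i)"
  define M where "M = pivot n Q x i"
  define t where "t = (w i + ip n f (x i)) / M"
  have R: "orth_proj n R" by (simp add: R_def orth_proj_res[OF Q])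
  have M': "ip n (x i) q = M" by (simp add: M_def pivot_def R_def q_def)
  have Rf: "mv n R f b = 0" if "b < n" for b using Suc.IH that by (simp add: R_def f_def)
  have qf: "ip n q f = 0"
    unfolding q_def ip_mv_sym[OF R] by (rule ip_zero_right) (use Rf in auto)
  have qq: "ip n q q = M"
    using pivot_eq[OF Q, of x i] by (simp add: M_def R_def q_def)
  have Rq: "mv n R q b = q b" if "b < n" for b
    using that by (simp add: q_def mv_mv[OF R])
  have "mv n (res n Q x (Suc i)) (fit n Q u w x (Suc i)) a =
     mv n R f a - q a * ip n q f / M - t * (mv n R q a - q a * ip n q q / M)"
    by (simp add: mv_deflate mv_diff mv_scale ip_diff_right ip_scale_right
      R_def[symmetric] f_def[symmetric] q_def[symmetric] M_def[symmetric] t_def[symmetric] M')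
  also have "\<dots> = 0"
  proof (cases "M = 0")
    \<comment> \<open>A zero pivot means that \<open>x i\<close> lies in the kernel of the
      projection, so the step vanishes and the value of the division by 0 does not matter.\<close>
    case True
    then have "q a = 0" using pivot_eq_0D[OF Q, of x i] Suc.prems by (simp add: M_def R_def q_def)
    with True Suc.prems show ?thesis by (simp add: Rf Rq)
  next
    case False
    then show ?thesis using Suc.prems by (simp add: Rf Rq qf qq)
  qed
  finally show ?case .
qed

text \<open>Pythagoras: by the kernel invariant the step is orthogonal to \<open>fit\<close>, and
  \<open>q\<close> has squared length \<open>M\<close>. With \<open>x / 0 = 0\<close> the identity
  also covers a zero pivot.\<close>

lemma ip_fit_Suc:
  assumes Q: "orth_proj n Q" and u: "\<And>a. a < n \<Longrightarrow> mv n Q u a = 0"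
  shows "fit_sq n Q u w x (Suc i) =
    fit_sq n Q u w x i + (w i + ip n (fit n Q u w x i) (x i))\<^sup>2 / pivot n Q x i"
proof -
  define R where "R = res n Q x i"
  define f where "f = fit n Q u w x i"
  define q where "q = mv n R (x i)"
  define M where "M = pivot n Q x i"
  define t where "t = (w i + ip n f (x i)) / M"
  have R: "orth_proj n R" by (simp add: R_def orth_proj_res[OF Q])
  have qf: "ip n q f = 0"
    unfolding q_def ip_mv_sym[OF R]
    by (rule ip_zero_right) (use mv_res_fit[OF Q u] in \<open>auto simp: R_def f_def\<close>)
  have qq: "ip n q q = M"
    using pivot_eq[OF Q, of x i] by (simp add: M_def R_def q_def)
  have "fit_sq n Q u w x (Suc i) = ip n f f + t\<^sup>2 * M"
    using qf qq ip_commute[of n f q]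
    by (simp add: ip_diff_left ip_diff_right ip_scale_left ip_scale_right power2_eq_square
      R_def[symmetric] f_def[symmetric] q_def[symmetric] M_def[symmetric] t_def[symmetric])
  also have "t\<^sup>2 * M = (w i + ip n f (x i))\<^sup>2 / M"
    by (simp add: t_def power2_eq_square)
  finally show ?thesis by (simp add: f_def M_def)
qed

text \<open>Monotonicity serves twice later: the errors in the telescoped sum are weighted by
  nonnegative increments, and stopping at a threshold cuts the sum at a single index.\<close>

lemma ip_fit_ge:
  assumes Q: "orth_proj n Q" and u: "\<And>a. a < n \<Longrightarrow> mv n Q u a = 0" and "i \<le> m"
  shows "fit_sq n Q u w x i \<le> fit_sq n Q u w x m"
proof (rule lift_Suc_mono_le[where f = "\<lambda>i. fit_sq n Q u w x i", OF _ \<open>i \<le> m\<close>])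
  fix i
  show "fit_sq n Q u w x i \<le> fit_sq n Q u w x (Suc i)"
    using ip_fit_Suc[OF Q u, where w = w and x = x and i = i] pivot_nonneg[OF Q, of x i]
    by (simp del: fit.simps)
qed

lemma mv_res_past:
  assumes Q: "orth_proj n Q" and piv: "\<And>m. m < i \<Longrightarrow> pivot n Q x m \<noteq> 0" and "m < i" "a < n"
  shows "mv n (res n Q x i) (x m) a = 0"
  using assms(2-)
proof (induction i arbitrary: a)
  case (Suc i)
  define R where "R = res n Q x i"
  have R: "orth_proj n R" by (simp add: R_def orth_proj_res[OF Q])
  have piv: "ip n (x i) (mv n R (x i)) \<noteq> 0"
    using Suc.prems(1)[of i] by (simp add: pivot_def R_def)
  have eq: "mv n (res n Q x (Suc i)) (x m) a =
     mv n R (x m) a - mv n R (x i) a * ip n (mv n R (x i)) (x m) / ip n (x i) (mv n R (x i))"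
    by (simp add: mv_deflate R_def)
  show ?case
  proof (cases "m = i")
    case True
    then show ?thesis unfolding eq using piv by (simp add: ip_commute[of n "mv n R (x i)"])
  next
    case False
    then have z: "mv n R (x m) b = 0" if "b < n" for b
      using Suc that by (simp add: R_def)
    then have "ip n (mv n R (x i)) (x m) = 0"
      unfolding ip_mv_sym[OF R] by (intro ip_zero_right)
    then show ?thesis unfolding eq using z Suc.prems by simp
  qed
qed simp

text \<open>The coefficient of step \<open>m\<close> is chosen to produce \<open>- w m\<close>.
  Later steps move along vectors that are orthogonal to \<open>x m\<close>, because the later
  projections annihilate it, and so they preserve the value.\<close>

lemma ip_fit_past:
  assumes Q: "orth_proj n Q" and piv: "\<And>m. m < i \<Longrightarrow> pivot n Q x m \<noteq> 0" and "m < i"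
  shows "ip n (fit n Q u w x i) (x m) = - w m"
  using assms(2-)
proof (induction i)
  case (Suc i)
  define R where "R = res n Q x i"
  have R: "orth_proj n R" by (simp add: R_def orth_proj_res[OF Q])
  have piv: "pivot n Q x i \<noteq> 0" using Suc.prems(1)[of i] by simp
  have eq: "ip n (fit n Q u w x (Suc i)) (x m) = ip n (fit n Q u w x i) (x m) -
     (w i + ip n (fit n Q u w x i) (x i)) / pivot n Q x i * ip n (mv n R (x i)) (x m)"
    by (simp add: ip_diff_left R_def ip_scale_left del: times_divide_eq_left)
  show ?case
  proof (cases "m = i")
    case True
    have "ip n (mv n R (x i)) (x i) = pivot n Q x i"
      unfolding R_def pivot_def by (rule ip_commute)
    then show ?thesis using eq piv True by (simp del: fit.simps)
  next
    case False
    then have "ip n (mv n R (x i)) (x m) = 0"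
      unfolding ip_mv_sym[OF R]
      by (intro ip_zero_right) (use Suc.prems in \<open>auto simp: R_def intro!: mv_res_past[OF Q]\<close>)
    then show ?thesis unfolding eq using Suc False by simp
  qed
qed simp

text \<open>Connects the recursion with linear algebra: an iterated residual is \<open>Q\<close>
  applied to the vector minus a combination of the columns. The induction works for any value of the
  quotient \<open>t\<close>.\<close>

lemma mv_res_span:
  "\<exists>c. \<forall>a<n. mv n (res n Q x i) v a = mv n Q (\<lambda>l. v l - (\<Sum>m<i. c m * x m l)) a"
proof (induction i arbitrary: v)
  case 0
  then show ?case by simp
next
  case (Suc i)
  obtain c where c: "\<forall>a<n. mv n (res n Q x i) v a = mv n Q (\<lambda>l. v l - (\<Sum>m<i. c m * x m l)) a"
    using Suc by blast
  obtain d where d: "\<forall>a<n. mv n (res n Q x i) (x i) a = mv n Q (\<lambda>l. x i l - (\<Sum>m<i. d m * x m l)) a"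
    using Suc by blast
  define t where "t = ip n (mv n (res n Q x i) (x i)) v / pivot n Q x i"
  have "mv n (res n Q x (Suc i)) v a =
     mv n Q (\<lambda>l. v l - (\<Sum>m<Suc i. (if m = i then t else c m - t * d m) * x m l)) a" if "a < n" for a
  proof -
    have "mv n (res n Q x (Suc i)) v a = mv n (res n Q x i) v a - t * mv n (res n Q x i) (x i) a"
      by (simp add: mv_deflate t_def pivot_def)
    also have "\<dots> = mv n Q (\<lambda>l. (v l - (\<Sum>m<i. c m * x m l)) - t * (x i l - (\<Sum>m<i. d m * x m l))) a"
      using c d that by (simp add: mv_diff mv_scale)
    also have "\<dots> = mv n Q (\<lambda>l. v l - (\<Sum>m<Suc i. (if m = i then t else c m - t * d m) * x m l)) a"
      by (rule mv_cong) (simp add: algebra_simps sum_subtractf sum_distrib_left sum_negf)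
    finally show ?thesis .
  qed
  then show ?case by (intro exI allI impI)
qed

lemma fit_span:
  "\<exists>c. \<forall>a<n. fit n Q u w x i a = u a - mv n Q (\<lambda>l. \<Sum>m<i. c m * x m l) a"
proof (induction i)
  case 0
  then show ?case by (intro exI[of _ "\<lambda>_. 0"]) (simp add: mv_def ip_def)
next
  case (Suc i)
  then obtain c where c: "\<forall>a<n. fit n Q u w x i a = u a - mv n Q (\<lambda>l. \<Sum>m<i. c m * x m l) a"
    by blast
  obtain d where d: "\<forall>a<n. mv n (res n Q x i) (x i) a = mv n Q (\<lambda>l. x i l - (\<Sum>m<i. d m * x m l)) a"
    using mv_res_span by blast
  define t where "t = (w i + ip n (fit n Q u w x i) (x i)) / pivot n Q x i"
  have "fit n Q u w x (Suc i) a =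
      u a - mv n Q (\<lambda>l. \<Sum>m<Suc i. (if m = i then t else c m - t * d m) * x m l) a" if "a < n" for a
  proof -
    have "fit n Q u w x (Suc i) a = fit n Q u w x i a - t * mv n (res n Q x i) (x i) a"
      by (simp add: t_def)
    also have "\<dots> = u a - (mv n Q (\<lambda>l. \<Sum>m<i. c m * x m l) a + t * mv n Q (\<lambda>l. x i l - (\<Sum>m<i. d m * x m l)) a)"
      using c d that by simp
    also have "mv n Q (\<lambda>l. \<Sum>m<i. c m * x m l) a + t * mv n Q (\<lambda>l. x i l - (\<Sum>m<i. d m * x m l)) a =
       mv n Q (\<lambda>l. (\<Sum>m<i. c m * x m l) - (- t) * (x i l - (\<Sum>m<i. d m * x m l))) a"
      unfolding mv_diff mv_scale by simp
    also have "\<dots> = mv n Q (\<lambda>l. \<Sum>m<Suc i. (if m = i then t else c m - t * d m) * x m l) a"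
      by (rule mv_cong) (simp add: algebra_simps sum_subtractf sum_distrib_left sum_negf)
    finally show ?thesis .
  qed
  then show ?case by (intro exI allI impI)
qed

text \<open>With \<open>x\<close> as the matrix of columns, \<open>c\<close> solves
  \<open>x' Q x c = w + x' u\<close>, and the increase of the squared norm is the quadratic form of
  the inverse at that right-hand side, expressed without an inverse. It comes from
  \<open>fit = u - Q z\<close>: the prescribed scalar products are the normal equations, and
  \<open>Q u = 0\<close> leaves only \<open>|Q z|^2\<close> as the increase.\<close>

lemma fit_solves:
  assumes Q: "orth_proj n Q" and u: "\<And>a. a < n \<Longrightarrow> mv n Q u a = 0"
    and piv: "\<And>m. m < p \<Longrightarrow> pivot n Q x m \<noteq> 0"
  obtains c where
    "\<And>m. m < p \<Longrightarrow> ip n (x m) (mv n Q (\<lambda>l. \<Sum>i<p. c i * x i l)) = w m + ip n u (x m)"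
    "fit_sq n Q u w x p - ip n u u = (\<Sum>i<p. c i * (w i + ip n u (x i)))"
proof -
  obtain c where c: "\<forall>a<n. fit n Q u w x p a = u a - mv n Q (\<lambda>l. \<Sum>m<p. c m * x m l) a"
    using fit_span by blast
  define z where "z = (\<lambda>l. \<Sum>m<p. c m * x m l)"
  have fz: "ip n (fit n Q u w x p) b = ip n u b - ip n (mv n Q z) b" for b
    unfolding ip_diff_left[symmetric] by (rule ip_cong) (use c in \<open>auto simp: z_def\<close>)
  have fz': "ip n b (fit n Q u w x p) = ip n b u - ip n b (mv n Q z)" for b
    using fz[of b] by (simp add: ip_commute)
  have 1: "ip n (x m) (mv n Q z) = w m + ip n u (x m)" if "m < p" for m
    using fz[of "x m"] ip_fit_past[OF Q piv, of p m u w] that ip_commute[of n "x m" "mv n Q z"] by simp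
  have 0: "ip n (mv n Q z) u = 0"
    unfolding ip_mv_sym[OF Q] by (rule ip_zero_right) (use u in auto)
  have "fit_sq n Q u w x p - ip n u u = ip n (mv n Q z) (mv n Q z)"
    using 0 ip_commute[of n "mv n Q z" u] by (simp add: fz fz')
  also have "\<dots> = ip n (mv n Q z) z"
    using ip_mv_self[OF Q, of z] by (simp add: ip_commute)
  also have "\<dots> = (\<Sum>i<p. c i * ip n (mv n Q z) (x i))"
    unfolding z_def by (rule ip_sum_right)
  also have "\<dots> = (\<Sum>i<p. c i * (w i + ip n u (x i)))"
    by (intro sum.cong refl) (use 1 in \<open>auto simp: ip_commute\<close>)
  finally show thesis using 1 that[of c] unfolding z_def by blast
qed

section \<open>Exponential inequalities for adapted sums\<close>

lemma exp_le_quadratic: "exp z \<le> 1 + z + z\<^sup>2 * exp \<bar>z\<bar>" for z :: real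
proof -
  obtain t where t: "\<bar>t\<bar> \<le> \<bar>z\<bar>" "exp z = (\<Sum>m<2. z ^ m / fact m) + exp t / fact 2 * z ^ 2"
    using Maclaurin_exp_le[of z 2] by auto
  have "exp t / 2 * z\<^sup>2 \<le> exp \<bar>z\<bar> * z\<^sup>2"
  proof (rule mult_right_mono)
    have "exp t \<le> exp \<bar>z\<bar>" using t(1) by simp
    then show "exp t / 2 \<le> exp \<bar>z\<bar>" using exp_gt_zero[of t] by linarith
  qed simp
  then show ?thesis using t(2) by (simp add: numeral_2_eq_2 mult.commute)
qed

lemma power2_add_le: "(x + y)\<^sup>2 \<le> 2 * x\<^sup>2 + 2 * y\<^sup>2" for x y :: real
  using zero_le_power2[of "x - y"] by (simp add: power2_eq_square algebra_simps)

text \<open>A Bernstein bound in which the mean need only be small, since truncation and cut-offs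
  destroy exact centring.\<close>

lemma exp_moment_bound:
  fixes X :: "'b \<Rightarrow> real"
  assumes "prob_space N" and X[measurable]: "X \<in> borel_measurable N"
    and b: "\<And>y. y \<in> space N \<Longrightarrow> \<bar>X y\<bar> \<le> b"
    and m: "(\<integral>y. X y \<partial>N) \<le> m" and v: "(\<integral>y. (X y)\<^sup>2 \<partial>N) \<le> v" and l: "0 \<le> l"
  shows "(\<integral>\<^sup>+y. ennreal (exp (l * X y)) \<partial>N) \<le> ennreal (exp (l * m + l\<^sup>2 * v * exp (l * b)))"
proof -
  interpret prob_space N by fact
  have b0: "0 \<le> b" using not_empty b by fastforce
  have i1: "integrable N X"
    by (rule integrable_const_bound[of _ b]) (use b in auto)
  have i2: "integrable N (\<lambda>y. (X y)\<^sup>2)"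
    by (rule integrable_const_bound[of _ "b\<^sup>2"])
       (use b b0 in \<open>auto intro!: AE_I2 simp: abs_le_square_iff[symmetric]\<close>)
  have le: "exp (l * X y) \<le> 1 + l * X y + l\<^sup>2 * exp (l * b) * (X y)\<^sup>2" if "y \<in> space N" for y
  proof -
    have "\<bar>l * X y\<bar> \<le> l * b" using b[OF that] l by (simp add: abs_mult mult_left_mono)
    then have "(l * X y)\<^sup>2 * exp \<bar>l * X y\<bar> \<le> (l * X y)\<^sup>2 * exp (l * b)"
      by (intro mult_left_mono) auto
    with exp_le_quadratic[of "l * X y"] show ?thesis
      by (simp add: power_mult_distrib mult_ac)
  qed
  have "(\<integral>\<^sup>+y. ennreal (exp (l * X y)) \<partial>N) \<le>
      (\<integral>\<^sup>+y. ennreal (1 + l * X y + l\<^sup>2 * exp (l * b) * (X y)\<^sup>2) \<partial>N)"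
    by (intro nn_integral_mono ennreal_leI le)
  also have "\<dots> = ennreal (\<integral>y. 1 + l * X y + l\<^sup>2 * exp (l * b) * (X y)\<^sup>2 \<partial>N)"
  proof (rule nn_integral_eq_integral)
    show "integrable N (\<lambda>y. 1 + l * X y + l\<^sup>2 * exp (l * b) * (X y)\<^sup>2)"
      using i1 i2 by simp
    show "AE y in N. 0 \<le> 1 + l * X y + l\<^sup>2 * exp (l * b) * (X y)\<^sup>2"
      by (intro AE_I2) (meson le exp_ge_zero order_trans)
  qed
  also have "(\<integral>y. 1 + l * X y + l\<^sup>2 * exp (l * b) * (X y)\<^sup>2 \<partial>N) =
      1 + l * (\<integral>y. X y \<partial>N) + l\<^sup>2 * exp (l * b) * (\<integral>y. (X y)\<^sup>2 \<partial>N)"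
    using i1 i2 by (simp add: prob_space)
  also have "\<dots> \<le> 1 + (l * m + l\<^sup>2 * v * exp (l * b))"
  proof -
    have "l\<^sup>2 * exp (l * b) * (\<integral>y. (X y)\<^sup>2 \<partial>N) \<le> l\<^sup>2 * exp (l * b) * v"
      by (rule mult_left_mono[OF v]) simp
    also have "\<dots> = l\<^sup>2 * v * exp (l * b)" by simp
    finally show ?thesis using mult_left_mono[OF m l] by linarith
  qed
  also have "\<dots> \<le> exp (l * m + l\<^sup>2 * v * exp (l * b))"
    by (rule exp_ge_add_one_self)
  finally show ?thesis by (simp add: ennreal_leI)
qed

text \<open>Stands in for iterated conditional expectations: on a product space, conditioning on the
  past means fixing the first \<open>t\<close> coordinates. Integrating out the last coordinate
  removes the last factor, whose bound is uniform in the past. The coordinate type is left open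
  because coordinates are entries of one column in some uses and whole columns in others.\<close>

lemma nn_integral_prod_le:
  fixes N :: "nat \<Rightarrow> 'b measure" and F :: "nat \<Rightarrow> (nat \<Rightarrow> 'b) \<Rightarrow> ennreal"
  assumes N: "\<And>t. prob_space (N t)"
    and meas: "\<And>t. t < m \<Longrightarrow> F t \<in> borel_measurable (PiM {..<Suc t} N)"
    and dep: "\<And>t x. t < m \<Longrightarrow> F t x = F t (restrict x {..<Suc t})"
    and bd: "\<And>t x. t < m \<Longrightarrow> x \<in> space (PiM {..<t} N) \<Longrightarrow> (\<integral>\<^sup>+y. F t (x(t := y)) \<partial>N t) \<le> K t"
  shows "(\<integral>\<^sup>+x. (\<Prod>t<m. F t x) \<partial>PiM {..<m} N) \<le> (\<Prod>t<m. K t)"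
  using meas dep bd
proof (induction m)
  case 0
  interpret product_sigma_finite N
    by (rule product_sigma_finite.intro) (rule prob_space_imp_sigma_finite, rule N)
  show ?case using prob_space.emeasure_space_1[OF prob_space_PiM, of "{}" N, OF N]
    by (simp add: nn_integral_empty)
next
  case (Suc m)
  interpret product_sigma_finite N
    by (rule product_sigma_finite.intro) (rule prob_space_imp_sigma_finite, rule N)
  have FM: "F t \<in> borel_measurable (PiM {..<k} N)" if "t < k" "t < Suc m" for t k
  proof -
    have "(\<lambda>x. F t (restrict x {..<Suc t})) \<in> borel_measurable (PiM {..<k} N)"
      by (rule measurable_compose[OF measurable_restrict_subset Suc.prems(1)]) (use that in auto)
    then show ?thesis using Suc.prems(2)[OF that(2)] by (simp cong: measurable_cong)
  qed
  have upd: "F t (x(m := y)) = F t x" if "t < m" for t x y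
  proof -
    have r: "restrict (x(m := y)) {..<Suc t} = restrict x {..<Suc t}"
      using that by (auto simp: restrict_def fun_eq_iff)
    have "F t (x(m := y)) = F t (restrict (x(m := y)) {..<Suc t})"
      by (rule Suc.prems(2)) (use that in simp)
    also have "\<dots> = F t x"
      unfolding r by (rule Suc.prems(2)[symmetric]) (use that in simp)
    finally show ?thesis .
  qed
  have eq: "{..<Suc m} = insert m {..<m}" by auto
  have meas: "(\<lambda>x. \<Prod>t<Suc m. F t x) \<in> borel_measurable (PiM (insert m {..<m}) N)"
    unfolding eq[symmetric] using FM by (intro borel_measurable_prod_ennreal) auto
  have "(\<integral>\<^sup>+x. (\<Prod>t<Suc m. F t x) \<partial>PiM {..<Suc m} N) =
     (\<integral>\<^sup>+x. \<integral>\<^sup>+y. (\<Prod>t<Suc m. F t (x(m := y))) \<partial>N m \<partial>PiM {..<m} N)"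
    unfolding eq[symmetric] by (subst eq, subst product_nn_integral_insert) (use meas in auto)
  also have "\<dots> = (\<integral>\<^sup>+x. \<integral>\<^sup>+y. (\<Prod>t<m. F t x) * F m (x(m := y)) \<partial>N m \<partial>PiM {..<m} N)"
    by (simp add: upd)
  also have "\<dots> = (\<integral>\<^sup>+x. (\<Prod>t<m. F t x) * (\<integral>\<^sup>+y. F m (x(m := y)) \<partial>N m) \<partial>PiM {..<m} N)"
  proof (intro nn_integral_cong nn_integral_cmult)
    fix x assume x: "x \<in> space (PiM {..<m} N)"
    have "(\<lambda>y. x(m := y)) \<in> measurable (N m) (PiM (insert m {..<m}) N)"
      by (rule measurable_component_update) (use x in auto)
    then show "(\<lambda>y. F m (x(m := y))) \<in> borel_measurable (N m)"
      using FM[of m "Suc m"] by (auto simp: eq intro: measurable_compose)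
  qed
  also have "\<dots> \<le> (\<integral>\<^sup>+x. (\<Prod>t<m. F t x) * K m \<partial>PiM {..<m} N)"
    by (intro nn_integral_mono mult_left_mono Suc.prems(3)) auto
  also have "\<dots> = (\<integral>\<^sup>+x. (\<Prod>t<m. F t x) \<partial>PiM {..<m} N) * K m"
    by (rule nn_integral_multc) (use FM in \<open>auto intro!: borel_measurable_prod_ennreal\<close>)
  also have "\<dots> \<le> (\<Prod>t<m. K t) * K m"
    by (intro mult_right_mono Suc.IH Suc.prems less_SucI) auto
  finally show ?case by simp
qed

lemma measurable_dep:
  assumes "F \<in> borel_measurable (PiM {..<Suc t} N)" "\<And>x. F x = F (restrict x {..<Suc t})" "t < m"
  shows "F \<in> borel_measurable (PiM {..<m} N)"
proof -
  have "(\<lambda>x. F (restrict x {..<Suc t})) \<in> borel_measurable (PiM {..<m} N)"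
    by (rule measurable_compose[OF measurable_restrict_subset assms(1)]) (use assms(3) in auto)
  moreover have "(\<lambda>x. F (restrict x {..<Suc t})) = F" using assms(2) by auto
  ultimately show ?thesis by simp
qed

text \<open>The exponent \<open>l\<close> stays free because the applications need different orders,
  from \<open>n^(-3/10)\<close> for linear forms to \<open>log n / n\<close> for the
  martingale.\<close>

lemma chernoff_one_sided:
  fixes N :: "nat \<Rightarrow> 'b measure" and S :: "nat \<Rightarrow> (nat \<Rightarrow> 'b) \<Rightarrow> real"
  assumes N: "\<And>t. prob_space (N t)"
    and meas: "\<And>t. t < m \<Longrightarrow> S t \<in> borel_measurable (PiM {..<Suc t} N)"
    and dep: "\<And>t x. t < m \<Longrightarrow> S t x = S t (restrict x {..<Suc t})"
    and b: "\<And>t x y. t < m \<Longrightarrow> x \<in> space (PiM {..<t} N) \<Longrightarrow> y \<in> space (N t) \<Longrightarrow> \<bar>S t (x(t := y))\<bar> \<le> b"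
    and mu: "\<And>t x. t < m \<Longrightarrow> x \<in> space (PiM {..<t} N) \<Longrightarrow> (\<integral>y. S t (x(t := y)) \<partial>N t) \<le> \<mu> t"
    and v: "\<And>t x. t < m \<Longrightarrow> x \<in> space (PiM {..<t} N) \<Longrightarrow> (\<integral>y. (S t (x(t := y)))\<^sup>2 \<partial>N t) \<le> v t"
    and l: "0 \<le> l"
  shows "measure (PiM {..<m} N) {x \<in> space (PiM {..<m} N). z < (\<Sum>t<m. S t x)} \<le>
    exp (l * (\<Sum>t<m. \<mu> t) + l\<^sup>2 * exp (l * b) * (\<Sum>t<m. v t) - l * z)"
proof -
  interpret P: prob_space "PiM {..<m} N" by (rule prob_space_PiM) (rule N)
  have Sm: "S t \<in> borel_measurable (PiM {..<m} N)" if "t < m" for t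
    by (rule measurable_dep[OF meas dep]) (use that in auto)
  then have Sum[measurable]: "(\<lambda>x. \<Sum>t<m. S t x) \<in> borel_measurable (PiM {..<m} N)"
    by (intro borel_measurable_sum) auto
  have "(\<integral>\<^sup>+x. (\<Prod>t<m. ennreal (exp (l * S t x))) \<partial>PiM {..<m} N) \<le>
     (\<Prod>t<m. ennreal (exp (l * \<mu> t + l\<^sup>2 * v t * exp (l * b))))"
  proof (rule nn_integral_prod_le[OF N])
    fix t x assume t: "t < m"
    show "(\<lambda>x. ennreal (exp (l * S t x))) \<in> borel_measurable (PiM {..<Suc t} N)"
      using meas[OF t] by simp
    show "ennreal (exp (l * S t x)) = ennreal (exp (l * S t (restrict x {..<Suc t})))"
      using dep[OF t, of x] by simp
  next
    fix t x assume t: "t < m" and x: "x \<in> space (PiM {..<t} N)"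
    have eq: "{..<Suc t} = insert t {..<t}" by auto
    have "(\<lambda>y. x(t := y)) \<in> measurable (N t) (PiM (insert t {..<t}) N)"
      by (rule measurable_component_update) (use x in auto)
    then have "(\<lambda>y. S t (x(t := y))) \<in> borel_measurable (N t)"
      using meas[OF t] by (auto simp: eq intro: measurable_compose)
    then show "(\<integral>\<^sup>+y. ennreal (exp (l * S t (x(t := y)))) \<partial>N t) \<le>
       ennreal (exp (l * \<mu> t + l\<^sup>2 * v t * exp (l * b)))"
      by (intro exp_moment_bound N mu[OF t x] v[OF t x] b[OF t x] l)
  qed
  also have "(\<Prod>t<m. ennreal (exp (l * \<mu> t + l\<^sup>2 * v t * exp (l * b)))) =
      ennreal (exp (l * (\<Sum>t<m. \<mu> t) + l\<^sup>2 * exp (l * b) * (\<Sum>t<m. v t)))"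
    by (simp add: prod_ennreal exp_sum[symmetric] sum.distrib flip: sum_distrib_left sum_distrib_right)
  also have "(\<integral>\<^sup>+x. (\<Prod>t<m. ennreal (exp (l * S t x))) \<partial>PiM {..<m} N) =
      (\<integral>\<^sup>+x. ennreal (exp (l * (\<Sum>t<m. S t x))) \<partial>PiM {..<m} N)"
    by (simp add: prod_ennreal exp_sum[symmetric] sum_distrib_left)
  finally have I: "(\<integral>\<^sup>+x. ennreal (exp (l * (\<Sum>t<m. S t x))) \<partial>PiM {..<m} N) \<le>
     ennreal (exp (l * (\<Sum>t<m. \<mu> t) + l\<^sup>2 * exp (l * b) * (\<Sum>t<m. v t)))" .
  let ?A = "{x \<in> space (PiM {..<m} N). z < (\<Sum>t<m. S t x)}"
  have "emeasure (PiM {..<m} N) ?A = (\<integral>\<^sup>+x. indicator ?A x \<partial>PiM {..<m} N)"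
    by (simp add: nn_integral_indicator)
  also have "\<dots> \<le> (\<integral>\<^sup>+x. ennreal (exp (- l * z)) * ennreal (exp (l * (\<Sum>t<m. S t x))) \<partial>PiM {..<m} N)"
  proof (rule nn_integral_mono)
    fix x
    have "1 \<le> exp (- l * z) * exp (l * (\<Sum>t<m. S t x))" if "x \<in> ?A"
      using that l by (simp add: exp_add[symmetric] mult_left_mono)
    then show "indicator ?A x \<le> ennreal (exp (- l * z)) * ennreal (exp (l * (\<Sum>t<m. S t x)))"
      by (auto simp: indicator_def ennreal_mult[symmetric])
  qed
  also have "\<dots> = ennreal (exp (- l * z)) * (\<integral>\<^sup>+x. ennreal (exp (l * (\<Sum>t<m. S t x))) \<partial>PiM {..<m} N)"
    by (rule nn_integral_cmult) simp
  also have "\<dots> \<le> ennreal (exp (- l * z)) *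
     ennreal (exp (l * (\<Sum>t<m. \<mu> t) + l\<^sup>2 * exp (l * b) * (\<Sum>t<m. v t)))"
    by (rule mult_left_mono[OF I]) simp
  also have "\<dots> = ennreal (exp (l * (\<Sum>t<m. \<mu> t) + l\<^sup>2 * exp (l * b) * (\<Sum>t<m. v t) - l * z))"
    by (simp add: ennreal_mult[symmetric] exp_add[symmetric])
  finally show ?thesis by (simp add: P.emeasure_eq_measure)
qed

lemma chernoff_seq:
  fixes N :: "nat \<Rightarrow> 'b measure" and S :: "nat \<Rightarrow> (nat \<Rightarrow> 'b) \<Rightarrow> real"
  assumes N: "\<And>t. prob_space (N t)"
    and meas: "\<And>t. t < m \<Longrightarrow> S t \<in> borel_measurable (PiM {..<Suc t} N)"
    and dep: "\<And>t x. t < m \<Longrightarrow> S t x = S t (restrict x {..<Suc t})"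
    and b: "\<And>t x y. t < m \<Longrightarrow> x \<in> space (PiM {..<t} N) \<Longrightarrow> y \<in> space (N t) \<Longrightarrow> \<bar>S t (x(t := y))\<bar> \<le> b"
    and mu: "\<And>t x. t < m \<Longrightarrow> x \<in> space (PiM {..<t} N) \<Longrightarrow> \<bar>\<integral>y. S t (x(t := y)) \<partial>N t\<bar> \<le> \<mu> t"
    and v: "\<And>t x. t < m \<Longrightarrow> x \<in> space (PiM {..<t} N) \<Longrightarrow> (\<integral>y. (S t (x(t := y)))\<^sup>2 \<partial>N t) \<le> v t"
    and l: "0 \<le> l"
  shows "measure (PiM {..<m} N) {x \<in> space (PiM {..<m} N). z < \<bar>\<Sum>t<m. S t x\<bar>} \<le>
    2 * exp (l * (\<Sum>t<m. \<mu> t) + l\<^sup>2 * exp (l * b) * (\<Sum>t<m. v t) - l * z)"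
proof -
  interpret P: prob_space "PiM {..<m} N" by (rule prob_space_PiM) (rule N)
  have Sm: "S t \<in> borel_measurable (PiM {..<m} N)" if "t < m" for t
    by (rule measurable_dep[OF meas dep]) (use that in auto)
  then have [measurable]: "(\<lambda>x. \<Sum>t<m. S t x) \<in> borel_measurable (PiM {..<m} N)"
    by (intro borel_measurable_sum) auto
  have 1: "measure (PiM {..<m} N) {x \<in> space (PiM {..<m} N). z < (\<Sum>t<m. S t x)} \<le>
    exp (l * (\<Sum>t<m. \<mu> t) + l\<^sup>2 * exp (l * b) * (\<Sum>t<m. v t) - l * z)"
    by (rule chernoff_one_sided[OF N meas dep b order_trans[OF abs_ge_self mu] v l])
  have 2: "measure (PiM {..<m} N) {x \<in> space (PiM {..<m} N). z < (\<Sum>t<m. - S t x)} \<le>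
    exp (l * (\<Sum>t<m. \<mu> t) + l\<^sup>2 * exp (l * b) * (\<Sum>t<m. v t) - l * z)"
  proof (rule chernoff_one_sided[OF N _ _ _ _ _ l])
    fix t x assume t: "t < m"
    show "(\<lambda>x. - S t x) \<in> borel_measurable (PiM {..<Suc t} N)" using meas[OF t] by simp
    show "- S t x = - S t (restrict x {..<Suc t})" using dep[OF t, of x] by simp
  next
    fix t x y assume "t < m" "x \<in> space (PiM {..<t} N)" "y \<in> space (N t)"
    from b[OF this] show "\<bar>- S t (x(t := y))\<bar> \<le> b" by simp
  next
    fix t x assume tx: "t < m" "x \<in> space (PiM {..<t} N)"
    show "(\<integral>y. - S t (x(t := y)) \<partial>N t) \<le> \<mu> t" using mu[OF tx] by (simp add: abs_le_iff)
    show "(\<integral>y. (- S t (x(t := y)))\<^sup>2 \<partial>N t) \<le> v t" using v[OF tx] by (simp only: power2_minus)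
  qed
  have "measure (PiM {..<m} N) {x \<in> space (PiM {..<m} N). z < \<bar>\<Sum>t<m. S t x\<bar>} \<le>
     measure (PiM {..<m} N) ({x \<in> space (PiM {..<m} N). z < (\<Sum>t<m. S t x)} \<union>
       {x \<in> space (PiM {..<m} N). z < (\<Sum>t<m. - S t x)})"
    by (rule P.finite_measure_mono) (auto simp: sum_negf)
  also have "\<dots> \<le> measure (PiM {..<m} N) {x \<in> space (PiM {..<m} N). z < (\<Sum>t<m. S t x)} +
     measure (PiM {..<m} N) {x \<in> space (PiM {..<m} N). z < (\<Sum>t<m. - S t x)}"
    by (rule measure_Un_le) (auto simp: sum_negf)
  finally show ?thesis using 1 2 by linarith
qed

text \<open>A union bound over conditional probabilities. Each single event is handled by the
  product estimate with all factors but one equal to 1.\<close>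

lemma measure_ex_less_le:
  fixes N :: "nat \<Rightarrow> 'b measure" and P :: "nat \<Rightarrow> (nat \<Rightarrow> 'b) \<Rightarrow> bool"
  assumes N: "\<And>t. prob_space (N t)"
    and meas: "\<And>t. t < m \<Longrightarrow> {x \<in> space (PiM {..<Suc t} N). P t x} \<in> sets (PiM {..<Suc t} N)"
    and dep: "\<And>t x. t < m \<Longrightarrow> P t x = P t (restrict x {..<Suc t})"
    and q: "\<And>t x. t < m \<Longrightarrow> x \<in> space (PiM {..<t} N) \<Longrightarrow>
       measure (N t) {y \<in> space (N t). P t (x(t := y))} \<le> q"
  shows "measure (PiM {..<m} N) {x \<in> space (PiM {..<m} N). \<exists>t<m. P t x} \<le> real m * q"
proof -
  interpret Q: prob_space "PiM {..<m} N" by (rule prob_space_PiM) (rule N)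
  have pred: "Measurable.pred (PiM {..<Suc t} N) (P t)" if "t < m" for t
    using meas[OF that] by (simp add: pred_def)
  define F where "F t = (\<lambda>x. if P t x then 1 else 0 :: ennreal)" for t
  have Fm: "F t \<in> borel_measurable (PiM {..<Suc t} N)" if "t < m" for t
    unfolding F_def using pred[OF that] by measurable
  have Fd: "F t x = F t (restrict x {..<Suc t})" if "t < m" for t x
    using dep[OF that] by (simp add: F_def)
  have Fm': "F t \<in> borel_measurable (PiM {..<m} N)" if "t < m" for t
    by (rule measurable_dep[OF Fm Fd]) (use that in auto)
  have setsP: "{x \<in> space (PiM {..<m} N). P t x} \<in> sets (PiM {..<m} N)" if "t < m" for t
  proof -
    have "{x \<in> space (PiM {..<m} N). P t x} = F t -` {1} \<inter> space (PiM {..<m} N)"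
      by (auto simp: F_def split: if_splits)
    also have "\<dots> \<in> sets (PiM {..<m} N)"
      by (rule measurable_sets[OF Fm'[OF that]]) simp
    finally show ?thesis .
  qed
  have one: "measure (PiM {..<m} N) {x \<in> space (PiM {..<m} N). P t x} \<le> q" if t: "t < m" for t
  proof -
    have q0: "0 \<le> q"
    proof -
      have ne: "space (PiM {..<t} N) \<noteq> {}"
        by (rule prob_space.not_empty) (rule prob_space_PiM, rule N)
      then obtain x where "x \<in> space (PiM {..<t} N)" by (meson ex_in_conv)
      from q[OF t this] show ?thesis by (meson measure_nonneg order_trans)
    qed
    have "emeasure (PiM {..<m} N) {x \<in> space (PiM {..<m} N). P t x} =
        (\<integral>\<^sup>+x. F t x \<partial>PiM {..<m} N)"
      by (subst nn_integral_indicator[OF setsP[OF t], symmetric])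
         (auto intro!: nn_integral_cong simp: F_def indicator_def)
    also have "\<dots> = (\<integral>\<^sup>+x. (\<Prod>s<m. if s = t then F t x else 1) \<partial>PiM {..<m} N)"
      using t by (simp add: prod.delta)
    also have "\<dots> \<le> (\<Prod>s<m. if s = t then ennreal q else 1)"
    proof (rule nn_integral_prod_le[OF N])
      fix s x assume s: "s < m"
      show "(\<lambda>x. if s = t then F t x else 1) \<in> borel_measurable (PiM {..<Suc s} N)"
        using Fm[OF t] by (cases "s = t") auto
      show "(if s = t then F t x else 1) = (if s = t then F t (restrict x {..<Suc s}) else 1)"
        using Fd[OF t] by (cases "s = t") auto
    next
      fix s x assume s: "s < m" and x: "x \<in> space (PiM {..<s} N)"
      interpret Ns: prob_space "N s" by (rule N)
      have eq: "{..<Suc s} = insert s {..<s}" by auto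
      have upd: "(\<lambda>y. x(s := y)) \<in> measurable (N s) (PiM {..<Suc s} N)"
        unfolding eq by (rule measurable_component_update) (use x in auto)
      have "(\<integral>\<^sup>+y. F s (x(s := y)) \<partial>N s) = emeasure (N s) {y \<in> space (N s). P s (x(s := y))}"
      proof -
        have "Measurable.pred (N s) (\<lambda>y. P s (x(s := y)))"
          using measurable_compose[OF upd pred[OF s]] by simp
        then have "{y \<in> space (N s). P s (x(s := y))} \<in> sets (N s)"
          by (simp add: pred_def)
        from nn_integral_indicator[OF this, symmetric] show ?thesis
          by (auto intro!: nn_integral_cong simp: F_def indicator_def)
      qed
      also have "\<dots> \<le> ennreal q"
        using q[OF s x] by (simp add: Ns.emeasure_eq_measure ennreal_leI)
      finally show "(\<integral>\<^sup>+y. (if s = t then F t (x(s := y)) else 1) \<partial>N s) \<le> (if s = t then ennreal q else 1)"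
        by (auto simp: Ns.emeasure_space_1)
    qed
    also have "\<dots> = ennreal q" using t by (simp add: prod.delta)
    finally show ?thesis using q0 by (simp add: Q.emeasure_eq_measure)
  qed
  have "{x \<in> space (PiM {..<m} N). \<exists>t<m. P t x} = (\<Union>t\<in>{..<m}. {x \<in> space (PiM {..<m} N). P t x})"
    by auto
  also have "measure (PiM {..<m} N) \<dots> \<le> (\<Sum>t<m. measure (PiM {..<m} N) {x \<in> space (PiM {..<m} N). P t x})"
    by (rule Q.finite_measure_subadditive_finite) (use setsP in auto)
  also have "\<dots> \<le> (\<Sum>t<m. q)" by (intro sum_mono one) auto
  finally show ?thesis by simp
qed

section \<open>Moments and truncated linear forms\<close>

lemma abs_power_le_power4: "k \<le> 4 \<Longrightarrow> \<bar>y\<bar> ^ k \<le> 1 + y ^ 4" for y :: real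
proof -
  assume k: "k \<le> 4"
  have "\<bar>y\<bar> ^ k \<le> 1 + \<bar>y\<bar> ^ 4"
  proof (cases "\<bar>y\<bar> \<le> 1")
    case True
    then have "\<bar>y\<bar> ^ k \<le> 1" by (simp add: power_le_one)
    then show ?thesis using zero_le_power[of "\<bar>y\<bar>" 4] by linarith
  next
    case False
    then have "\<bar>y\<bar> ^ k \<le> \<bar>y\<bar> ^ 4" using k by (intro power_increasing) auto
    then show ?thesis by simp
  qed
  then show ?thesis by simp
qed

text \<open>In the fourth power of \<open>Z + S\<close> the terms containing a first power vanish by
  independence and centring. The surviving cross term \<open>6 s T\<close> equals
  \<open>3 * 2 s T\<close>, which is where the 3 in \<open>3 + K\<close> comes from. The individual
  bound has the form \<open>K * (s i)^2\<close> so that rescaled variables satisfy it with the same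
  \<open>K\<close>.\<close>

lemma (in prob_space) sum_moments:
  fixes X :: "'i \<Rightarrow> 'a \<Rightarrow> real"
  assumes "finite I" "indep_vars (\<lambda>_. borel) X I"
    and int: "\<And>i. i \<in> I \<Longrightarrow> integrable M (\<lambda>x. X i x ^ 4)"
    and m1: "\<And>i. i \<in> I \<Longrightarrow> expectation (X i) = 0"
    and m2: "\<And>i. i \<in> I \<Longrightarrow> expectation (\<lambda>x. (X i x)\<^sup>2) = s i"
    and m4: "\<And>i. i \<in> I \<Longrightarrow> expectation (\<lambda>x. X i x ^ 4) \<le> K * (s i)\<^sup>2"
    and K: "0 \<le> K"
  shows "integrable M (\<lambda>x. (\<Sum>i\<in>I. X i x) ^ 4) \<and> expectation (\<lambda>x. \<Sum>i\<in>I. X i x) = 0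
    \<and> expectation (\<lambda>x. (\<Sum>i\<in>I. X i x)\<^sup>2) = (\<Sum>i\<in>I. s i)
    \<and> expectation (\<lambda>x. (\<Sum>i\<in>I. X i x) ^ 4) \<le> (3 + K) * (\<Sum>i\<in>I. s i)\<^sup>2"
  using assms(1-6)
proof (induction I rule: finite_induct)
  case empty
  then show ?case by simp
next
  case (insert i I)
  have pow: "integrable M (\<lambda>x. Z x ^ k)" if "integrable M (\<lambda>x. Z x ^ 4)" "k \<le> 4"
      "Z \<in> borel_measurable M" for Z :: "'a \<Rightarrow> real" and k
  proof (rule Bochner_Integration.integrable_bound[of _ "\<lambda>x. 1 + Z x ^ 4"])
    show "integrable M (\<lambda>x. 1 + Z x ^ 4)" using that by simp
    show "(\<lambda>x. Z x ^ k) \<in> borel_measurable M" using that by measurable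
    show "AE x in M. norm (Z x ^ k) \<le> norm (1 + Z x ^ 4)"
    proof (intro AE_I2)
      fix x
      have "\<bar>Z x\<bar> ^ k \<le> 1 + Z x ^ 4" by (rule abs_power_le_power4[OF that(2)])
      then show "norm (Z x ^ k) \<le> norm (1 + Z x ^ 4)" by (simp add: power_abs)
    qed
  qed
  define S where "S = (\<lambda>x. \<Sum>j\<in>I. X j x)"
  define T where "T = (\<Sum>j\<in>I. s j)"
  have ind: "indep_vars (\<lambda>_. borel) X I"
    by (rule indep_vars_subset[OF insert.prems(1)]) auto
  have rv: "X j \<in> borel_measurable M" if "j \<in> insert i I" for j
    using insert.prems(1) that by (auto simp: indep_vars_def)
  have Sm: "S \<in> borel_measurable M" unfolding S_def using rv by (intro borel_measurable_sum) auto
  have IH: "integrable M (\<lambda>x. S x ^ 4)" "expectation S = 0" "expectation (\<lambda>x. (S x)\<^sup>2) = T"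
     "expectation (\<lambda>x. S x ^ 4) \<le> (3 + K) * T\<^sup>2"
    using insert.IH[OF ind insert.prems(2-5)] by (auto simp: S_def T_def)
  define Z where "Z = X i"
  have Zm: "Z \<in> borel_measurable M" using rv by (simp add: Z_def)
  have Zi: "integrable M (\<lambda>x. Z x ^ 4)" using insert.prems(2) by (simp add: Z_def)
  have Z: "expectation Z = 0" "expectation (\<lambda>x. (Z x)\<^sup>2) = s i" "expectation (\<lambda>x. Z x ^ 4) \<le> K * (s i)\<^sup>2"
    using insert.prems(3-5) by (auto simp: Z_def)
  have ip: "indep_var borel Z borel S"
    unfolding Z_def S_def by (rule indep_vars_sum[OF insert.hyps insert.prems(1)])
  have prod: "integrable M (\<lambda>x. Z x ^ a * S x ^ b)"
    "expectation (\<lambda>x. Z x ^ a * S x ^ b) = expectation (\<lambda>x. Z x ^ a) * expectation (\<lambda>x. S x ^ b)"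
    if "a \<le> 4" "b \<le> 4" for a b
  proof -
    have ip': "indep_var borel (\<lambda>x. Z x ^ a) borel (\<lambda>x. S x ^ b)"
      using indep_var_compose[OF ip, of "\<lambda>z. z ^ a" borel "\<lambda>z. z ^ b" borel] by (simp add: o_def)
    show "integrable M (\<lambda>x. Z x ^ a * S x ^ b)"
      by (rule indep_var_integrable[OF ip' pow[OF Zi that(1) Zm] pow[OF IH(1) that(2) Sm]])
    show "expectation (\<lambda>x. Z x ^ a * S x ^ b) = expectation (\<lambda>x. Z x ^ a) * expectation (\<lambda>x. S x ^ b)"
      by (rule indep_var_lebesgue_integral[OF ip' pow[OF Zi that(1) Zm] pow[OF IH(1) that(2) Sm]])
  qed
  have pi: "integrable M (\<lambda>x. Z x ^ 4 * S x ^ 0)" "integrable M (\<lambda>x. Z x ^ 3 * S x ^ 1)"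
    "integrable M (\<lambda>x. Z x ^ 2 * S x ^ 2)" "integrable M (\<lambda>x. Z x ^ 1 * S x ^ 3)"
    "integrable M (\<lambda>x. Z x ^ 0 * S x ^ 4)" "integrable M (\<lambda>x. Z x ^ 2 * S x ^ 0)"
    "integrable M (\<lambda>x. Z x ^ 1 * S x ^ 1)" "integrable M (\<lambda>x. Z x ^ 0 * S x ^ 2)"
    by (rule prod; simp)+
  have sum: "(\<Sum>j\<in>insert i I. X j x) = Z x + S x" for x
    using insert.hyps by (simp add: Z_def S_def)
  have e4: "(Z x + S x) ^ 4 = Z x ^ 4 * S x ^ 0 + 4 * (Z x ^ 3 * S x ^ 1) + 6 * (Z x ^ 2 * S x ^ 2)
      + 4 * (Z x ^ 1 * S x ^ 3) + Z x ^ 0 * S x ^ 4" for x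
    by (simp add: power4_eq_xxxx power3_eq_cube power2_eq_square algebra_simps)
  have e2: "(Z x + S x)\<^sup>2 = Z x ^ 2 * S x ^ 0 + 2 * (Z x ^ 1 * S x ^ 1) + Z x ^ 0 * S x ^ 2" for x
    by (simp add: power2_eq_square algebra_simps)
  have i4: "integrable M (\<lambda>x. (Z x + S x) ^ 4)"
    unfolding e4 by (intro Bochner_Integration.integrable_add integrable_mult_right prod) auto
  have z1: "integrable M Z" "integrable M S"
    using pow[OF Zi _ Zm, of 1] pow[OF IH(1) _ Sm, of 1] by auto
  have "expectation (\<lambda>x. (Z x + S x) ^ 4) = expectation (\<lambda>x. Z x ^ 4) + 6 * s i * T + expectation (\<lambda>x. S x ^ 4)"
  proof -
    have "expectation (\<lambda>x. (Z x + S x) ^ 4) =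
      expectation (\<lambda>x. Z x ^ 4 * S x ^ 0) + 4 * expectation (\<lambda>x. Z x ^ 3 * S x ^ 1)
       + 6 * expectation (\<lambda>x. Z x ^ 2 * S x ^ 2)
      + 4 * expectation (\<lambda>x. Z x ^ 1 * S x ^ 3) + expectation (\<lambda>x. Z x ^ 0 * S x ^ 4)"
      unfolding e4
      by (simp only: Bochner_Integration.integral_add Bochner_Integration.integrable_add
          integrable_mult_right integral_mult_right_zero pi)
    then show ?thesis by (simp add: prod[of 4 0, simplified] prod[of 3 1, simplified] prod[of 2 2, simplified]
        prod[of 1 3, simplified] prod[of 1 1, simplified] Z IH)
  qed
  also have "\<dots> \<le> K * (s i)\<^sup>2 + 6 * s i * T + (3 + K) * T\<^sup>2"
    using Z(3) IH(4) by linarith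
  also have "\<dots> \<le> (3 + K) * (s i + T)\<^sup>2"
  proof -
    have "0 \<le> s i" using Z(2)[symmetric] by simp
    moreover have "0 \<le> T" using IH(3)[symmetric] by simp
    ultimately have "0 \<le> 3 * (s i)\<^sup>2 + K * (2 * (s i * T))" using K by simp
    then show ?thesis by (simp add: power2_eq_square algebra_simps)
  qed
  finally have "expectation (\<lambda>x. (Z x + S x) ^ 4) \<le> (3 + K) * (s i + T)\<^sup>2" .
  moreover have "expectation (\<lambda>x. (Z x + S x)\<^sup>2) = s i + T"
  proof -
    have "expectation (\<lambda>x. (Z x + S x)\<^sup>2) =
      expectation (\<lambda>x. Z x ^ 2 * S x ^ 0) + 2 * expectation (\<lambda>x. Z x ^ 1 * S x ^ 1)
       + expectation (\<lambda>x. Z x ^ 0 * S x ^ 2)"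
      unfolding e2
      by (simp only: Bochner_Integration.integral_add Bochner_Integration.integrable_add
          integrable_mult_right integral_mult_right_zero pi)
    then show ?thesis by (simp add: prod[of 4 0, simplified] prod[of 3 1, simplified] prod[of 2 2, simplified]
        prod[of 1 3, simplified] prod[of 1 1, simplified] Z IH)
  qed
  moreover have "expectation (\<lambda>x. Z x + S x) = 0"
    using z1 Z IH by simp
  ultimately show ?case
    using i4 insert.hyps by (simp add: sum T_def)
qed

text \<open>Large values are replaced by 0 rather than clipped, so the remainder
  \<open>y - trunc T y\<close> is either 0 or the whole entry.\<close>

definition trunc :: "real \<Rightarrow> real \<Rightarrow> real" where
  "trunc T y = (if \<bar>y\<bar> \<le> T then y else 0)"

lemma trunc_measurable [measurable]: "trunc T \<in> borel_measurable borel"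
  unfolding trunc_def[abs_def] by measurable

lemma abs_trunc_le: "0 \<le> T \<Longrightarrow> \<bar>trunc T y\<bar> \<le> T"
  by (simp add: trunc_def)

locale std_law = prob_space D for D :: "real measure" +
  assumes sets_D [measurable_cong]: "sets D = sets borel"
    and int4: "integrable D (\<lambda>x. x ^ 4)"
    and mean: "(\<integral>x. x \<partial>D) = 0"
    and second: "(\<integral>x. x\<^sup>2 \<partial>D) = 1"
begin

text \<open>In terms of the excess \<tau> in (C3) this is \<tau> + 3; the cut-off level called
  \<open>tau\<close> below is unrelated.\<close>

definition kappa :: real where "kappa = (\<integral>x. x ^ 4 \<partial>D)"

abbreviation col_law :: "nat \<Rightarrow> (nat \<Rightarrow> real) measure" where
  "col_law n \<equiv> PiM {..<n} (\<lambda>_. D)"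

lemma space_D [simp]: "space D = UNIV"
  using sets_eq_imp_space_eq[OF sets_D] by simp

lemma prob_space_D: "prob_space D" by unfold_locales

lemma prob_space_col: "prob_space (col_law n)"
  by (rule prob_space_PiM) (rule prob_space_D)

lemma kappa_nonneg: "0 \<le> kappa"
  by (simp add: kappa_def)

lemma measurable_coord: "t \<in> I \<Longrightarrow> (\<lambda>x. x t) \<in> borel_measurable (PiM I (\<lambda>_. D))"
  using measurable_component_singleton[of t I "\<lambda>_. D"] by (simp cong: measurable_cong_sets add: sets_D)

lemma integrable_le4:
  assumes [measurable]: "f \<in> borel_measurable borel" and "\<And>y. \<bar>f y\<bar> \<le> c * (1 + y ^ 4)"
  shows "integrable D f"
proof (rule Bochner_Integration.integrable_bound[of _ "\<lambda>x. c * (1 + x ^ 4)"])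
  show "integrable D (\<lambda>x. c * (1 + x ^ 4))" using int4 by simp
  show "AE x in D. norm (f x) \<le> norm (c * (1 + x ^ 4))"
    using assms(2) by (intro AE_I2) (smt (verit) real_norm_def)
qed measurable

lemma integrable_power: "k \<le> 4 \<Longrightarrow> integrable D (\<lambda>x. x ^ k)"
  by (rule integrable_le4[of _ 1]) (use abs_power_le_power4 in \<open>auto simp: power_abs\<close>)

lemma integrable_id: "integrable D (\<lambda>x. x)"
  using integrable_power[of 1] by simp

lemma integrable_trunc: "0 \<le> T \<Longrightarrow> integrable D (trunc T)"
  by (rule integrable_const_bound[of _ T]) (auto simp: abs_trunc_le)

lemma integrable_trunc_sq: "integrable D (\<lambda>y. (trunc T y)\<^sup>2)"
  by (rule integrable_le4[of _ 1]) (use abs_power_le_power4[of 2] in \<open>auto simp: trunc_def add_nonneg_nonneg\<close>)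

lemma integrable_trunc_4: "integrable D (\<lambda>y. (trunc T y) ^ 4)"
  by (rule integrable_le4[of _ 1]) (auto simp: trunc_def)

lemma tail_power:
  fixes T y :: real
  assumes "T > 0" "\<bar>y\<bar> > T" "k \<le> 4" shows "\<bar>y\<bar> ^ k \<le> y ^ 4 / T ^ (4 - k)"
proof -
  have "\<bar>y\<bar> ^ k * T ^ (4 - k) \<le> \<bar>y\<bar> ^ k * \<bar>y\<bar> ^ (4 - k)"
    using assms by (intro mult_left_mono power_mono) auto
  also have "\<dots> = y ^ 4" using assms(3) by (simp add: power_add[symmetric])
  finally show ?thesis using assms(1) by (simp add: field_simps)
qed

lemma trunc_mean:
  assumes "T > 0" shows "\<bar>\<integral>y. trunc T y \<partial>D\<bar> \<le> kappa / T ^ 3"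
proof -
  have "(\<integral>y. trunc T y \<partial>D) = (\<integral>y. trunc T y - y \<partial>D)"
    using integrable_trunc[of T] assms integrable_id mean by simp
  also have "\<bar>\<dots>\<bar> \<le> (\<integral>y. \<bar>trunc T y - y\<bar> \<partial>D)"
    by (rule integral_abs_bound)
  also have "\<dots> \<le> (\<integral>y. y ^ 4 / T ^ 3 \<partial>D)"
  proof (rule integral_mono)
    show "integrable D (\<lambda>y. \<bar>trunc T y - y\<bar>)"
      using integrable_trunc[of T] assms integrable_id by simp
    show "integrable D (\<lambda>y. y ^ 4 / T ^ 3)" using int4 by simp
    fix y show "\<bar>trunc T y - y\<bar> \<le> y ^ 4 / T ^ 3"
      using tail_power[OF assms, of y 1] assms by (auto simp: trunc_def)
  qed
  finally show ?thesis by (simp add: kappa_def)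
qed

lemma trunc_sq_le: "(\<integral>y. (trunc T y)\<^sup>2 \<partial>D) \<le> 1"
proof -
  have "(\<integral>y. (trunc T y)\<^sup>2 \<partial>D) \<le> (\<integral>y. y\<^sup>2 \<partial>D)"
    by (rule integral_mono[OF integrable_trunc_sq integrable_power]) (auto simp: trunc_def)
  then show ?thesis by (simp add: second)
qed

lemma trunc_sq_ge:
  assumes "T > 0" shows "1 - kappa / T\<^sup>2 \<le> (\<integral>y. (trunc T y)\<^sup>2 \<partial>D)"
proof -
  have "(\<integral>y. y\<^sup>2 - y ^ 4 / T\<^sup>2 \<partial>D) \<le> (\<integral>y. (trunc T y)\<^sup>2 \<partial>D)"
  proof (rule integral_mono[OF _ integrable_trunc_sq])
    show "integrable D (\<lambda>y. y\<^sup>2 - y ^ 4 / T\<^sup>2)" using int4 integrable_power[of 2] by simp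
    fix y show "y\<^sup>2 - y ^ 4 / T\<^sup>2 \<le> (trunc T y)\<^sup>2"
      using tail_power[OF assms, of y 2] assms by (auto simp: trunc_def)
  qed
  then show ?thesis using int4 integrable_power[of 2] by (simp add: second kappa_def)
qed

lemma trunc_4_le: "(\<integral>y. (trunc T y) ^ 4 \<partial>D) \<le> kappa"
  unfolding kappa_def
  by (rule integral_mono[OF integrable_trunc_4 int4]) (auto simp: trunc_def)

text \<open>The truncation level \<open>n\<^sup>3\<^sup>/\<^sup>1\<^sup>0\<close> lies above \<open>n\<^sup>1\<^sup>/\<^sup>4\<close>, so that by the fourth moment a column has only few
  larger entries; it is small enough that its product with the bound \<open>n\<^sup>2\<^sup>/\<^sup>5\<close> for linear forms is \<open>o(n)\<close>.\<close>
lemma linear_form_bound: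
  assumes n: "1 \<le> n" and a: "(\<Sum>l<n. (a l)\<^sup>2) \<le> 1"
  shows "measure (col_law n) {x \<in> space (col_law n).
     real n powr (2/5) < \<bar>\<Sum>l<n. a l * trunc (real n powr (3/10)) (x l)\<bar>}
     \<le> 2 * exp (kappa + 3 - real n powr (1/10))"
proof -
  define T where "T = real n powr (3/10)"
  \<comment> \<open>The exponent is the reciprocal of the truncation level, so
    \<open>exp (L * T)\<close> is constant while \<open>L * n powr (2/5)\<close> still grows like
    \<open>n powr (1/10)\<close>.\<close>
  define L where "L = real n powr (-3/10)"
  have n0: "real n > 0" "1 \<le> real n" using n by auto
  have T: "T > 0" using n by (simp add: T_def)
  have T3: "T ^ 3 = real n powr (9/10)"
    using n0 by (simp add: T_def powr_power)
  have LT: "L * T = 1" using n0 by (simp add: L_def T_def powr_add[symmetric])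
  have L0: "0 \<le> L" by (simp add: L_def)
  have L1: "L \<le> 1" using powr_mono[of "-3/10" 0 "real n"] n0 by (simp add: L_def)
  have abs1: "\<bar>a t\<bar> \<le> 1" if "t < n" for t
  proof -
    have "(a t)\<^sup>2 \<le> (\<Sum>l<n. (a l)\<^sup>2)" using that by (intro member_le_sum) auto
    with a have "(a t)\<^sup>2 \<le> 1" by simp
    then show ?thesis by (simp add: abs_square_le_1)
  qed
  have "measure (col_law n) {x \<in> space (col_law n). real n powr (2/5) < \<bar>\<Sum>t<n. a t * trunc T (x t)\<bar>} \<le>
    2 * exp (L * (\<Sum>t<n. \<bar>a t\<bar> * (kappa / T ^ 3)) + L\<^sup>2 * exp (L * T) * (\<Sum>t<n. (a t)\<^sup>2)
      - L * real n powr (2/5))"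
  proof (rule chernoff_seq[OF prob_space_D _ _ _ _ _ L0])
    fix t x assume t: "t < n"
    have "(\<lambda>x. x t) \<in> borel_measurable (col_law (Suc t))"
      by (rule measurable_coord) simp
    then show "(\<lambda>x. a t * trunc T (x t)) \<in> borel_measurable (col_law (Suc t))"
      by measurable
    show "a t * trunc T (x t) = a t * trunc T (restrict x {..<Suc t} t)" by simp
  next
    fix t x y assume t: "t < n"
    show "\<bar>a t * trunc T ((x(t := y)) t)\<bar> \<le> T"
      using mult_mono[OF abs1[OF t] abs_trunc_le[of T y]] T by (simp add: abs_mult)
  next
    fix t x assume t: "t < n"
    show "\<bar>\<integral>y. a t * trunc T ((x(t := y)) t) \<partial>D\<bar> \<le> \<bar>a t\<bar> * (kappa / T ^ 3)"
      using mult_left_mono[OF trunc_mean[OF T], of "\<bar>a t\<bar>"] by (simp add: abs_mult)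
    show "(\<integral>y. (a t * trunc T ((x(t := y)) t))\<^sup>2 \<partial>D) \<le> (a t)\<^sup>2"
      using mult_left_mono[OF trunc_sq_le[of T], of "(a t)\<^sup>2"] by (simp add: power_mult_distrib)
  qed
  also have "\<dots> \<le> 2 * exp (kappa + 3 - real n powr (1/10))"
  proof -
    \<comment> \<open>The crude bound \<open>\<bar>a t\<bar> \<le> 1\<close> is good enough here:
      the bias per entry is of order \<open>1 / T^3\<close>, and
      \<open>L * n / T^3 = n powr (-1/5)\<close>.\<close>
    have "(\<Sum>t<n. \<bar>a t\<bar> * (kappa / T ^ 3)) \<le> (\<Sum>t<n. 1 * (kappa / T ^ 3))"
      using T kappa_nonneg by (intro sum_mono mult_right_mono abs1) auto
    also have "\<dots> = kappa * real n powr (1/10)"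
      unfolding T3 using n0 by (simp add: powr_diff[symmetric] field_simps flip: powr_one) (simp add: powr_add[symmetric])
    finally have "L * (\<Sum>t<n. \<bar>a t\<bar> * (kappa / T ^ 3)) \<le> L * (kappa * real n powr (1/10))"
      using L0 by (rule mult_left_mono)
    also have "\<dots> = kappa * real n powr (-1/5)"
      using n0 by (simp add: L_def powr_add[symmetric] mult.left_commute)
    also have "\<dots> \<le> kappa * 1"
      using n0 kappa_nonneg by (intro mult_left_mono) (use powr_mono[of "-1/5" 0 "real n"] in auto)
    finally have 1: "L * (\<Sum>t<n. \<bar>a t\<bar> * (kappa / T ^ 3)) \<le> kappa" by simp
    have "L\<^sup>2 * exp (L * T) * (\<Sum>t<n. (a t)\<^sup>2) \<le> 1 * 3 * 1"
      unfolding LT using exp_le L0 L1 a by (intro mult_mono) (auto simp: sum_nonneg power_le_one)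
    moreover have "L * real n powr (2/5) = real n powr (1/10)"
      using n0 by (simp add: L_def powr_add[symmetric])
    ultimately show ?thesis using 1 by simp
  qed
  finally show ?thesis by (simp add: T_def)
qed

text \<open>Beyond \<open>T\<close> the squares have mean at most \<open>kappa / T\<^sup>2\<close>,
  which for \<open>T = n^(3/10)\<close> adds up to \<open>O(n^(2/5))\<close> in a column, far below
  a multiple of \<open>n\<close>. A single square may be as large as \<open>tau\<^sup>2\<close>,
  which will be of order \<open>n\<close>. Hence \<open>l\<close> must be of order
  \<open>log n / n\<close>, and the probability is only polynomially small; this is affordable
  because there is one such event per column and none per variable.\<close>

lemma spike_bound:
  assumes T: "0 < T" and tau: "0 \<le> tau" and l: "0 \<le> l"
  shows "measure (col_law n) {x \<in> space (col_law n).
     z < (\<Sum>t<n. if T < \<bar>x t\<bar> \<and> \<bar>x t\<bar> \<le> tau then (x t)\<^sup>2 else 0)}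
     \<le> exp (l * (real n * (kappa / T\<^sup>2)) + l\<^sup>2 * exp (l * tau\<^sup>2) * (real n * kappa) - l * z)"
proof -
  define g where "g y = (if T < \<bar>y\<bar> \<and> \<bar>y\<bar> \<le> tau then y\<^sup>2 else 0)" for y :: real
  have gm [measurable]: "g \<in> borel_measurable borel" unfolding g_def[abs_def] by measurable
  have g4: "\<bar>g y\<bar> \<le> 1 * (1 + y ^ 4)" "\<bar>(g y)\<^sup>2\<bar> \<le> 1 * (1 + y ^ 4)" for y
    using abs_power_le_power4[of 2 y] by (auto simp: g_def add_nonneg_nonneg)
  have "measure (col_law n) {x \<in> space (col_law n). z < (\<Sum>t<n. g (x t))}
    \<le> exp (l * (\<Sum>t<n. kappa / T\<^sup>2) + l\<^sup>2 * exp (l * tau\<^sup>2) * (\<Sum>t<n. kappa) - l * z)"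
  proof (rule chernoff_one_sided[OF prob_space_D _ _ _ _ _ l])
    fix t x assume t: "t < n"
    have "(\<lambda>x. x t) \<in> borel_measurable (col_law (Suc t))"
      by (rule measurable_coord) simp
    then show "(\<lambda>x. g (x t)) \<in> borel_measurable (col_law (Suc t))"
      by measurable
    show "g (x t) = g (restrict x {..<Suc t} t)" by simp
  next
    fix t x y assume t: "t < n"
    show "\<bar>g ((x(t := y)) t)\<bar> \<le> tau\<^sup>2"
      using tau by (auto simp: g_def abs_le_square_iff[symmetric])
  next
    fix t x assume t: "t < n"
    have "(\<integral>y. g y \<partial>D) \<le> (\<integral>y. y ^ 4 / T\<^sup>2 \<partial>D)"
      using int4 tail_power[OF T, of _ 2]
      by (intro integral_mono integrable_le4[OF gm g4(1)]) (auto simp: g_def)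
    then show "(\<integral>y. g ((x(t := y)) t) \<partial>D) \<le> kappa / T\<^sup>2"
      by (simp add: kappa_def)
    have "(\<integral>y. (g y)\<^sup>2 \<partial>D) \<le> (\<integral>y. y ^ 4 \<partial>D)"
      using int4 
      by (intro integral_mono integrable_le4[OF _ g4(2)]) (auto simp: g_def)
    then show "(\<integral>y. (g ((x(t := y)) t))\<^sup>2 \<partial>D) \<le> kappa"
      by (simp add: kappa_def)
  qed
  then show ?thesis by (simp add: g_def)
qed

end

section \<open>Quadratic forms and martingale increments\<close>

text \<open>Orders the off-diagonal part so that each entry is multiplied by a combination of
  earlier entries only, as a martingale argument requires.\<close>

lemma sum_sym_split:
  fixes R :: "nat \<Rightarrow> nat \<Rightarrow> real"
  assumes "\<And>a b. a < n \<Longrightarrow> b < n \<Longrightarrow> R a b = R b a"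
  shows "(\<Sum>l<n. x l * (\<Sum>m<n. R l m * x m)) =
    (\<Sum>l<n. R l l * (x l)\<^sup>2 + 2 * x l * (\<Sum>m<l. R l m * x m))"
  using assms
proof (induction n)
  case (Suc n)
  have IH: "(\<Sum>l<n. x l * (\<Sum>m<n. R l m * x m)) =
    (\<Sum>l<n. R l l * (x l)\<^sup>2 + 2 * x l * (\<Sum>m<l. R l m * x m))"
    using Suc by simp
  have "(\<Sum>l<n. x l * (R l n * x n)) = x n * (\<Sum>m<n. R n m * x m)"
    unfolding sum_distrib_left using Suc.prems by (intro sum.cong refl) auto
  then have "(\<Sum>l<Suc n. x l * (\<Sum>m<Suc n. R l m * x m)) =
     (\<Sum>l<n. x l * (\<Sum>m<n. R l m * x m)) + x n * (\<Sum>m<n. R n m * x m)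
      + (x n * (\<Sum>m<n. R n m * x m) + x n * (R n n * x n))"
    by (simp add: distrib_left sum.distrib)
  then show ?case unfolding IH by (simp add: power2_eq_square)
qed simp

lemma orth_proj_row:
  assumes "orth_proj n R" "t < n"
  shows "(\<Sum>m<n. (R t m)\<^sup>2) = R t t" "0 \<le> R t t" "R t t \<le> 1"
proof -
  have "(\<Sum>m<n. (R t m)\<^sup>2) = (\<Sum>m<n. R t m * R m t)"
    unfolding power2_eq_square by (intro sum.cong refl) (use assms orth_projD_sym in auto)
  then show 1: "(\<Sum>m<n. (R t m)\<^sup>2) = R t t"
    using orth_projD_idem[OF assms(1,2,2)] by simp
  then show 0: "0 \<le> R t t" by (metis sum_nonneg zero_le_power2)
  have "(R t t)\<^sup>2 \<le> (\<Sum>m<n. (R t m)\<^sup>2)" using assms(2) by (intro member_le_sum) auto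
  then have "R t t * R t t \<le> 1 * R t t" using 1 by (simp add: power2_eq_square)
  then show "R t t \<le> 1" using 0 by (cases "R t t = 0") (auto simp: mult_le_cancel_right)
qed

context std_law begin

text \<open>The off-diagonal part is a martingale in the entries of the column: entry \<open>t\<close> is multiplied by a linear
  form \<open>beta t\<close> in the earlier entries, which is itself small by the bound for linear forms.\<close>
lemma quad_form_bound:
  assumes n: "1 \<le> n" and R: "orth_proj n R"
  defines "T \<equiv> real n powr (3/10)"
  shows "measure (col_law n) {x \<in> space (col_law n).
     \<epsilon> * real n < \<bar>ip n (\<lambda>l. trunc T (x l)) (mv n R (\<lambda>l. trunc T (x l))) - tr n R\<bar>}
     \<le> 2 * exp (3 * kappa + exp 4 * (2 * kappa + 10) - \<epsilon> * real n powr (1/20))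
       + real n * (2 * exp (kappa + 3 - real n powr (1/10)))"
proof -
  interpret C: prob_space "col_law n" by (rule prob_space_col)
  have n0: "real n > 0" "1 \<le> real n" using n by auto
  have T: "T > 0" "0 \<le> T" using n by (simp_all add: T_def)
  define H where "H = real n powr (2/5)"
  have H0: "0 \<le> H" by (simp add: H_def)
  define beta where "beta t x = (\<Sum>m<t. R t m * trunc T (x m))" for t x
  \<comment> \<open>The cut-off bounds the summands for every past. Where all the linear forms are
    at most \<open>H\<close> it has no effect, and the \<open>S t\<close> then add up to the
    quadratic form minus its trace; the complement is charged to the bound for linear forms.\<close>
  define c where "c t x = (if \<bar>beta t x\<bar> \<le> H then beta t x else 0)" for t x
  define S where "S t x = R t t * ((trunc T (x t))\<^sup>2 - 1) + 2 * trunc T (x t) * c t x" for t x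
  have cH: "\<bar>c t x\<bar> \<le> H" for t x using H0 by (simp add: c_def)
  have mx: "(\<lambda>x. x t) \<in> borel_measurable (col_law m)" if "t < m" for t m
    by (rule measurable_coord) (use that in simp)
  have mbeta: "beta t \<in> borel_measurable (col_law m)" if "t \<le> m" for t m
    unfolding beta_def[abs_def]
    by (intro borel_measurable_sum borel_measurable_times borel_measurable_const
        measurable_compose[OF mx trunc_measurable]) (use that in auto)
  have mS: "S t \<in> borel_measurable (col_law m)" if "t < m" for t m
  proof -
    note [measurable] = mx[OF that] mbeta[OF less_imp_le[OF that]]
    show ?thesis unfolding S_def[abs_def] c_def[abs_def] by measurable
  qed
  define bd where "bd = 4 * real n powr (7/10)"
  \<comment> \<open>The exponent -19/20 is halfway between -1, below which the gain
    \<open>L * (\<epsilon> * real n)\<close> would no longer grow, and -9/10, above which the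
    variance term of order \<open>L\<^sup>2 * n * H\<^sup>2\<close> would. With this choice
    \<open>L * bd\<close> stays bounded too.\<close>
  define L where "L = real n powr (-19/20)"
  have pw: "real n powr s \<le> real n powr s'" if "s \<le> s'" for s s'
    using n0 that by (intro powr_mono) auto
  have T2: "T\<^sup>2 = real n powr (3/5)" and T3: "T ^ 3 = real n powr (9/10)"
    using n0 by (simp_all add: T_def powr_power)
  have TH: "T * H = real n powr (7/10)"
    by (simp add: T_def H_def powr_add[symmetric])
  have H2: "H\<^sup>2 = real n powr (4/5)" using n0 by (simp add: H_def powr_power)
  have A: "measure (col_law n) {x \<in> space (col_law n). \<epsilon> * real n < \<bar>\<Sum>t<n. S t x\<bar>} \<le>
     2 * exp (L * (\<Sum>t<n. 3 * kappa * real n powr (-1/2)) +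
       L\<^sup>2 * exp (L * bd) * (\<Sum>t<n. (2 * kappa + 10) * real n powr (4/5)) - L * (\<epsilon> * real n))"
  proof (rule chernoff_seq[OF prob_space_D])
    show "0 \<le> L" by (simp add: L_def)
    fix t assume t: "t < n"
    note r = orth_proj_row(2,3)[OF R t]
    show "S t \<in> borel_measurable (col_law (Suc t))" by (rule mS) simp
    fix x
    show "S t x = S t (restrict x {..<Suc t})"
      by (simp add: S_def c_def beta_def)
    have upd: "S t (x(t := y)) = R t t * ((trunc T y)\<^sup>2 - 1) + 2 * trunc T y * c t x" for y
      by (simp add: S_def c_def beta_def)
    note c = cH[of t x]
    show "\<bar>S t (x(t := y))\<bar> \<le> bd" for y
    proof -
      have y2: "(trunc T y)\<^sup>2 \<le> T\<^sup>2"
        using abs_trunc_le[OF T(2), of y] T by (simp add: abs_le_square_iff[symmetric])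
      have "\<bar>(trunc T y)\<^sup>2 - 1\<bar> \<le> T\<^sup>2 + 1"
        using y2 zero_le_power2[of "trunc T y"] by linarith
      then have "\<bar>R t t * ((trunc T y)\<^sup>2 - 1)\<bar> \<le> 1 * (T\<^sup>2 + 1)"
        unfolding abs_mult using r by (intro mult_mono) auto
      also have "\<dots> \<le> 2 * real n powr (7/10)"
        using pw[of "3/5" "7/10"] pw[of 0 "7/10"] n0 by (simp add: T2)
      finally have 1: "\<bar>R t t * ((trunc T y)\<^sup>2 - 1)\<bar> \<le> 2 * real n powr (7/10)" .
      have "\<bar>trunc T y * c t x\<bar> \<le> T * H"
        unfolding abs_mult using abs_trunc_le[OF T(2), of y] c T by (intro mult_mono) auto
      then have "\<bar>2 * trunc T y * c t x\<bar> \<le> 2 * real n powr (7/10)"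
        by (simp add: TH abs_mult)
      with 1 show ?thesis unfolding upd bd_def by linarith
    qed
    have ints: "integrable D (\<lambda>y. R t t * ((trunc T y)\<^sup>2 - 1))" "integrable D (\<lambda>y. 2 * trunc T y * c t x)"
      using integrable_trunc[OF T(2)] integrable_trunc_sq by auto
    show "\<bar>\<integral>y. S t (x(t := y)) \<partial>D\<bar> \<le> 3 * kappa * real n powr (-1/2)"
    proof -
      have "(\<integral>y. S t (x(t := y)) \<partial>D) =
          R t t * ((\<integral>y. (trunc T y)\<^sup>2 \<partial>D) - 1) + 2 * c t x * (\<integral>y. trunc T y \<partial>D)"
        unfolding upd using ints integrable_trunc[OF T(2)] integrable_trunc_sq[of T]
        by (simp add: prob_space[unfolded space_D])
      also have "\<bar>\<dots>\<bar> \<le> \<bar>R t t * ((\<integral>y. (trunc T y)\<^sup>2 \<partial>D) - 1)\<bar> + \<bar>2 * c t x * (\<integral>y. trunc T y \<partial>D)\<bar>"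
        by (rule abs_triangle_ineq)
      also have "\<bar>R t t * ((\<integral>y. (trunc T y)\<^sup>2 \<partial>D) - 1)\<bar> \<le> 1 * (kappa / T\<^sup>2)"
        unfolding abs_mult using r trunc_sq_ge[OF T(1)] trunc_sq_le[of T]
        by (intro mult_mono) auto
      also have "kappa / T\<^sup>2 \<le> kappa * real n powr (-1/2)"
        unfolding T2 using mult_left_mono[OF pw[of "-3/5" "-1/2"] kappa_nonneg]
        by (simp add: powr_minus field_simps)
      also have "\<bar>2 * c t x * (\<integral>y. trunc T y \<partial>D)\<bar> \<le> (2 * H) * (kappa / T ^ 3)"
        unfolding abs_mult using c trunc_mean[OF T(1)] H0 by (intro mult_mono) auto
      also have "(2 * H) * (kappa / T ^ 3) = 2 * kappa * real n powr (-1/2)"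
      proof -
        have "H / T ^ 3 = real n powr (-1/2)"
          unfolding T3 H_def by (simp add: powr_diff[symmetric])
        moreover have "(2 * H) * (kappa / T ^ 3) = 2 * kappa * (H / T ^ 3)" by simp
        ultimately show ?thesis by simp
      qed
      finally show ?thesis by (simp del: fun_upd_apply)
    qed
    show "(\<integral>y. (S t (x(t := y)))\<^sup>2 \<partial>D) \<le> (2 * kappa + 10) * real n powr (4/5)"
    proof -
      have le: "(S t (x(t := y)))\<^sup>2 \<le> 2 * ((trunc T y) ^ 4 + 1) + 8 * H\<^sup>2 * (trunc T y)\<^sup>2" for y
      proof -
        define u where "u = trunc T y"
        have "(R t t * (u\<^sup>2 - 1))\<^sup>2 \<le> 1 * (u\<^sup>2 - 1)\<^sup>2"
          unfolding power_mult_distrib using r by (intro mult_right_mono) (auto simp: power_le_one)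
        also have "\<dots> \<le> u ^ 4 + 1"
          by (simp add: power2_eq_square power4_eq_xxxx algebra_simps)
        finally have 1: "(R t t * (u\<^sup>2 - 1))\<^sup>2 \<le> u ^ 4 + 1" .
        have "(c t x)\<^sup>2 \<le> H\<^sup>2" using c H0 by (simp add: abs_le_square_iff[symmetric])
        then have 2: "(2 * u * c t x)\<^sup>2 \<le> 4 * H\<^sup>2 * u\<^sup>2"
          using mult_left_mono[of "(c t x)\<^sup>2" "H\<^sup>2" "4 * u\<^sup>2"] by (simp add: power_mult_distrib mult_ac)
        note 3 = power2_add_le[of "R t t * (u\<^sup>2 - 1)" "2 * u * c t x"]
        have "P \<le> 2 * P' + 2 * P'' \<Longrightarrow> P' \<le> U \<Longrightarrow> P'' \<le> U' \<Longrightarrow> P \<le> 2 * U + 2 * U'"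
          for P P' P'' U U' :: real by linarith
        from this[OF 3 1 2] show ?thesis
          unfolding upd u_def[symmetric] by (simp add: mult.assoc[symmetric])
      qed
      have i: "integrable D (\<lambda>y. 2 * ((trunc T y) ^ 4 + 1) + 8 * H\<^sup>2 * (trunc T y)\<^sup>2)"
        using integrable_trunc_4 integrable_trunc_sq by simp
      have "(\<integral>y. (S t (x(t := y)))\<^sup>2 \<partial>D) \<le> (\<integral>y. 2 * ((trunc T y) ^ 4 + 1) + 8 * H\<^sup>2 * (trunc T y)\<^sup>2 \<partial>D)"
        by (rule integral_mono'[OF i le]) simp
      also have "\<dots> = 2 * ((\<integral>y. (trunc T y) ^ 4 \<partial>D) + 1) + 8 * H\<^sup>2 * (\<integral>y. (trunc T y)\<^sup>2 \<partial>D)"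
        using integrable_trunc_4 integrable_trunc_sq by (simp add: prob_space[unfolded space_D])
      also have "\<dots> \<le> 2 * (kappa + 1) + 8 * H\<^sup>2 * 1"
        using trunc_4_le trunc_sq_le by (intro add_mono mult_left_mono) auto
      also have "\<dots> \<le> (2 * kappa + 2) * real n powr (4/5) + 8 * real n powr (4/5)"
        using pw[of 0 "4/5"] n0 kappa_nonneg by (simp add: H2 mult_le_cancel_left1)
      finally show ?thesis by (simp add: algebra_simps)
    qed
  qed
  also have "\<dots> \<le> 2 * exp (3 * kappa + exp 4 * (2 * kappa + 10) - \<epsilon> * real n powr (1/20))"
  proof -
    have n1: "real n * real n powr s = real n powr (1 + s)" for s
      using n0 by (simp add: powr_add)
    have "L * (\<Sum>t<n. 3 * kappa * real n powr (-1/2)) = 3 * kappa * (L * (real n * real n powr (-1/2)))"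
      by simp
    also have "L * (real n * real n powr (-1/2)) = real n powr (-9/20)"
      unfolding n1 L_def powr_add[symmetric] by simp
    also have "3 * kappa * real n powr (-9/20) \<le> 3 * kappa * 1"
      using pw[of "-9/20" 0] n0 kappa_nonneg by (intro mult_left_mono) auto
    finally have 1: "L * (\<Sum>t<n. 3 * kappa * real n powr (-1/2)) \<le> 3 * kappa" by simp
    have "L * bd = 4 * real n powr (-1/4)"
      by (simp add: L_def bd_def powr_add[symmetric])
    also have "\<dots> \<le> 4" using pw[of "-1/4" 0] n0 by simp
    finally have e: "exp (L * bd) \<le> exp 4" by simp
    have L2: "L\<^sup>2 = real n powr (-19/10)" using n0 by (simp add: L_def powr_power)
    have "L\<^sup>2 * exp (L * bd) * (\<Sum>t<n. (2 * kappa + 10) * real n powr (4/5)) =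
       (L\<^sup>2 * (real n * real n powr (4/5))) * (exp (L * bd) * (2 * kappa + 10))"
      by simp
    also have "L\<^sup>2 * (real n * real n powr (4/5)) = real n powr (-1/10)"
      unfolding n1 L2 powr_add[symmetric] by simp
    also have "real n powr (-1/10) * (exp (L * bd) * (2 * kappa + 10)) \<le> 1 * (exp 4 * (2 * kappa + 10))"
      using e pw[of "-1/10" 0] n0 kappa_nonneg by (intro mult_mono mult_right_mono) auto
    finally have 2: "L\<^sup>2 * exp (L * bd) * (\<Sum>t<n. (2 * kappa + 10) * real n powr (4/5)) \<le> exp 4 * (2 * kappa + 10)"
      by simp
    have 3: "L * (\<epsilon> * real n) = \<epsilon> * real n powr (1/20)"
      unfolding L_def using n1[of "-19/20"] by (simp add: mult_ac)
    show ?thesis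
      by (rule mult_left_mono, subst exp_le_cancel_iff) (use 1 2 3 in linarith, simp)
  qed
  finally have A: "measure (col_law n) {x \<in> space (col_law n). \<epsilon> * real n < \<bar>\<Sum>t<n. S t x\<bar>} \<le>
     2 * exp (3 * kappa + exp 4 * (2 * kappa + 10) - \<epsilon> * real n powr (1/20))" .
  have Bt: "measure (col_law n) {x \<in> space (col_law n). H < \<bar>beta t x\<bar>} \<le> 2 * exp (kappa + 3 - real n powr (1/10))"
    if t: "t < n" for t
  proof -
    \<comment> \<open>Padding with zeros turns \<open>beta t\<close> into a form of full length
      \<open>n\<close>. Its squared norm is at most the diagonal entry of the projection, hence at
      most 1.\<close>
    define a where "a l = (if l < t then R t l else 0)" for l
    have "(\<Sum>l<n. (a l)\<^sup>2) \<le> (\<Sum>l<n. (R t l)\<^sup>2)"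
      by (intro sum_mono) (simp add: a_def)
    also have "\<dots> \<le> 1" using orth_proj_row[OF R t] by simp
    finally have "(\<Sum>l<n. (a l)\<^sup>2) \<le> 1" .
    from linear_form_bound[OF n this]
    have "measure (col_law n) {x \<in> space (col_law n). H < \<bar>\<Sum>l<n. a l * trunc T (x l)\<bar>}
       \<le> 2 * exp (kappa + 3 - real n powr (1/10))" by (simp add: H_def T_def)
    also have "(\<lambda>x. \<Sum>l<n. a l * trunc T (x l)) = beta t"
    proof
      fix x
      have "(\<Sum>l<n. a l * trunc T (x l)) = (\<Sum>l\<in>{..<t}. a l * trunc T (x l))"
        using t by (intro sum.mono_neutral_right) (auto simp: a_def)
      then show "(\<Sum>l<n. a l * trunc T (x l)) = beta t x"
        by (simp add: beta_def a_def)
    qed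
    finally show ?thesis .
  qed
  have qs: "ip n (\<lambda>l. trunc T (x l)) (mv n R (\<lambda>l. trunc T (x l))) - tr n R = (\<Sum>t<n. S t x)"
    if "\<And>t. t < n \<Longrightarrow> \<bar>beta t x\<bar> \<le> H" for x
  proof -
    have "ip n (\<lambda>l. trunc T (x l)) (mv n R (\<lambda>l. trunc T (x l))) =
      (\<Sum>l<n. R l l * (trunc T (x l))\<^sup>2 + 2 * trunc T (x l) * beta l x)"
      unfolding ip_def mv_def beta_def by (rule sum_sym_split) (use orth_projD_sym[OF R] in auto)
    then show ?thesis
      using that by (simp add: tr_def S_def c_def algebra_simps sum.distrib sum_subtractf)
  qed
  have "measure (col_law n) {x \<in> space (col_law n).
     \<epsilon> * real n < \<bar>ip n (\<lambda>l. trunc T (x l)) (mv n R (\<lambda>l. trunc T (x l))) - tr n R\<bar>} \<le>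
    measure (col_law n) ({x \<in> space (col_law n). \<epsilon> * real n < \<bar>\<Sum>t<n. S t x\<bar>} \<union>
      (\<Union>t\<in>{..<n}. {x \<in> space (col_law n). H < \<bar>beta t x\<bar>}))"
  proof (rule C.finite_measure_mono)
    note [measurable] = mS mbeta[OF less_imp_le]
    show "{x \<in> space (col_law n). \<epsilon> * real n < \<bar>\<Sum>t<n. S t x\<bar>} \<union>
      (\<Union>t\<in>{..<n}. {x \<in> space (col_law n). H < \<bar>beta t x\<bar>}) \<in> sets (col_law n)"
      by measurable
    show "{x \<in> space (col_law n).
     \<epsilon> * real n < \<bar>ip n (\<lambda>l. trunc T (x l)) (mv n R (\<lambda>l. trunc T (x l))) - tr n R\<bar>} \<subseteq>
     {x \<in> space (col_law n). \<epsilon> * real n < \<bar>\<Sum>t<n. S t x\<bar>} \<union>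
      (\<Union>t\<in>{..<n}. {x \<in> space (col_law n). H < \<bar>beta t x\<bar>})"
      using qs by (auto simp: not_less)
  qed
  also have "\<dots> \<le> measure (col_law n) {x \<in> space (col_law n). \<epsilon> * real n < \<bar>\<Sum>t<n. S t x\<bar>} +
      measure (col_law n) (\<Union>t\<in>{..<n}. {x \<in> space (col_law n). H < \<bar>beta t x\<bar>})"
  proof (rule measure_Un_le)
    note [measurable] = mS mbeta[OF less_imp_le]
    show "{x \<in> space (col_law n). \<epsilon> * real n < \<bar>\<Sum>t<n. S t x\<bar>} \<in> sets (col_law n)" by measurable
    show "(\<Union>t\<in>{..<n}. {x \<in> space (col_law n). H < \<bar>beta t x\<bar>}) \<in> sets (col_law n)" by measurable
  qed
  also have "measure (col_law n) (\<Union>t\<in>{..<n}. {x \<in> space (col_law n). H < \<bar>beta t x\<bar>}) \<le>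
     (\<Sum>t<n. measure (col_law n) {x \<in> space (col_law n). H < \<bar>beta t x\<bar>})"
  proof (rule C.finite_measure_subadditive_finite)
    note [measurable] = mbeta[OF less_imp_le]
    show "(\<lambda>t. {x \<in> space (col_law n). H < \<bar>beta t x\<bar>}) ` {..<n} \<subseteq> sets (col_law n)"
      by (intro image_subsetI) measurable
  qed simp
  also have "\<dots> \<le> (\<Sum>t<n. 2 * exp (kappa + 3 - real n powr (1/10)))"
    by (intro sum_mono Bt) simp
  finally show ?thesis using A by simp
qed

lemma col_moments:
  shows "integrable (col_law n) (\<lambda>x. (ip n a x) ^ 4)" "(\<integral>x. ip n a x \<partial>col_law n) = 0"
    "(\<integral>x. (ip n a x)\<^sup>2 \<partial>col_law n) = ip n a a"
    "(\<integral>x. (ip n a x) ^ 4 \<partial>col_law n) \<le> (3 + kappa) * (ip n a a)\<^sup>2"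
proof -
  interpret C: prob_space "col_law n" by (rule prob_space_col)
  have dist: "distr (col_law n) borel (\<lambda>x. x l) = D" if "l < n" for l
  proof -
    have "distr (col_law n) borel (\<lambda>x. x l) = distr (col_law n) D (\<lambda>x. x l)"
      by (rule distr_cong) (auto simp: sets_D)
    also have "\<dots> = D"
      by (rule distr_PiM_component[of "{..<n}" "\<lambda>_. D"]) (use that prob_space_D in auto)
    finally show ?thesis .
  qed
  have m: "(\<lambda>x. x l) \<in> borel_measurable (col_law n)" if "l < n" for l
    by (rule measurable_coord) (use that in simp)
  have E: "integrable (col_law n) (\<lambda>x. f (x l)) = integrable D f"
    "(\<integral>x. f (x l) \<partial>col_law n) = (\<integral>y. f y \<partial>D)" if "l < n" "f \<in> borel_measurable borel" for l and f :: "real \<Rightarrow> real"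
    using integrable_distr_eq[OF m[OF that(1)] that(2)] integral_distr[OF m[OF that(1)] that(2)]
    by (simp_all add: dist[OF that(1)])
  have ind: "C.indep_vars (\<lambda>_. borel) (\<lambda>l x. x l) {..<n}"
  proof (cases "n = 0")
    \<comment> \<open>Kept apart because the characterisation of independence by the joint law is
      applied to a nonempty index set.\<close>
    case True
    show ?thesis unfolding C.indep_vars_def C.indep_sets_def by (auto simp: True)
  next
    case False
    have "distr (col_law n) (PiM {..<n} (\<lambda>_. borel)) (\<lambda>x. \<lambda>i\<in>{..<n}. x i) = distr (col_law n) (col_law n) (\<lambda>x. x)"
      by (rule distr_cong) (auto intro!: sets_PiM_cong simp: sets_D space_PiM PiE_restrict)
    also have "\<dots> = PiM {..<n} (\<lambda>i. distr (col_law n) borel (\<lambda>x. x i))"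
      unfolding distr_id2[OF refl] by (rule PiM_cong) (auto simp: dist)
    finally show ?thesis
      using False by (subst C.indep_vars_iff_distr_eq_PiM') (auto simp: m)
  qed
  then have ind': "C.indep_vars (\<lambda>_. borel) (\<lambda>l x. a l * x l) {..<n}"
    by (rule C.indep_vars_compose2[of _ _ _ "\<lambda>l y. a l * y"]) simp
  have "integrable (col_law n) (\<lambda>x. (\<Sum>l<n. a l * x l) ^ 4) \<and> (\<integral>x. (\<Sum>l<n. a l * x l) \<partial>col_law n) = 0
    \<and> (\<integral>x. (\<Sum>l<n. a l * x l)\<^sup>2 \<partial>col_law n) = (\<Sum>l<n. (a l)\<^sup>2)
    \<and> (\<integral>x. (\<Sum>l<n. a l * x l) ^ 4 \<partial>col_law n) \<le> (3 + kappa) * (\<Sum>l<n. (a l)\<^sup>2)\<^sup>2"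
  proof (rule C.sum_moments[OF _ ind'])
    fix l assume "l \<in> {..<n}" then have l: "l < n" by simp
    show "integrable (col_law n) (\<lambda>x. (a l * x l) ^ 4)"
      using E(1)[OF l, of "\<lambda>y. (a l * y) ^ 4"] int4 by (simp add: power_mult_distrib)
    show "(\<integral>x. a l * x l \<partial>col_law n) = 0"
      using E(2)[OF l, of "\<lambda>y. a l * y"] mean by simp
    show "(\<integral>x. (a l * x l)\<^sup>2 \<partial>col_law n) = (a l)\<^sup>2"
      using E(2)[OF l, of "\<lambda>y. (a l * y)\<^sup>2"] second by (simp add: power_mult_distrib)
    show "(\<integral>x. (a l * x l) ^ 4 \<partial>col_law n) \<le> kappa * ((a l)\<^sup>2)\<^sup>2"
      using E(2)[OF l, of "\<lambda>y. y ^ 4"] by (simp add: power_mult_distrib kappa_def)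
  qed (use kappa_nonneg in auto)
  then show "integrable (col_law n) (\<lambda>x. (ip n a x) ^ 4)" "(\<integral>x. ip n a x \<partial>col_law n) = 0"
    "(\<integral>x. (ip n a x)\<^sup>2 \<partial>col_law n) = ip n a a"
    "(\<integral>x. (ip n a x) ^ 4 \<partial>col_law n) \<le> (3 + kappa) * (ip n a a)\<^sup>2"
    by (simp_all add: ip_def power2_eq_square)
qed

text \<open>The cut-off keeps the exponential moment of order \<open>log n / n\<close> small enough without truncating the entries,
  whose first, second and fourth moments can then be used as they are.\<close>
definition inc :: "real \<Rightarrow> nat \<Rightarrow> real \<Rightarrow> (nat \<Rightarrow> real) \<Rightarrow> (nat \<Rightarrow> real) \<Rightarrow> real" where
  "inc b n w a x = (if (ip n a x)\<^sup>2 \<le> b * real n then 2 * w * ip n a x + (ip n a x)\<^sup>2 - ip n a a else 0)"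

lemma measurable_ip_col [measurable]: "ip n a \<in> borel_measurable (col_law n)"
  unfolding ip_def[abs_def]
  by (intro borel_measurable_sum borel_measurable_times borel_measurable_const measurable_coord) simp

text \<open>Without the cut-off the increment has mean 0. Where the cut-off acts, every part of the
  increment is dominated by \<open>s^4 / (b\<^sup>2 n)\<close>, so the fourth moment bounds the bias
  by \<open>O(1/n)\<close>, which adds up to \<open>O(1)\<close> over all columns. The second moment
  keeps \<open>w\<^sup>2\<close> explicit so that it can be summed over the columns later.\<close>

lemma inc_bounds:
  assumes n: "1 \<le> n" and a: "ip n a a \<le> 1" and w: "w\<^sup>2 \<le> real n" and b: "0 < b" "b \<le> 1"
  shows "\<bar>inc b n w a x\<bar> \<le> 3 * sqrt b * real n + 1"
    and "\<bar>\<integral>x. inc b n w a x \<partial>col_law n\<bar> \<le> 4 * (3 + kappa) / (b\<^sup>2 * real n)"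
    and "(\<integral>x. (inc b n w a x)\<^sup>2 \<partial>col_law n) \<le> 8 * w\<^sup>2 + 8 + 2 * kappa"
proof -
  interpret C: prob_space "col_law n" by (rule prob_space_col)
  have n0: "real n > 0" "1 \<le> real n" using n by auto
  define s where "s = ip n a"
  define A where "A = ip n a a"
  have A: "0 \<le> A" "A \<le> 1" using a by (auto simp: A_def ip_self_nonneg)
  have inc: "inc b n w a x = (if (s x)\<^sup>2 \<le> b * real n then 2 * w * s x + (s x)\<^sup>2 - A else 0)" for x
    by (simp add: inc_def s_def A_def)
  have sm [measurable]: "s \<in> borel_measurable (col_law n)" by (simp add: s_def)
  note mom = col_moments[where n = n and a = a, folded s_def A_def]
  have i4: "integrable (col_law n) (\<lambda>x. (s x) ^ 4)" by (rule mom)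
  have i2: "integrable (col_law n) (\<lambda>x. (s x)\<^sup>2)"
    by (rule Bochner_Integration.integrable_bound[of _ "\<lambda>x. 1 + s x ^ 4"])
       (use i4 abs_power_le_power4[of 2] in \<open>auto simp: power_abs\<close>)
  have i1: "integrable (col_law n) s"
    by (rule Bochner_Integration.integrable_bound[of _ "\<lambda>x. 1 + s x ^ 4"])
       (use i4 abs_power_le_power4[of 1] in \<open>auto simp: power_abs\<close>)
  have E4: "(\<integral>x. (s x) ^ 4 \<partial>col_law n) \<le> 3 + kappa"
  proof -
    have "(3 + kappa) * A\<^sup>2 \<le> (3 + kappa) * 1"
      using A kappa_nonneg by (intro mult_left_mono power_le_one) auto
    then show ?thesis using mom(4) by simp
  qed
  have ws: "\<bar>w\<bar> \<le> sqrt (real n)" using w by (metis real_sqrt_abs real_sqrt_le_iff)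
  have sqb: "b \<le> sqrt b" using b by (metis less_imp_le mult_left_le real_le_rsqrt power2_eq_square)
  have bd: "\<bar>inc b n w a x\<bar> \<le> 3 * sqrt b * real n + 1" for x
  proof (cases "(s x)\<^sup>2 \<le> b * real n")
    case True
    then have "\<bar>s x\<bar> \<le> sqrt (b * real n)" by (metis real_sqrt_abs real_sqrt_le_iff)
    then have "\<bar>w\<bar> * \<bar>s x\<bar> \<le> sqrt (real n) * sqrt (b * real n)"
      using ws by (intro mult_mono) auto
    also have "\<dots> = sqrt b * real n" by (simp add: real_sqrt_mult)
    finally have "\<bar>2 * w * s x\<bar> \<le> 2 * (sqrt b * real n)" by (simp add: abs_mult)
    moreover have "\<bar>(s x)\<^sup>2 - A\<bar> \<le> sqrt b * real n + 1"
      using True A mult_right_mono[OF sqb, of "real n"] by (smt (verit) of_nat_0_le_iff zero_le_power2)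
    ultimately show ?thesis using True by (simp add: inc)
  next
    case False
    then show ?thesis using b by (simp add: inc)
  qed
  then show "\<bar>inc b n w a x\<bar> \<le> 3 * sqrt b * real n + 1" .
  have im [measurable]: "inc b n w a \<in> borel_measurable (col_law n)"
    unfolding inc_def[abs_def] by measurable
  have ii: "integrable (col_law n) (inc b n w a)"
    by (rule C.integrable_const_bound[of _ "3 * sqrt b * real n + 1"]) (auto intro!: AE_I2 bd)
  have iD: "integrable (col_law n) (\<lambda>x. 2 * w * s x + (s x)\<^sup>2 - A)"
    using i1 i2 by auto
  have "(\<integral>x. 2 * w * s x + (s x)\<^sup>2 - A \<partial>col_law n) = 0"
    using i1 i2 mom by (simp add: C.prob_space)
  then have eq: "(\<integral>x. inc b n w a x \<partial>col_law n) = (\<integral>x. inc b n w a x - (2 * w * s x + (s x)\<^sup>2 - A) \<partial>col_law n)"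
    using ii iD by (simp del: Bochner_Integration.integral_diff add: Bochner_Integration.integral_diff[OF ii iD])
  have "\<bar>\<integral>x. inc b n w a x \<partial>col_law n\<bar> \<le> (\<integral>x. \<bar>inc b n w a x - (2 * w * s x + (s x)\<^sup>2 - A)\<bar> \<partial>col_law n)"
    unfolding eq by (rule integral_abs_bound)
  also have "\<dots> \<le> (\<integral>x. 4 / (b\<^sup>2 * real n) * s x ^ 4 \<partial>col_law n)"
  proof (rule integral_mono')
    show "integrable (col_law n) (\<lambda>x. 4 / (b\<^sup>2 * real n) * s x ^ 4)" using i4 by simp
    fix x
    show "0 \<le> 4 / (b\<^sup>2 * real n) * s x ^ 4" by simp
    show "\<bar>inc b n w a x - (2 * w * s x + (s x)\<^sup>2 - A)\<bar> \<le> 4 / (b\<^sup>2 * real n) * s x ^ 4"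
    proof (cases "(s x)\<^sup>2 \<le> b * real n")
      case True
      then show ?thesis by (simp add: inc)
    next
      case False
      define q where "q = (s x)\<^sup>2"
      define Z where "Z = s x ^ 4 / (b\<^sup>2 * real n)"
      have q: "b * real n \<le> q" using False by (simp add: q_def)
      have bn: "0 < b * real n" using b n0 by simp
      have q0: "0 < q" using q bn by linarith
      have s4: "s x ^ 4 = q * q" by (simp add: q_def power2_eq_square power4_eq_xxxx)
      have b2n: "0 < b\<^sup>2 * real n" using b n0 by simp
      have b2: "b\<^sup>2 * real n \<le> b * real n" using b n0 by (simp add: power2_eq_square mult_le_one)
      have Z1: "q \<le> Z"
        unfolding Z_def s4 using b2n mult_left_mono[OF order_trans[OF b2 q], of q] q0 by (simp add: pos_le_divide_eq)
      have "b\<^sup>2 * real n * 1 \<le> b\<^sup>2 * real n * real n" using n0 b2n by (intro mult_left_mono) auto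
      also have "\<dots> = (b * real n) * (b * real n)" by (simp add: power2_eq_square)
      also have "\<dots> \<le> q * q" using q bn by (intro mult_mono) auto
      finally have Z2: "1 \<le> Z" unfolding Z_def s4 using b2n by (simp add: pos_le_divide_eq)
      have Z3: "\<bar>w * s x\<bar> \<le> Z"
      proof -
        have "(w * s x)\<^sup>2 \<le> real n * q"
          unfolding power_mult_distrib q_def[symmetric] using w q0 by (intro mult_right_mono) auto
        also have "\<dots> \<le> Z * Z"
        proof -
          have "Z \<ge> q * (real n / (b * real n))"
          proof -
            have "q * (real n / (b * real n)) = q * (b * real n) / (b\<^sup>2 * real n)"
              using b n0 by (simp add: power2_eq_square)
            also have "\<dots> \<le> q * q / (b\<^sup>2 * real n)"
              using q q0 b2n by (intro divide_right_mono mult_left_mono) auto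
            finally show ?thesis by (simp add: Z_def s4)
          qed
          moreover have "Z \<ge> real n"
          proof -
            have "real n * (b\<^sup>2 * real n) = (b * real n) * (b * real n)" by (simp add: power2_eq_square)
            also have "\<dots> \<le> q * q" using q bn by (intro mult_mono) auto
            finally show ?thesis unfolding Z_def s4 using b2n by (simp add: pos_le_divide_eq)
          qed
          ultimately show ?thesis using Z1 q0 n0 by (intro mult_mono) auto
        qed
        finally have "(w * s x)\<^sup>2 \<le> Z\<^sup>2" by (simp add: power2_eq_square)
        then have "\<bar>w * s x\<bar> \<le> \<bar>Z\<bar>" by (simp only: abs_le_square_iff)
        then show ?thesis using Z2 by simp
      qed
      \<comment> \<open>One \<open>Z\<close> each for \<open>(s x)\<^sup>2\<close> and
        \<open>A\<close>, and two for the cross term \<open>2 * w * s x\<close>.\<close>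
      have "\<bar>inc b n w a x - (2 * w * s x + (s x)\<^sup>2 - A)\<bar> \<le> 4 * Z"
        using False Z1 Z2 Z3 A q0 by (simp add: inc q_def[symmetric])
      then show ?thesis by (simp add: Z_def)
    qed
  qed
  also have "\<dots> = 4 / (b\<^sup>2 * real n) * (\<integral>x. s x ^ 4 \<partial>col_law n)" by simp
  also have "\<dots> \<le> 4 / (b\<^sup>2 * real n) * (3 + kappa)"
    using E4 by (rule mult_left_mono) simp
  finally show "\<bar>\<integral>x. inc b n w a x \<partial>col_law n\<bar> \<le> 4 * (3 + kappa) / (b\<^sup>2 * real n)" by simp
  have i3: "integrable (col_law n) (\<lambda>x. 8 * w\<^sup>2 * (s x)\<^sup>2 + 2 * (s x ^ 4 + 1))"
    using i2 i4 by simp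
  have "(\<integral>x. (inc b n w a x)\<^sup>2 \<partial>col_law n) \<le> (\<integral>x. 8 * w\<^sup>2 * (s x)\<^sup>2 + 2 * (s x ^ 4 + 1) \<partial>col_law n)"
  proof (rule integral_mono'[OF i3])
    fix x
    define q where "q = (s x)\<^sup>2"
    have q0: "0 \<le> q" by (simp add: q_def)
    have s4: "s x ^ 4 = q\<^sup>2" by (simp add: q_def)
    from power2_add_le[of "2 * w * s x" "q - A"]
    have "(2 * w * s x + (q - A))\<^sup>2 \<le> 8 * w\<^sup>2 * q + 2 * (q - A)\<^sup>2"
      by (simp add: power_mult_distrib q_def)
    moreover have "(q - A)\<^sup>2 \<le> q\<^sup>2 + 1"
    proof -
      have "A\<^sup>2 \<le> 1" using A by (simp add: power_le_one)
      moreover have "0 \<le> q * A" using q0 A by simp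
      ultimately show ?thesis by (simp add: power2_eq_square algebra_simps)
    qed
    moreover have "0 \<le> 8 * w\<^sup>2 * q + 2 * (q\<^sup>2 + 1)" using q0 by simp
    ultimately show "(inc b n w a x)\<^sup>2 \<le> 8 * w\<^sup>2 * (s x)\<^sup>2 + 2 * (s x ^ 4 + 1)"
      unfolding s4 inc q_def[symmetric] by (auto simp: add_diff_eq)
    show "0 \<le> 8 * w\<^sup>2 * (s x)\<^sup>2 + 2 * (s x ^ 4 + 1)"
      by (simp add: add_nonneg_nonneg)
  qed
  also have "\<dots> = 8 * w\<^sup>2 * A + 2 * ((\<integral>x. s x ^ 4 \<partial>col_law n) + 1)"
    using i2 i4 mom(3) by (simp add: C.prob_space)
  also have "\<dots> \<le> 8 * w\<^sup>2 * 1 + 2 * ((3 + kappa) + 1)"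
    using A E4 by (intro add_mono mult_left_mono) auto
  finally show "(\<integral>x. (inc b n w a x)\<^sup>2 \<partial>col_law n) \<le> 8 * w\<^sup>2 + 8 + 2 * kappa" by simp
qed

lemma measurable_entry: "t \<in> I \<Longrightarrow> l < n \<Longrightarrow> (\<lambda>x. x t l) \<in> borel_measurable (PiM I (\<lambda>_. col_law n))"
  by (rule measurable_compose[OF measurable_component_singleton[of t I "\<lambda>_. col_law n"] measurable_coord[of l "{..<n}"]]) auto

text \<open>Here the coordinates of the product space are whole columns. A single
  \<open>(w t)\<^sup>2\<close> may be as large as \<open>n\<close>; the variance is controlled
  through the total \<open>W\<close>, so nothing is assumed about how \<open>w\<close> is spread
  over the columns.\<close>

lemma martingale_bound:
  assumes n: "1 \<le> n" and b: "0 < b" "b \<le> 1" and l: "0 \<le> l"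
    and ma: "\<And>t i. t < p \<Longrightarrow> i < n \<Longrightarrow> (\<lambda>x. a t x i) \<in> borel_measurable (PiM {..<Suc t} (\<lambda>_. col_law n))"
    and dep: "\<And>t x. t < p \<Longrightarrow> a t x = a t (restrict x {..<t})"
    and a1: "\<And>t x. t < p \<Longrightarrow> ip n (a t x) (a t x) \<le> 1"
    and w: "\<And>t. t < p \<Longrightarrow> (w t)\<^sup>2 \<le> real n" and W: "(\<Sum>t<p. (w t)\<^sup>2) \<le> W"
  shows "measure (PiM {..<p} (\<lambda>_. col_law n)) {x \<in> space (PiM {..<p} (\<lambda>_. col_law n)).
       z < \<bar>\<Sum>t<p. inc b n (w t) (a t x) (x t)\<bar>}
    \<le> 2 * exp (l * (real p * (4 * (3 + kappa) / (b\<^sup>2 * real n)))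
        + l\<^sup>2 * exp (l * (3 * sqrt b * real n + 1)) * (8 * W + real p * (8 + 2 * kappa)) - l * z)"
proof -
  have dep': "a t (x(t := y)) = a t x" if "t < p" for t x y
  proof -
    have "restrict (x(t := y)) {..<t} = restrict x {..<t}" by (auto simp: restrict_def fun_eq_iff)
    then show ?thesis using dep[OF that, of x] dep[OF that, of "x(t := y)"] by metis
  qed
  have "measure (PiM {..<p} (\<lambda>_. col_law n)) {x \<in> space (PiM {..<p} (\<lambda>_. col_law n)).
       z < \<bar>\<Sum>t<p. inc b n (w t) (a t x) (x t)\<bar>}
    \<le> 2 * exp (l * (\<Sum>t<p. 4 * (3 + kappa) / (b\<^sup>2 * real n))
        + l\<^sup>2 * exp (l * (3 * sqrt b * real n + 1)) * (\<Sum>t<p. 8 * (w t)\<^sup>2 + 8 + 2 * kappa) - l * z)"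
  proof (rule chernoff_seq[OF prob_space_col _ _ _ _ _ l])
    fix t x assume t: "t < p"
    have ip1: "(\<lambda>x. ip n (a t x) (x t)) \<in> borel_measurable (PiM {..<Suc t} (\<lambda>_. col_law n))"
      "(\<lambda>x. ip n (a t x) (a t x)) \<in> borel_measurable (PiM {..<Suc t} (\<lambda>_. col_law n))"
      unfolding ip_def by (intro borel_measurable_sum borel_measurable_times ma t measurable_entry; simp)+
    then show "(\<lambda>x. inc b n (w t) (a t x) (x t)) \<in> borel_measurable (PiM {..<Suc t} (\<lambda>_. col_law n))"
      unfolding inc_def by measurable
    have "a t (restrict x {..<Suc t}) = a t (restrict (restrict x {..<Suc t}) {..<t})" by (rule dep[OF t])
    also have "restrict (restrict x {..<Suc t}) {..<t} = restrict x {..<t}"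
      by (auto simp: restrict_def fun_eq_iff)
    also have "a t \<dots> = a t x" by (rule dep[OF t, symmetric])
    finally have e: "a t (restrict x {..<Suc t}) = a t x" .
    show "inc b n (w t) (a t x) (x t) = inc b n (w t) (a t (restrict x {..<Suc t})) (restrict x {..<Suc t} t)"
      unfolding e by simp
    show "\<bar>inc b n (w t) (a t (x(t := y))) ((x(t := y)) t)\<bar> \<le> 3 * sqrt b * real n + 1" for y
      by (rule inc_bounds(1)[OF n a1[OF t] w[OF t] b])
    show "\<bar>\<integral>y. inc b n (w t) (a t (x(t := y))) ((x(t := y)) t) \<partial>col_law n\<bar> \<le> 4 * (3 + kappa) / (b\<^sup>2 * real n)"
      using inc_bounds(2)[OF n a1[OF t] w[OF t] b] by (simp add: dep'[OF t] del: fun_upd_apply) simp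
    show "(\<integral>y. (inc b n (w t) (a t (x(t := y))) ((x(t := y)) t))\<^sup>2 \<partial>col_law n) \<le> 8 * (w t)\<^sup>2 + 8 + 2 * kappa"
      using inc_bounds(3)[OF n a1[OF t] w[OF t] b] by (simp add: dep'[OF t] del: fun_upd_apply) simp
  qed
  also have "\<dots> \<le> 2 * exp (l * (real p * (4 * (3 + kappa) / (b\<^sup>2 * real n)))
        + l\<^sup>2 * exp (l * (3 * sqrt b * real n + 1)) * (8 * W + real p * (8 + 2 * kappa)) - l * z)"
  proof -
    have "(\<Sum>t<p. 8 * (w t)\<^sup>2 + 8 + 2 * kappa) = 8 * (\<Sum>t<p. (w t)\<^sup>2) + real p * (8 + 2 * kappa)"
      by (simp add: sum.distrib sum_distrib_left algebra_simps)
    also have "\<dots> \<le> 8 * W + real p * (8 + 2 * kappa)" using W by simp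
    finally have "l\<^sup>2 * exp (l * (3 * sqrt b * real n + 1)) * (\<Sum>t<p. 8 * (w t)\<^sup>2 + 8 + 2 * kappa) \<le>
      l\<^sup>2 * exp (l * (3 * sqrt b * real n + 1)) * (8 * W + real p * (8 + 2 * kappa))"
      by (rule mult_left_mono) simp
    then show ?thesis by simp
  qed
  finally show ?thesis .
qed

end

section \<open>The recursion for the squared residual\<close>

lemma ip_Cauchy_Schwarz: "(ip n a b)\<^sup>2 \<le> ip n a a * ip n b b"
  using Cauchy_Schwarz_ineq_sum[of a b "{..<n}"] by (simp add: ip_def power2_eq_square)

lemma orth_proj_contract:
  assumes "orth_proj n R" shows "ip n v (mv n R v) \<le> ip n v v" "0 \<le> ip n v (mv n R v)"
proof -
  have "0 \<le> ip n (\<lambda>l. v l - mv n R v l) (\<lambda>l. v l - mv n R v l)" by (rule ip_self_nonneg)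
  also have "\<dots> = ip n v v - ip n v (mv n R v)"
    by (simp add: ip_diff_left ip_diff_right ip_mv_self[OF assms, symmetric] ip_commute[of n "mv n R v" v])
  finally show "ip n v (mv n R v) \<le> ip n v v" by simp
  show "0 \<le> ip n v (mv n R v)" by (simp add: ip_mv_self[OF assms] ip_self_nonneg)
qed

text \<open>A deterministic passage from the truncated column \<open>v\<close> to the actual one. By
  Cauchy-Schwarz the cross term is at most \<open>4 * sqrt \<epsilon> * N\<close>, and the form in
  \<open>d\<close> alone is at most \<open>\<epsilon> * N \<le> sqrt \<epsilon> * N\<close>.\<close>

lemma quad_form_perturb:
  assumes R: "orth_proj n R" and q: "ip n v (mv n R v) \<le> 4 * N" and d: "ip n d d \<le> \<epsilon> * N"
    and e: "0 \<le> \<epsilon>" "\<epsilon> \<le> 1" and N: "0 \<le> N"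
  shows "\<bar>ip n (\<lambda>l. v l + d l) (mv n R (\<lambda>l. v l + d l)) - ip n v (mv n R v)\<bar> \<le> 5 * sqrt \<epsilon> * N"
proof -
  have mva: "mv n R (\<lambda>l. v l + d l) = (\<lambda>a. mv n R v a + mv n R d a)"
    by (rule ext) (simp add: mv_def ip_def distrib_left sum.distrib)
  have "ip n (\<lambda>l. v l + d l) (mv n R (\<lambda>l. v l + d l)) =
     ip n v (mv n R v) + ip n v (mv n R d) + (ip n d (mv n R v) + ip n d (mv n R d))"
    unfolding mva by (simp add: ip_def algebra_simps sum.distrib)
  moreover have "ip n v (mv n R d) = ip n d (mv n R v)"
    using ip_mv_sym[OF R, of v d] by (simp add: ip_commute)
  ultimately have eq: "ip n (\<lambda>l. v l + d l) (mv n R (\<lambda>l. v l + d l)) - ip n v (mv n R v) =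
     2 * ip n d (mv n R v) + ip n d (mv n R d)" by simp
  have "(ip n d (mv n R v))\<^sup>2 \<le> ip n d d * ip n (mv n R v) (mv n R v)" by (rule ip_Cauchy_Schwarz)
  also have "\<dots> \<le> (\<epsilon> * N) * (4 * N)"
    using d q e N unfolding ip_mv_self[OF R, of v] by (intro mult_mono ip_self_nonneg) auto
  also have "\<dots> = (2 * sqrt \<epsilon> * N)\<^sup>2" using e by (simp add: power2_eq_square)
  finally have "\<bar>ip n d (mv n R v)\<bar> \<le> \<bar>2 * sqrt \<epsilon> * N\<bar>" by (simp only: abs_le_square_iff)
  then have 1: "\<bar>ip n d (mv n R v)\<bar> \<le> 2 * sqrt \<epsilon> * N" using e N by simp
  have "ip n d (mv n R d) \<le> \<epsilon> * N" using orth_proj_contract(1)[OF R, of d] d by linarith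
  also have "\<epsilon> * N \<le> sqrt \<epsilon> * N"
    using e N by (intro mult_right_mono real_le_rsqrt) (auto simp: power2_eq_square mult_left_le)
  finally show ?thesis using 1 orth_proj_contract(2)[OF R, of d] unfolding eq by linarith
qed

text \<open>With the weight \<open>r - i\<close>, the contribution \<open>fit_sq\<close> to the
  conditional mean of the numerator is cancelled by the loss of one dimension from the weight. Only
  \<open>w\<close>, the drift and the deviation of the pivots from their expected values
  remain.\<close>

lemma fit_telescope:
  assumes Q: "orth_proj n Q" and u: "\<And>a. a < n \<Longrightarrow> mv n Q u a = 0"
    and piv: "\<And>i. i < m \<Longrightarrow> pivot n Q x i \<noteq> 0"
  shows "(r - real m) * fit_sq n Q u w x m =
    r * ip n u u + (\<Sum>i<m. (w i)\<^sup>2)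
    + (\<Sum>i<m. drift n Q u w x i)
    + (\<Sum>i<m. (r - real i - 1 - pivot n Q x i) *
        (fit_sq n Q u w x (Suc i) - fit_sq n Q u w x i))"
  using piv
proof (induction m)
  case (Suc m)
  define y where "y i = fit_sq n Q u w x i" for i
  define g where "g i = ip n (fit n Q u w x i) (x i)" for i
  define M where "M = pivot n Q x m"
  have M: "M \<noteq> 0" using Suc.prems by (simp add: M_def)
  have "y (Suc m) = y m + (w m + g m)\<^sup>2 / M"
    unfolding y_def g_def M_def by (rule ip_fit_Suc[OF Q u])
  then have "M * (y (Suc m) - y m) = (w m + g m)\<^sup>2" using M by simp
  then have "(r - real (Suc m)) * y (Suc m) = (r - real m) * y m + (w m)\<^sup>2
     + (2 * w m * g m + (g m)\<^sup>2 - y m) + (r - real m - 1 - M) * (y (Suc m) - y m)"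
    by (simp add: power2_eq_square algebra_simps)
  with Suc show ?case unfolding y_def[symmetric] g_def[symmetric]
    by (simp del: fit.simps add: M_def algebra_simps)
qed simp

text \<open>The drift is controlled only while \<open>fit_sq\<close> stays below
  \<open>C * (1 + \<delta>)\<close>. At a first exceedance the telescoped identity is still
  available and yields \<open>c0 * y \<le> 4 * (1 + \<delta>)\<close>, whereas exceeding
  \<open>C = 5 / c0\<close> means \<open>c0 * y > 5 * (1 + \<delta>)\<close>. So the threshold is
  never crossed, the stopped sum is the full one, and the identity at \<open>p\<close> gives the
  limit.\<close>

lemma fit_estimate:
  fixes C c0 \<epsilon> \<delta> :: real
  assumes Q: "orth_proj n Q" and u: "\<And>a. a < n \<Longrightarrow> mv n Q u a = 0" and u1: "ip n u u = 1"
    and w: "(\<Sum>i<p. (w i)\<^sup>2) = real p * \<delta>" and \<delta>: "0 \<le> \<delta>"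
    and c0: "0 < c0" "c0 \<le> 1" and tr: "c0 * real n \<le> tr n Q - real p" "tr n Q \<le> real n" and n: "1 \<le> c0 * real n / 4"
    and \<epsilon>: "0 \<le> \<epsilon>" "\<epsilon> \<le> c0 / 4" and C: "C = 5 / c0"
    and A: "\<And>i. i < p \<Longrightarrow> \<bar>pivot n Q x i - tr n (res n Q x i)\<bar> \<le> \<epsilon> * real n"
    and M: "\<bar>\<Sum>i<p. if fit_sq n Q u w x i \<le> C * (1 + \<delta>)
        then drift n Q u w x i else 0\<bar> \<le> \<epsilon> * real n * (1 + \<delta>)"
  shows "\<And>i. i < p \<Longrightarrow> pivot n Q x i \<noteq> 0"
    and "\<bar>fit_sq n Q u w x p - 1 - (1 + \<delta>) * (real p / (tr n Q - real p))\<bar>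
       \<le> (\<epsilon> + (\<epsilon> + 1 / real n) * C) / c0 * (1 + \<delta>)"
proof -
  define r where "r = tr n Q"
  define y where "y i = fit_sq n Q u w x i" for i
  define g where "g i = ip n (fit n Q u w x i) (x i)" for i
  define D where "D i = 2 * w i * g i + (g i)\<^sup>2 - y i" for i
  have M': "\<bar>\<Sum>i<p. if y i \<le> C * (1 + \<delta>) then D i else 0\<bar> \<le> \<epsilon> * real n * (1 + \<delta>)"
    using M unfolding D_def y_def g_def .
  have n0: "0 < real n" using n c0 by (metis div_0 mult_zero_right not_gr_zero not_one_le_zero of_nat_0 of_nat_0_less_iff)
  have en: "\<epsilon> * real n \<le> c0 * real n / 4" using mult_right_mono[OF \<epsilon>(2), of "real n"] by simp
  have cn: "0 < c0 * real n" using c0 n0 by simp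
  \<comment> \<open>The two claims need each other: the trace is \<open>r - i\<close> if the earlier
    pivots are nonzero, and pivot \<open>i\<close> is nonzero because it is close to this
    trace.\<close>
  have trr: "tr n (res n Q x i) = r - real i \<and> pivot n Q x i \<noteq> 0" if "i < p" for i
    using that
  proof (induction i rule: less_induct)
    case (less i)
    have t: "tr n (res n Q x i) = r - real i"
      unfolding r_def by (rule tr_res[OF Q]) (use less in auto)
    have "real i \<le> real p" using less.prems by simp
    then have "c0 * real n - \<epsilon> * real n \<le> pivot n Q x i" using A[OF less.prems] t tr by (simp add: r_def abs_le_iff)
    then show ?case using t en cn by linarith
  qed
  then show piv: "\<And>i. i < p \<Longrightarrow> pivot n Q x i \<noteq> 0" by blast
  have mono: "y i \<le> y m" if "i \<le> m" for i m
    unfolding y_def by (rule ip_fit_ge[OF Q u that])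
  have y0: "y 0 = 1" by (simp add: y_def u1)
  have y1: "1 \<le> y i" for i using mono[of 0 i] y0 by simp
  have tele: "(r - real m) * y m = r + (\<Sum>i<m. (w i)\<^sup>2) + (\<Sum>i<m. D i)
      + (\<Sum>i<m. (r - real i - 1 - pivot n Q x i) * (y (Suc i) - y i))" if "m \<le> p" for m
    using fit_telescope[OF Q u, where m = m and x = x and r = r and w = w] piv that
    unfolding y_def g_def D_def by (simp add: u1)
  \<comment> \<open>The increments are nonnegative, so a uniform bound on the pivot errors can be
    taken out and the increments telescope.\<close>
  have err: "\<bar>\<Sum>i<m. (r - real i - 1 - pivot n Q x i) * (y (Suc i) - y i)\<bar> \<le> (\<epsilon> * real n + 1) * y m" if "m \<le> p" for m
  proof -
    have "\<bar>\<Sum>i<m. (r - real i - 1 - pivot n Q x i) * (y (Suc i) - y i)\<bar>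
       \<le> (\<Sum>i<m. (\<epsilon> * real n + 1) * (y (Suc i) - y i))"
    proof (rule order_trans[OF sum_abs sum_mono])
      fix i assume "i \<in> {..<m}"
      then have i: "i < p" using that by simp
      have "\<bar>r - real i - 1 - pivot n Q x i\<bar> \<le> \<epsilon> * real n + 1"
        using A[OF i] trr[OF i] by (auto simp: abs_le_iff)
      moreover have "0 \<le> y (Suc i) - y i" using mono[of i "Suc i"] by simp
      ultimately show "\<bar>(r - real i - 1 - pivot n Q x i) * (y (Suc i) - y i)\<bar> \<le> (\<epsilon> * real n + 1) * (y (Suc i) - y i)"
        unfolding abs_mult by (intro mult_mono) auto
    qed
    also have "\<dots> = (\<epsilon> * real n + 1) * (y m - y 0)"
      by (simp add: sum_distrib_left[symmetric] sum_lessThan_telescope)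
    also have "\<dots> \<le> (\<epsilon> * real n + 1) * y m"
      using \<epsilon> y0 by (intro mult_left_mono) auto
    finally show ?thesis .
  qed
  have pn: "real p \<le> real n" using tr cn by linarith
  have rn: "r \<le> real n" using tr by (simp add: r_def)
  have wle: "(\<Sum>i<m. (w i)\<^sup>2) \<le> real n * \<delta>" if "m \<le> p" for m
  proof -
    have "(\<Sum>i<m. (w i)\<^sup>2) \<le> (\<Sum>i<p. (w i)\<^sup>2)" using that by (intro sum_mono2) auto
    also have "\<dots> \<le> real n * \<delta>" unfolding w using pn \<delta> by (rule mult_right_mono)
    finally show ?thesis .
  qed
  have d1: "0 < 1 + \<delta>" using \<delta> by simp
  have bound: "y m \<le> C * (1 + \<delta>)" if "m \<le> p" for m
  proof (rule ccontr)
    assume "\<not> y m \<le> C * (1 + \<delta>)"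
    \<comment> \<open>As \<open>y\<close> is nondecreasing, the stopped sum up to \<open>p\<close> is the full sum up to the first exceedance \<open>m'\<close>.\<close>
    define m' where "m' = (LEAST m. \<not> y m \<le> C * (1 + \<delta>))"
    have m'1: "\<not> y m' \<le> C * (1 + \<delta>)" unfolding m'_def by (rule LeastI) fact
    have m'2: "y i \<le> C * (1 + \<delta>)" if "i < m'" for i using not_less_Least that unfolding m'_def by blast
    have m'p: "m' \<le> p" using Least_le[of "\<lambda>m. \<not> y m \<le> C * (1 + \<delta>)" m] \<open>\<not> y m \<le> C * (1 + \<delta>)\<close> that
      by (simp add: m'_def)
    have "(\<Sum>i<p. if y i \<le> C * (1 + \<delta>) then D i else 0) = (\<Sum>i<m'. if y i \<le> C * (1 + \<delta>) then D i else 0)"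
    proof (rule sum.mono_neutral_right)
      show "\<forall>i\<in>{..<p} - {..<m'}. (if y i \<le> C * (1 + \<delta>) then D i else 0) = 0"
      proof
        fix i assume "i \<in> {..<p} - {..<m'}"
        then have "y m' \<le> y i" by (intro mono) simp
        then show "(if y i \<le> C * (1 + \<delta>) then D i else 0) = 0" using m'1 by simp
      qed
    qed (use m'p in auto)
    also have "\<dots> = (\<Sum>i<m'. D i)" using m'2 by simp
    finally have S: "\<bar>\<Sum>i<m'. D i\<bar> \<le> \<epsilon> * real n * (1 + \<delta>)"
      using M' by simp
    have "\<epsilon> * real n * (1 + \<delta>) \<le> real n * (1 + \<delta>)"
      using \<epsilon> c0 n0 d1 by (intro mult_right_mono) auto
    \<comment> \<open>The factor 2 collects \<open>r\<close> plus the sum of the squares of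
      \<open>w\<close>, at most \<open>n * (1 + \<delta>)\<close>, and the drift, at most the same.
      The remaining term is absorbed on the left, its factor being at most half of
      \<open>c0 * real n\<close>.\<close>
    then have "(r - real m') * y m' \<le> 2 * real n * (1 + \<delta>) + (\<epsilon> * real n + 1) * y m'"
      using tele[OF m'p] err[OF m'p] wle[OF m'p] S rn by (simp add: abs_le_iff algebra_simps)
    moreover have "c0 * real n \<le> r - real m'" using tr m'p by (simp add: r_def)
    then have "c0 * real n * y m' \<le> (r - real m') * y m'"
      using y1[of m'] by (intro mult_right_mono) auto
    moreover have "(\<epsilon> * real n + 1) * y m' \<le> (c0 * real n / 2) * y m'"
      using en n y1[of m'] by (intro mult_right_mono) auto
    ultimately have "(c0 * real n / 2) * y m' \<le> 2 * real n * (1 + \<delta>)" by simp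
    then have "real n * (c0 * y m') \<le> real n * (4 * (1 + \<delta>))" by (simp add: algebra_simps)
    then have "c0 * y m' \<le> 4 * (1 + \<delta>)" using n0 by simp
    moreover have "c0 * (C * (1 + \<delta>)) < c0 * y m'" using m'1 c0 by simp
    moreover have "c0 * (C * (1 + \<delta>)) = 5 * (1 + \<delta>)" using c0 C by simp
    ultimately show False using d1 by simp
  qed
  have S: "\<bar>\<Sum>i<p. D i\<bar> \<le> \<epsilon> * real n * (1 + \<delta>)"
  proof -
    have "(\<Sum>i<p. if y i \<le> C * (1 + \<delta>) then D i else 0) = (\<Sum>i<p. D i)"
      using bound by simp
    then show ?thesis using M' by simp
  qed
  have rp: "c0 * real n \<le> r - real p" using tr by (simp add: r_def)
  define E where "E = (\<Sum>i<p. D i) + (\<Sum>i<p. (r - real i - 1 - pivot n Q x i) * (y (Suc i) - y i))"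
  have Eb: "\<bar>E\<bar> \<le> \<epsilon> * real n * (1 + \<delta>) + (\<epsilon> * real n + 1) * (C * (1 + \<delta>))"
  proof -
    have "(\<epsilon> * real n + 1) * y p \<le> (\<epsilon> * real n + 1) * (C * (1 + \<delta>))"
      using \<epsilon> bound[of p] by (intro mult_left_mono) auto
    then show ?thesis using S err[of p] unfolding E_def by (simp add: abs_le_iff)
  qed
  have "(r - real p) * y p = r + real p * \<delta> + E"
    using tele[of p] w by (simp add: E_def)
  \<comment> \<open>Because \<open>r + p * \<delta> = (r - p) + p * (1 + \<delta>)\<close>.\<close>
  then have "(r - real p) * (y p - 1 - (1 + \<delta>) * (real p / (r - real p))) = E"
    using rp cn by (simp add: field_simps)
  then have "(r - real p) * \<bar>y p - 1 - (1 + \<delta>) * (real p / (r - real p))\<bar> = \<bar>E\<bar>"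
    using rp cn by (metis abs_mult abs_of_pos less_le_trans)
  moreover have "c0 * real n * \<bar>y p - 1 - (1 + \<delta>) * (real p / (r - real p))\<bar> \<le>
      (r - real p) * \<bar>y p - 1 - (1 + \<delta>) * (real p / (r - real p))\<bar>"
    using rp by (intro mult_right_mono) auto
  ultimately have "c0 * real n * \<bar>y p - 1 - (1 + \<delta>) * (real p / (r - real p))\<bar> \<le>
     \<epsilon> * real n * (1 + \<delta>) + (\<epsilon> * real n + 1) * (C * (1 + \<delta>))" using Eb by linarith
  also have "\<dots> = c0 * real n * ((\<epsilon> + (\<epsilon> + 1 / real n) * C) / c0 * (1 + \<delta>))"
    using c0 n0 by (simp add: field_simps)
  finally show "\<bar>fit_sq n Q u w x p - 1 - (1 + \<delta>) * (real p / (tr n Q - real p))\<bar>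
       \<le> (\<epsilon> + (\<epsilon> + 1 / real n) * C) / c0 * (1 + \<delta>)"
    by (simp only: mult_le_cancel_left_pos[OF cn] y_def r_def)
qed

text \<open>These congruences express predictability: stage \<open>i\<close> depends on the earlier
  columns only, and the pivot on column \<open>i\<close> as well. Given the past, projection and
  coefficients are therefore constants. The congruences also allow the restricted array to replace
  the errors themselves.\<close>

lemma res_cong:
  assumes "\<And>m l. m < i \<Longrightarrow> l < n \<Longrightarrow> x m l = x' m l"
  shows "res n Q x i = res n Q x' i"
  using assms
proof (induction i)
  case (Suc i)
  have "mv n R (x i) = mv n R (x' i)" for R by (rule ext, rule mv_cong) (use Suc.prems in auto)
  moreover have "ip n (x i) b = ip n (x' i) b" for b by (rule ip_cong) (use Suc.prems in auto)
  ultimately show ?case using Suc by (simp add: deflate_def[abs_def])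
qed simp

lemma pivot_cong:
  assumes "\<And>m l. m \<le> i \<Longrightarrow> l < n \<Longrightarrow> x m l = x' m l"
  shows "pivot n Q x i = pivot n Q x' i"
proof -
  have "res n Q x i = res n Q x' i" by (rule res_cong) (use assms in auto)
  moreover have "mv n R (x i) = mv n R (x' i)" for R by (rule ext, rule mv_cong) (use assms in auto)
  moreover have "ip n (x i) b = ip n (x' i) b" for b by (rule ip_cong) (use assms in auto)
  ultimately show ?thesis by (simp add: pivot_def[abs_def])
qed

lemma fit_cong:
  assumes "\<And>m l. m < i \<Longrightarrow> l < n \<Longrightarrow> x m l = x' m l"
  shows "fit n Q u w x i = fit n Q u w x' i"
  using assms
proof (induction i)
  case (Suc i)
  have "res n Q x i = res n Q x' i" by (rule res_cong) (use Suc.prems in auto)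
  moreover have "pivot n Q x i = pivot n Q x' i" by (rule pivot_cong) (use Suc.prems in auto)
  moreover have "mv n R (x i) = mv n R (x' i)" for R by (rule ext, rule mv_cong) (use Suc.prems in auto)
  moreover have "ip n b (x i) = ip n b (x' i)" for b by (rule ip_cong) (use Suc.prems in auto)
  ultimately show ?case using Suc by simp
qed simp

context std_law begin

abbreviation arr_law :: "nat \<Rightarrow> nat \<Rightarrow> (nat \<Rightarrow> nat \<Rightarrow> real) measure" where
  "arr_law n p \<equiv> PiM {..<p} (\<lambda>_. col_law n)"

lemma measurable_res: "i \<le> p \<Longrightarrow> (\<lambda>x. res n Q x i a b) \<in> borel_measurable (arr_law n p)"
proof (induction i arbitrary: a b)
  case (Suc i)
  have r: "(\<lambda>x. res n Q x i a b) \<in> borel_measurable (arr_law n p)" for a b using Suc by simp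
  have x: "(\<lambda>x. x i l) \<in> borel_measurable (arr_law n p)" if "l < n" for l
    by (rule measurable_entry) (use Suc that in auto)
  have m: "(\<lambda>x. mv n (res n Q x i) (x i) a) \<in> borel_measurable (arr_law n p)" for a
    unfolding mv_def ip_def by (intro borel_measurable_sum borel_measurable_times r x) auto
  have "(\<lambda>x. ip n (x i) (mv n (res n Q x i) (x i))) \<in> borel_measurable (arr_law n p)"
    unfolding ip_def[of n "x i" for x] by (intro borel_measurable_sum borel_measurable_times m x) auto
  then show ?case unfolding res.simps deflate_def by (intro borel_measurable_diff borel_measurable_divide borel_measurable_times r m)
qed simp

lemma measurable_pivot: "i < p \<Longrightarrow> (\<lambda>x. pivot n Q x i) \<in> borel_measurable (arr_law n p)"
  unfolding pivot_def ip_def mv_def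
  by (intro borel_measurable_sum borel_measurable_times measurable_res measurable_entry) auto

lemma measurable_fit: "i \<le> p \<Longrightarrow> (\<lambda>x. fit n Q u w x i a) \<in> borel_measurable (arr_law n p)"
proof (induction i arbitrary: a)
  case (Suc i)
  have r: "(\<lambda>x. fit n Q u w x i a) \<in> borel_measurable (arr_law n p)" for a using Suc by simp
  show ?case using Suc unfolding fit.simps ip_def mv_def
    by (intro borel_measurable_sum borel_measurable_times borel_measurable_diff borel_measurable_divide
        borel_measurable_add borel_measurable_const measurable_res measurable_entry measurable_pivot r) auto
qed simp

end

section \<open>Exceptional events\<close>

lemma tr_le: "orth_proj n R \<Longrightarrow> tr n R \<le> real n"
  using sum_mono[of "{..<n}" "\<lambda>a. R a a" "\<lambda>_. 1"] orth_proj_row(3)[of n R] by (simp add: tr_def)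

context std_law begin

definition spike_fail :: "real \<Rightarrow> real \<Rightarrow> real \<Rightarrow> nat \<Rightarrow> real" where
  "spike_fail \<epsilon> l tau n = exp (l * (real n * (kappa / (real n powr (3/10))\<^sup>2))
     + l\<^sup>2 * exp (l * tau\<^sup>2) * (real n * kappa) - l * (\<epsilon> * real n))"

definition linear_fail :: "nat \<Rightarrow> real" where
  "linear_fail n = 2 * exp (kappa + 3 - real n powr (1/10))"

definition quad_fail :: "real \<Rightarrow> nat \<Rightarrow> real" where
  "quad_fail \<epsilon> n = 2 * exp (3 * kappa + exp 4 * (2 * kappa + 10) - \<epsilon> * real n powr (1/20))
     + real n * linear_fail n"

definition martingale_fail :: "real \<Rightarrow> real \<Rightarrow> real \<Rightarrow> nat \<Rightarrow> real" where
  "martingale_fail b \<epsilon> l n = 2 * exp (l * (real n * (4 * (3 + kappa) / (b\<^sup>2 * real n)))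
     + l\<^sup>2 * exp (l * (3 * sqrt b * real n + 1)) * (8 * real n + real n * (8 + 2 * kappa)) - l * (\<epsilon> * real n))"

text \<open>The factors count events: one spike and one quadratic form per column, since
  \<open>res\<close> does not depend on the variable; one linear form per variable and column; one
  martingale per variable. The cut-off \<open>4 * \<epsilon>2\<close> is what the squared linear
  form can reach once its truncated part and its large entries have been bounded.\<close>

definition fail_bound :: "real \<Rightarrow> real \<Rightarrow> real \<Rightarrow> real \<Rightarrow> real \<Rightarrow> nat \<Rightarrow> real" where
  "fail_bound \<epsilon>2 \<epsilon>3 l1 l2 tau n = real n * spike_fail \<epsilon>2 l1 tau n + real n * quad_fail \<epsilon>2 n
     + real n * (real n * linear_fail n + martingale_fail (4 * \<epsilon>2) \<epsilon>3 l2 n)"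

text \<open>The bound \<open>tau\<close> on the entries is kept as a hypothesis and not made part of
  \<open>B\<close>: with four moments the probability that some entry of an
  \<open>n\<close>-by-\<open>p\<close> array exceeds a multiple of \<open>sqrt n\<close> need not be
  summable in \<open>n\<close>. Outside \<open>B\<close>, for such entries, the cut-off in
  \<open>inc\<close> never acts, so the stopped drift is \<open>K j\<close> times the martingale
  already estimated.\<close>

lemma bad_event:
  fixes u w :: "nat \<Rightarrow> nat \<Rightarrow> real" and C \<epsilon> \<epsilon>2 :: real
  assumes Q: "orth_proj n Q" and n: "1 \<le> n" and pn: "p \<le> n" and kn: "k \<le> n"
    and w: "\<And>j. j < k \<Longrightarrow> (\<Sum>i<p. (w j i)\<^sup>2) = real p * \<delta> j" and \<delta>: "\<And>j. j < k \<Longrightarrow> 0 \<le> \<delta> j"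
    and C: "1 \<le> C" and \<epsilon>: "0 < \<epsilon>" and \<epsilon>2: "0 < \<epsilon>2" "4 * \<epsilon>2 \<le> 1" "6 * sqrt \<epsilon>2 \<le> \<epsilon>"
    and nn: "real n powr (4/5) \<le> \<epsilon>2 * real n"
    and tau: "0 \<le> tau" and l1: "0 \<le> l1" and l2: "0 \<le> l2"
  shows "\<exists>B \<in> sets (arr_law n p). measure (arr_law n p) B \<le> fail_bound \<epsilon>2 (\<epsilon> / C) l1 l2 tau n \<and>
    (\<forall>x \<in> space (arr_law n p) - B. (\<forall>i<p. \<forall>l<n. \<bar>x i l\<bar> \<le> tau) \<longrightarrow>
      (\<forall>i<p. \<bar>pivot n Q x i - tr n (res n Q x i)\<bar> \<le> \<epsilon> * real n) \<and>
      (\<forall>j<k. \<bar>\<Sum>i<p. if fit_sq n Q (u j) (w j) x i \<le> C * (1 + \<delta> j)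
        then drift n Q (u j) (w j) x i else 0\<bar> \<le> \<epsilon> * real n * (1 + \<delta> j)))"
proof -
  interpret A: prob_space "arr_law n p" by (rule prob_space_PiM) (rule prob_space_col)
  define T where "T = real n powr (3/10)"
  define b where "b = 4 * \<epsilon>2"
  define \<epsilon>3 where "\<epsilon>3 = \<epsilon> / C"
  have n0: "0 < real n" "1 \<le> real n" using n by auto
  have T: "0 < T" "0 \<le> T" using n0 by (simp_all add: T_def)
  have b: "0 < b" "b \<le> 1" using \<epsilon>2 by (simp_all add: b_def)
  define K where "K j = C * (1 + \<delta> j)" for j
  have K: "1 \<le> K j" if "j < k" for j
    using mult_mono[of 1 C 1 "1 + \<delta> j"] C \<delta>[OF that] by (simp add: K_def)
  define f where "f j i x = fit n Q (u j) (w j) x i" for j i x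
  define y where "y j i x = ip n (f j i x) (f j i x)" for j i x
  \<comment> \<open>Normalised coefficients, set to 0 from the first time the squared residual exceeds \<open>K j\<close>; this makes
    the hypotheses of the martingale bound hold for every past.\<close>
  define a where "a j i x = (\<lambda>l. if y j i x \<le> K j then f j i x l / sqrt (K j) else 0)" for j i x
  define om where "om j i = w j i / sqrt (K j)" for j i
  define R where "R i x = res n Q x i" for i x
  define P1 where "P1 i x \<longleftrightarrow> \<epsilon>2 * real n < (\<Sum>l<n. if T < \<bar>x i l\<bar> \<and> \<bar>x i l\<bar> \<le> tau then (x i l)\<^sup>2 else 0)"
    for i and x :: "nat \<Rightarrow> nat \<Rightarrow> real"
  define P2 where "P2 j i x \<longleftrightarrow> real n powr (2/5) < \<bar>\<Sum>l<n. a j i x l * trunc T (x i l)\<bar>" for j i x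
  define P3 where "P3 i x \<longleftrightarrow> \<epsilon>2 * real n < \<bar>ip n (\<lambda>l. trunc T (x i l)) (mv n (R i x) (\<lambda>l. trunc T (x i l))) - tr n (R i x)\<bar>" for i x
  define P4 where "P4 j x \<longleftrightarrow> \<epsilon>3 * real n < \<bar>\<Sum>i<p. inc b n (om j i) (a j i x) (x i)\<bar>" for j x
  have R: "orth_proj n (R i x)" for i x unfolding R_def by (rule orth_proj_res[OF Q])
  have mx: "(\<lambda>x. x i l) \<in> borel_measurable (arr_law n m)" if "i < m" "l < n" for i l m
    by (rule measurable_entry) (use that in auto)
  have mf: "(\<lambda>x. f j i x l) \<in> borel_measurable (arr_law n m)" if "i \<le> m" for i j l m
    unfolding f_def by (rule measurable_fit[OF that])
  have my: "y j i \<in> borel_measurable (arr_law n m)" if "i \<le> m" for i j m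
    unfolding y_def[abs_def] ip_def by (intro borel_measurable_sum borel_measurable_times mf that)
  have ma: "(\<lambda>x. a j i x l) \<in> borel_measurable (arr_law n m)" if "i \<le> m" for i j l m
  proof -
    note [measurable] = my[OF that] mf[OF that]
    show ?thesis unfolding a_def by measurable
  qed
  have mR: "(\<lambda>x. R i x s t) \<in> borel_measurable (arr_law n m)" if "i \<le> m" for i m s t
    unfolding R_def by (rule measurable_res[OF that])
  have mtx: "(\<lambda>x. trunc T (x i l)) \<in> borel_measurable (arr_law n m)" if "i < m" "l < n" for i l m
    by (rule measurable_compose[OF mx[OF that] trunc_measurable])
  have S1: "{x \<in> space (arr_law n m). P1 i x} \<in> sets (arr_law n m)" if "i < m" for i m
  proof -
    have "(\<lambda>x. \<Sum>l<n. if T < \<bar>x i l\<bar> \<and> \<bar>x i l\<bar> \<le> tau then (x i l)\<^sup>2 else 0) \<in> borel_measurable (arr_law n m)"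
    proof (intro borel_measurable_sum)
      fix l assume "l \<in> {..<n}"
      then have [measurable]: "(\<lambda>x. x i l) \<in> borel_measurable (arr_law n m)" using mx that by auto
      show "(\<lambda>x. if T < \<bar>x i l\<bar> \<and> \<bar>x i l\<bar> \<le> tau then (x i l)\<^sup>2 else 0) \<in> borel_measurable (arr_law n m)"
        by measurable
    qed
    then show ?thesis unfolding P1_def by measurable
  qed
  have S2: "{x \<in> space (arr_law n m). P2 j i x} \<in> sets (arr_law n m)" if "i < m" for j i m
  proof -
    have "(\<lambda>x. \<Sum>l<n. a j i x l * trunc T (x i l)) \<in> borel_measurable (arr_law n m)"
      using that by (intro borel_measurable_sum borel_measurable_times ma mtx) auto
    then show ?thesis unfolding P2_def by measurable
  qed
  have S3: "{x \<in> space (arr_law n m). P3 i x} \<in> sets (arr_law n m)" if "i < m" for i m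
  proof -
    have "(\<lambda>x. ip n (\<lambda>l. trunc T (x i l)) (mv n (R i x) (\<lambda>l. trunc T (x i l))) - tr n (R i x)) \<in> borel_measurable (arr_law n m)"
      unfolding ip_def mv_def tr_def using that
      by (intro borel_measurable_diff borel_measurable_sum borel_measurable_times mR mtx) auto
    then show ?thesis unfolding P3_def by measurable
  qed
  have S4: "{x \<in> space (arr_law n p). P4 j x} \<in> sets (arr_law n p)" for j
  proof -
    have "(\<lambda>x. \<Sum>i<p. inc b n (om j i) (a j i x) (x i)) \<in> borel_measurable (arr_law n p)"
    proof (intro borel_measurable_sum)
      fix i assume "i \<in> {..<p}"
      then have "(\<lambda>x. ip n (a j i x) (x i)) \<in> borel_measurable (arr_law n p)"
        "(\<lambda>x. ip n (a j i x) (a j i x)) \<in> borel_measurable (arr_law n p)"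
        unfolding ip_def by (intro borel_measurable_sum borel_measurable_times ma mx; simp)+
      then show "(\<lambda>x. inc b n (om j i) (a j i x) (x i)) \<in> borel_measurable (arr_law n p)"
        unfolding inc_def by measurable
    qed
    then show ?thesis unfolding P4_def by measurable
  qed
  have cong: "f j i x = f j i x'" "a j i x = a j i x'" "R i x = R i x'"
    if "\<And>m. m < i \<Longrightarrow> x m = x' m" for j i and x x' :: "nat \<Rightarrow> nat \<Rightarrow> real"
  proof -
    show 1: "f j i x = f j i x'" unfolding f_def by (rule fit_cong) (use that in auto)
    show "a j i x = a j i x'" unfolding a_def y_def 1 by (rule refl)
    show "R i x = R i x'" unfolding R_def by (rule res_cong) (use that in auto)
  qed
  \<comment> \<open>Changing column \<open>t\<close> affects neither the coefficients nor the
    projection of stage \<open>t\<close>, so the bounds for a single column with fixed coefficients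
    apply conditionally.\<close>
  have upd: "a j t (x(t := z)) = a j t x" "R t (x(t := z)) = R t x" for j t x z
    by (rule cong; simp)+
  have rst: "a j t (restrict x {..<Suc t}) = a j t x" "R t (restrict x {..<Suc t}) = R t x" for j t x
    by (rule cong; simp)+
  have rst': "a j t (restrict x {..<t}) = a j t x" for j t x
    by (rule cong; simp)
  have y0: "0 \<le> y j i x" for j i x by (simp add: y_def ip_self_nonneg)
  have aa: "ip n (a j i x) (a j i x) = (if y j i x \<le> K j then y j i x / K j else 0)" if "j < k" for j i x
    using K[OF that] by (auto simp: a_def y_def ip_def sum_divide_distrib)
  have a1: "ip n (a j i x) (a j i x) \<le> 1" if "j < k" for j i x
    using K[OF that] by (auto simp: aa[OF that] divide_le_eq)
  have om: "(\<Sum>i<p. (om j i)\<^sup>2) \<le> real n" if "j < k" for j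
  proof -
    have "(\<Sum>i<p. (om j i)\<^sup>2) = (\<Sum>i<p. (w j i)\<^sup>2) / K j"
      using K[OF that] by (simp add: om_def power_divide sum_divide_distrib)
    \<comment> \<open>Dividing by \<open>K j\<close>, which exceeds \<open>\<delta> j\<close>,
      removes the size of the noncentrality from all later bounds.\<close>
    also have "\<dots> = real p * (\<delta> j / K j)" by (simp add: w[OF that])
    also have "\<dots> \<le> real p * 1"
    proof (rule mult_left_mono)
      have "\<delta> j \<le> K j" using mult_mono[of 1 C "\<delta> j" "1 + \<delta> j"] C \<delta>[OF that] by (simp add: K_def)
      then show "\<delta> j / K j \<le> 1" using K[OF that] by simp
    qed simp
    finally show ?thesis using pn by simp
  qed
  have om1: "(om j i)\<^sup>2 \<le> real n" if "j < k" "i < p" for j i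
    using member_le_sum[of i "{..<p}" "\<lambda>i. (om j i)\<^sup>2"] om[OF that(1)] that(2) by simp
  define q1 where "q1 = spike_fail \<epsilon>2 l1 tau n"
  define q2 where "q2 = linear_fail n"
  define q3 where "q3 = quad_fail \<epsilon>2 n"
  define q4 where "q4 = martingale_fail b \<epsilon>3 l2 n"
  note q_defs = q1_def q2_def q3_def q4_def spike_fail_def linear_fail_def quad_fail_def martingale_fail_def
  have M1: "measure (arr_law n p) {x \<in> space (arr_law n p). \<exists>i<p. P1 i x} \<le> real p * q1"
  proof (rule measure_ex_less_le[OF prob_space_col S1])
    fix t x
    show "P1 t x = P1 t (restrict x {..<Suc t})" by (simp add: P1_def cong: if_cong)
    show "measure (col_law n) {z \<in> space (col_law n). P1 t (x(t := z))} \<le> q1"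
      using spike_bound[OF T(1) tau l1, of n "\<epsilon>2 * real n"] by (simp add: P1_def q_defs T_def cong: if_cong)
  qed auto
  have M2: "measure (arr_law n p) {x \<in> space (arr_law n p). \<exists>i<p. P2 j i x} \<le> real p * q2" if j: "j < k" for j
  proof (rule measure_ex_less_le[OF prob_space_col S2])
    fix t x
    show "P2 j t x = P2 j t (restrict x {..<Suc t})" by (simp add: P2_def rst)
    have "(\<Sum>l<n. (a j t x l)\<^sup>2) \<le> 1" using a1[OF j, of t x] by (simp add: ip_def power2_eq_square)
    from linear_form_bound[OF n this]
    show "measure (col_law n) {z \<in> space (col_law n). P2 j t (x(t := z))} \<le> q2"
      unfolding P2_def q_defs upd by (simp add: T_def)
  qed auto
  have M3: "measure (arr_law n p) {x \<in> space (arr_law n p). \<exists>i<p. P3 i x} \<le> real p * q3"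
  proof (rule measure_ex_less_le[OF prob_space_col S3])
    fix t x
    show "P3 t x = P3 t (restrict x {..<Suc t})" by (simp add: P3_def rst)
    show "measure (col_law n) {z \<in> space (col_law n). P3 t (x(t := z))} \<le> q3"
      using quad_form_bound[OF n R[of t x], of \<epsilon>2] unfolding P3_def q_defs upd by (simp add: T_def)
  qed auto
  have M4: "measure (arr_law n p) {x \<in> space (arr_law n p). P4 j x} \<le> q4" if j: "j < k" for j
  proof -
    have "measure (arr_law n p) {x \<in> space (arr_law n p). P4 j x} \<le>
      2 * exp (l2 * (real p * (4 * (3 + kappa) / (b\<^sup>2 * real n)))
        + l2\<^sup>2 * exp (l2 * (3 * sqrt b * real n + 1)) * (8 * real n + real p * (8 + 2 * kappa)) - l2 * (\<epsilon>3 * real n))"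
      unfolding P4_def
      by (rule martingale_bound[OF n b l2 ma rst'[symmetric] a1[OF j] om1[OF j] om[OF j]]) auto
    also have "\<dots> \<le> q4"
    proof -
      have "l2 * (real p * (4 * (3 + kappa) / (b\<^sup>2 * real n))) \<le> l2 * (real n * (4 * (3 + kappa) / (b\<^sup>2 * real n)))"
        using pn l2 kappa_nonneg by (intro mult_left_mono mult_right_mono) auto
      moreover have "l2\<^sup>2 * exp (l2 * (3 * sqrt b * real n + 1)) * (8 * real n + real p * (8 + 2 * kappa)) \<le>
         l2\<^sup>2 * exp (l2 * (3 * sqrt b * real n + 1)) * (8 * real n + real n * (8 + 2 * kappa))"
        using pn kappa_nonneg by (intro mult_left_mono add_left_mono mult_right_mono) auto
      ultimately show ?thesis unfolding q_defs
        by (intro mult_left_mono, subst exp_le_cancel_iff) (linarith, simp)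
    qed
    finally show ?thesis .
  qed
  define B1 where "B1 = {x \<in> space (arr_law n p). \<exists>i<p. P1 i x}"
  define B2 where "B2 j = {x \<in> space (arr_law n p). \<exists>i<p. P2 j i x}" for j
  define B3 where "B3 = {x \<in> space (arr_law n p). \<exists>i<p. P3 i x}"
  define B4 where "B4 j = {x \<in> space (arr_law n p). P4 j x}" for j
  have [measurable]: "B1 \<in> sets (arr_law n p)" "B2 j \<in> sets (arr_law n p)" "B3 \<in> sets (arr_law n p)" "B4 j \<in> sets (arr_law n p)" for j
  proof -
    have "B1 = (\<Union>i\<in>{..<p}. {x \<in> space (arr_law n p). P1 i x})" by (auto simp: B1_def)
    also have "\<dots> \<in> sets (arr_law n p)" using S1 by (intro sets.finite_UN) auto
    finally show "B1 \<in> sets (arr_law n p)" .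
    have "B2 j = (\<Union>i\<in>{..<p}. {x \<in> space (arr_law n p). P2 j i x})" by (auto simp: B2_def)
    also have "\<dots> \<in> sets (arr_law n p)" using S2 by (intro sets.finite_UN) auto
    finally show "B2 j \<in> sets (arr_law n p)" .
    have "B3 = (\<Union>i\<in>{..<p}. {x \<in> space (arr_law n p). P3 i x})" by (auto simp: B3_def)
    also have "\<dots> \<in> sets (arr_law n p)" using S3 by (intro sets.finite_UN) auto
    finally show "B3 \<in> sets (arr_law n p)" .
    show "B4 j \<in> sets (arr_law n p)" using S4 by (simp add: B4_def)
  qed
  define B where "B = B1 \<union> B3 \<union> (\<Union>j\<in>{..<k}. B2 j \<union> B4 j)"
  have Bs: "B \<in> sets (arr_law n p)" unfolding B_def by measurable
  have q0: "0 \<le> q1" "0 \<le> q2" "0 \<le> q3" "0 \<le> q4" by (simp_all add: q_defs)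
  have "measure (arr_law n p) B \<le> measure (arr_law n p) B1 + measure (arr_law n p) B3 + measure (arr_law n p) (\<Union>j\<in>{..<k}. B2 j \<union> B4 j)"
    unfolding B_def by (intro order_trans[OF measure_Un_le] add_right_mono measure_Un_le) measurable
  also have "measure (arr_law n p) (\<Union>j\<in>{..<k}. B2 j \<union> B4 j) \<le> (\<Sum>j<k. measure (arr_law n p) (B2 j \<union> B4 j))"
    by (rule A.finite_measure_subadditive_finite) auto
  also have "\<dots> \<le> (\<Sum>j<k. real p * q2 + q4)"
  proof (rule sum_mono)
    fix j assume "j \<in> {..<k}"
    then have j: "j < k" by simp
    have "measure (arr_law n p) (B2 j \<union> B4 j) \<le> measure (arr_law n p) (B2 j) + measure (arr_law n p) (B4 j)"
      by (rule measure_Un_le) measurable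
    then show "measure (arr_law n p) (B2 j \<union> B4 j) \<le> real p * q2 + q4"
      using M2[OF j] M4[OF j] by (simp add: B2_def B4_def)
  qed
  also have "\<dots> = real k * (real p * q2 + q4)" by simp
  also have "\<dots> \<le> real n * (real n * q2 + q4)"
    using kn pn q0 by (intro mult_mono add_right_mono mult_right_mono) auto
  also have "measure (arr_law n p) B1 \<le> real n * q1"
    using M1 pn q0 mult_right_mono[of "real p" "real n" q1] by (simp add: B1_def)
  also have "measure (arr_law n p) B3 \<le> real n * q3"
    using M3 pn q0 mult_right_mono[of "real p" "real n" q3] by (simp add: B3_def)
  finally have Bm: "measure (arr_law n p) B \<le> fail_bound \<epsilon>2 (\<epsilon> / C) l1 l2 tau n"
    unfolding fail_bound_def q1_def q2_def q3_def q4_def b_def \<epsilon>3_def by simp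
  {
    fix x assume x: "x \<in> space (arr_law n p) - B" and small: "\<And>i l. i < p \<Longrightarrow> l < n \<Longrightarrow> \<bar>x i l\<bar> \<le> tau"
    have nP: "\<not> P1 i x" "\<not> P3 i x" "j < k \<Longrightarrow> \<not> P2 j i x" if "i < p" for i j
      using x that by (auto simp: B_def B1_def B2_def B3_def)
    have nP4: "\<not> P4 j x" if "j < k" for j
      using x that by (auto simp: B_def B4_def)
    define d where "d i l = x i l - trunc T (x i l)" for i l
    have dd: "ip n (d i) (d i) \<le> \<epsilon>2 * real n" if "i < p" for i
    proof -
      have "ip n (d i) (d i) = (\<Sum>l<n. if T < \<bar>x i l\<bar> \<and> \<bar>x i l\<bar> \<le> tau then (x i l)\<^sup>2 else 0)"
        unfolding ip_def using small[OF that]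
        by (intro sum.cong refl) (auto simp: d_def trunc_def power2_eq_square)
      then show ?thesis using nP(1)[OF that] by (simp add: P1_def)
    qed
    have xd: "x i = (\<lambda>l. trunc T (x i l) + d i l)" for i by (simp add: d_def)
    have "\<bar>pivot n Q x i - tr n (res n Q x i)\<bar> \<le> \<epsilon> * real n" if i: "i < p" for i
    proof -
      define v where "v = (\<lambda>l. trunc T (x i l))"
      have q: "\<bar>ip n v (mv n (R i x) v) - tr n (R i x)\<bar> \<le> \<epsilon>2 * real n"
        using nP(2)[OF i] by (simp add: P3_def v_def)
      have e1: "\<epsilon>2 * real n \<le> 1 * real n" using \<epsilon>2 by (intro mult_right_mono) auto
      have "ip n v (mv n (R i x) v) \<le> 4 * real n"
        using q tr_le[OF R[of i x]] e1 by (simp add: abs_le_iff)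
      from quad_form_perturb[OF R this dd[OF i]] \<epsilon>2
      have "\<bar>ip n (\<lambda>l. v l + d i l) (mv n (R i x) (\<lambda>l. v l + d i l)) - ip n v (mv n (R i x) v)\<bar> \<le> 5 * sqrt \<epsilon>2 * real n"
        by simp
      then have "\<bar>pivot n Q x i - ip n v (mv n (R i x) v)\<bar> \<le> 5 * sqrt \<epsilon>2 * real n"
        unfolding pivot_def R_def[symmetric] v_def xd[symmetric] .
      moreover have "\<epsilon>2 * real n \<le> sqrt \<epsilon>2 * real n"
        using \<epsilon>2 by (intro mult_right_mono real_le_rsqrt) (auto simp: power2_eq_square mult_left_le)
      \<comment> \<open>Five for the passage from the truncated to the actual column and one for the
        deviation of the truncated form from the trace.\<close>
      ultimately have "\<bar>pivot n Q x i - tr n (R i x)\<bar> \<le> 6 * sqrt \<epsilon>2 * real n" using q by linarith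
      also have "\<dots> \<le> \<epsilon> * real n" using \<epsilon>2 by (intro mult_right_mono) auto
      finally show ?thesis by (simp add: R_def)
    qed
    note piv = this
    have "\<bar>\<Sum>i<p. if fit_sq n Q (u j) (w j) x i \<le> C * (1 + \<delta> j)
        then drift n Q (u j) (w j) x i else 0\<bar> \<le> \<epsilon> * real n * (1 + \<delta> j)"
      if j: "j < k" for j
    proof -
      have trm: "(if y j i x \<le> K j then 2 * w j i * ip n (f j i x) (x i) + (ip n (f j i x) (x i))\<^sup>2 - y j i x else 0)
         = K j * inc b n (om j i) (a j i x) (x i)" if i: "i < p" for i
      proof -
        define s where "s = ip n (a j i x) (x i)"
        have sd: "s = ip n (a j i x) (\<lambda>l. trunc T (x i l)) + ip n (a j i x) (d i)"
          unfolding s_def by (subst xd) (simp add: ip_def distrib_left sum.distrib)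
        have s1: "(ip n (a j i x) (\<lambda>l. trunc T (x i l)))\<^sup>2 \<le> real n powr (4/5)"
        proof -
          have "\<bar>ip n (a j i x) (\<lambda>l. trunc T (x i l))\<bar> \<le> real n powr (2/5)"
            using nP(3)[OF i j] by (simp add: P2_def ip_def)
          then have "\<bar>ip n (a j i x) (\<lambda>l. trunc T (x i l))\<bar>\<^sup>2 \<le> (real n powr (2/5))\<^sup>2"
            by (rule power_mono) simp
          then show ?thesis using n0 by (simp add: powr_power)
        qed
        have s2: "(ip n (a j i x) (d i))\<^sup>2 \<le> \<epsilon>2 * real n"
          using mult_mono[OF a1[OF j, of i x] dd[OF i]] ip_Cauchy_Schwarz[of n "a j i x" "d i"]
          by (simp add: ip_self_nonneg)
        from power2_add_le[of "ip n (a j i x) (\<lambda>l. trunc T (x i l))" "ip n (a j i x) (d i)"]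
        \<comment> \<open>Twice \<open>n powr (4/5) \<le> \<epsilon>2 * real n\<close> plus twice
          \<open>\<epsilon>2 * real n\<close> gives \<open>b = 4 * \<epsilon>2\<close>.\<close>
        have "s\<^sup>2 \<le> b * real n" using s1 s2 nn unfolding sd b_def by linarith
        then have inc: "inc b n (om j i) (a j i x) (x i) = 2 * om j i * s + s\<^sup>2 - ip n (a j i x) (a j i x)"
          by (simp add: inc_def s_def)
        show ?thesis
        proof (cases "y j i x \<le> K j")
          case True
          have "s = ip n (f j i x) (x i) / sqrt (K j)"
            using True by (simp add: s_def a_def ip_def sum_divide_distrib)
          then show ?thesis unfolding inc aa[OF j] using True K[OF j]
            by (simp add: om_def power_divide algebra_simps)
        next
          case False
          then have "s = 0" by (simp add: s_def a_def ip_def)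
          then show ?thesis unfolding inc aa[OF j] using False by simp
        qed
      qed
      have "\<bar>\<Sum>i<p. if y j i x \<le> K j then 2 * w j i * ip n (f j i x) (x i) + (ip n (f j i x) (x i))\<^sup>2 - y j i x else 0\<bar>
         = K j * \<bar>\<Sum>i<p. inc b n (om j i) (a j i x) (x i)\<bar>"
        using trm K[OF j] by (simp add: sum_distrib_left[symmetric] abs_mult)
      also have "\<dots> \<le> K j * (\<epsilon>3 * real n)"
        using nP4[OF j] K[OF j] by (intro mult_left_mono) (auto simp: P4_def)
      also have "\<dots> = \<epsilon> * real n * (1 + \<delta> j)" using C by (simp add: K_def \<epsilon>3_def)
      finally show ?thesis unfolding y_def f_def K_def .
    qed
    note piv this
  }
  with Bs Bm show ?thesis by blast
qed

end

section \<open>Almost sure convergence\<close>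

text \<open>Of the four powers of \<open>n\<close> in the exponential, one pays for the union over
  \<open>n\<close> events and one for the constant \<open>exp 1\<close>; the remaining two are
  summable.\<close>

lemma eventually_exp_bound:
  fixes h :: "nat \<Rightarrow> real"
  assumes "h \<longlonglongrightarrow> 0"
  shows "eventually (\<lambda>n. real n * exp (h n - 4 * ln (real n)) \<le> 1 / (real n)\<^sup>2) sequentially"
proof -
  have "eventually (\<lambda>n. h n < 1) sequentially" using order_tendstoD(2)[OF assms, of 1] by simp
  moreover have "eventually (\<lambda>n. 3 \<le> real n) sequentially" by real_asymp
  ultimately show ?thesis
  proof eventually_elim
    case (elim n)
    have "exp (h n - 4 * ln (real n)) \<le> exp (1 - 4 * ln (real n))" using elim by simp
    also have "\<dots> = exp 1 / real n ^ 4"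
      using elim by (simp add: exp_diff exp_of_nat_mult[of 4, simplified])
    also have "\<dots> \<le> real n / real n ^ 4" using exp_le elim by (intro divide_right_mono) auto
    finally have "real n * exp (h n - 4 * ln (real n)) \<le> real n * (real n / real n ^ 4)"
      by (rule mult_left_mono) simp
    also have "\<dots> = 1 / (real n)\<^sup>2" using elim by (simp add: power4_eq_xxxx power2_eq_square)
    finally show ?case .
  qed
qed

lemma eventually_times_bound:
  fixes h :: "nat \<Rightarrow> real"
  assumes "(\<lambda>n. h n * (real n)\<^sup>2) \<longlonglongrightarrow> 0"
  shows "eventually (\<lambda>n. c * h n \<le> 1 / (real n)\<^sup>2) sequentially"
proof -
  have "(\<lambda>n. c * (h n * (real n)\<^sup>2)) \<longlonglongrightarrow> c * 0" by (intro tendsto_mult assms tendsto_const)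
  then have "eventually (\<lambda>n. c * (h n * (real n)\<^sup>2) < 1) sequentially"
    using order_tendstoD(2)[of _ "c * 0" sequentially 1] by simp
  moreover have "eventually (\<lambda>n. 1 \<le> real n) sequentially" by real_asymp
  ultimately show ?thesis by eventually_elim (simp add: pos_le_divide_eq)
qed

context std_law begin

text \<open>The exponents \<open>l1\<close> and \<open>l2\<close> are chosen so that exceeding the
  allowed multiple of \<open>n\<close> has weight \<open>n^(-4)\<close>. The level
  \<open>tau\<close> and the hypothesis on \<open>\<epsilon>2\<close> keep the exponentials in the
  variance terms at order \<open>sqrt n\<close>; as \<open>(ln n / n)^2 * sqrt n * n\<close> tends
  to 0, these terms are harmless.\<close>

lemma eventually_fail_bound_le:
  assumes e2: "0 < \<epsilon>2" and e3: "0 < \<epsilon>3" and b: "3 * sqrt (4 * \<epsilon>2) \<le> \<epsilon>3 / 8"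
  defines "l1 \<equiv> \<lambda>n. 4 * ln (real n) / (\<epsilon>2 * real n)"
    and "l2 \<equiv> \<lambda>n. 4 * ln (real n) / (\<epsilon>3 * real n)"
    and "tau \<equiv> \<lambda>n. sqrt (\<epsilon>2 / 8 * real n)"
  shows "eventually (\<lambda>n. fail_bound \<epsilon>2 \<epsilon>3 (l1 n) (l2 n) (tau n) n \<le> 6 * (1 / (real n)\<^sup>2)) sequentially"
proof -
  have pos: "eventually (\<lambda>n. 1 \<le> real n) sequentially" by real_asymp
  have t1: "(\<lambda>n. 4 / \<epsilon>2 * kappa * (ln (real n) / (real n powr (3/10))\<^sup>2)
     + (4 / \<epsilon>2)\<^sup>2 * kappa * ((ln (real n) / real n)\<^sup>2 * (sqrt (real n) * real n))) \<longlonglongrightarrow> 4 / \<epsilon>2 * kappa * 0 + (4 / \<epsilon>2)\<^sup>2 * kappa * 0"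
    by (intro tendsto_add tendsto_mult tendsto_const; real_asymp)
  have ev1: "eventually (\<lambda>n. real n * spike_fail \<epsilon>2 (l1 n) (tau n) n \<le> 1 / (real n)\<^sup>2) sequentially"
    using eventually_exp_bound[OF t1[simplified]] pos
  proof eventually_elim
    case (elim n)
    have "l1 n * (tau n)\<^sup>2 = ln (real n) / 2" using e2 elim by (simp add: l1_def tau_def)
    then have ex: "exp (l1 n * (tau n)\<^sup>2) = sqrt (real n)"
      using elim by (simp add: ln_sqrt[symmetric])
    have l: "l1 n * (\<epsilon>2 * real n) = 4 * ln (real n)" using e2 elim by (simp add: l1_def)
    have r1: "l1 n * (real n * (kappa / (real n powr (3/10))\<^sup>2)) = 4 / \<epsilon>2 * kappa * (ln (real n) / (real n powr (3/10))\<^sup>2)"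
      using e2 elim by (simp add: l1_def)
    have r2: "(l1 n)\<^sup>2 * sqrt (real n) * (real n * kappa) =
       (4 / \<epsilon>2)\<^sup>2 * kappa * ((ln (real n) / real n)\<^sup>2 * (sqrt (real n) * real n))"
      by (simp add: l1_def power_mult_distrib power_divide)
    show ?case unfolding spike_fail_def ex l r1 r2 using elim(1) by simp
  qed
  have ev2: "eventually (\<lambda>n. exp (3 * kappa + exp 4 * (2 * kappa + 10)) * (real n * (2 * exp (- \<epsilon>2 * real n powr (1/20)))) \<le> 1 / (real n)\<^sup>2) sequentially"
    by (rule eventually_times_bound) (use e2 in real_asymp)
  have ev3: "eventually (\<lambda>n. exp (kappa + 3) * (real n * (real n * (2 * exp (- (real n powr (1/10)))))) \<le> 1 / (real n)\<^sup>2) sequentially"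
    by (rule eventually_times_bound) real_asymp
  have t4: "(\<lambda>n. 4 / \<epsilon>3 * (4 * (3 + kappa) / (4 * \<epsilon>2)\<^sup>2) * (ln (real n) / real n)
     + (4 / \<epsilon>3)\<^sup>2 * (16 + 2 * kappa) * ((ln (real n) / real n)\<^sup>2 * (sqrt (real n) * exp 1 * real n))) \<longlonglongrightarrow>
      4 / \<epsilon>3 * (4 * (3 + kappa) / (4 * \<epsilon>2)\<^sup>2) * 0 + (4 / \<epsilon>3)\<^sup>2 * (16 + 2 * kappa) * 0"
    by (intro tendsto_add tendsto_mult tendsto_const; real_asymp)
  have l2l: "l2 \<longlonglongrightarrow> 0"
  proof -
    have "(\<lambda>n. 4 / \<epsilon>3 * (ln (real n) / real n)) \<longlonglongrightarrow> 4 / \<epsilon>3 * 0"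
      by (intro tendsto_mult tendsto_const) real_asymp
    then show ?thesis by (simp add: l2_def)
  qed
  have ev4: "eventually (\<lambda>n. real n * (martingale_fail (4 * \<epsilon>2) \<epsilon>3 (l2 n) n / 2) \<le> 1 / (real n)\<^sup>2) sequentially"
    using eventually_exp_bound[OF t4[simplified]] order_tendstoD(2)[OF l2l, of 1, simplified] pos
  proof eventually_elim
    case (elim n)
    have l0: "0 \<le> l2 n" using elim e3 by (simp add: l2_def)
    have l: "l2 n * (\<epsilon>3 * real n) = 4 * ln (real n)" using e3 elim by (simp add: l2_def)
    have r1: "l2 n * (real n * (4 * (3 + kappa) / ((4 * \<epsilon>2)\<^sup>2 * real n))) = 4 / \<epsilon>3 * (4 * (3 + kappa) / (4 * \<epsilon>2)\<^sup>2) * (ln (real n) / real n)"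
    proof -
      have "real n * (4 * (3 + kappa) / ((4 * \<epsilon>2)\<^sup>2 * real n)) = 4 * (3 + kappa) / (4 * \<epsilon>2)\<^sup>2"
        using elim by simp
      moreover have "l2 n * A = 4 / \<epsilon>3 * A * (ln (real n) / real n)" for A
        by (simp add: l2_def)
      ultimately show ?thesis by (simp only:)
    qed
    have "l2 n * (3 * sqrt (4 * \<epsilon>2) * real n + 1) \<le> l2 n * (\<epsilon>3 / 8 * real n) + 1"
      using mult_left_mono[OF mult_right_mono[OF b, of "real n"] l0] elim by (simp add: distrib_left)
    also have "l2 n * (\<epsilon>3 / 8 * real n) = ln (real n) / 2" using l by simp
    finally have "exp (l2 n * (3 * sqrt (4 * \<epsilon>2) * real n + 1)) \<le> exp (ln (real n) / 2 + 1)" by simp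
    also have "\<dots> = sqrt (real n) * exp 1" using elim by (simp add: exp_add ln_sqrt[symmetric])
    finally have ex: "exp (l2 n * (3 * sqrt (4 * \<epsilon>2) * real n + 1)) \<le> sqrt (real n) * exp 1" .
    have "(l2 n)\<^sup>2 * exp (l2 n * (3 * sqrt (4 * \<epsilon>2) * real n + 1)) * (8 * real n + real n * (8 + 2 * kappa))
      \<le> (l2 n)\<^sup>2 * (sqrt (real n) * exp 1) * (8 * real n + real n * (8 + 2 * kappa))"
      using ex kappa_nonneg by (intro mult_left_mono mult_right_mono) auto
    also have "\<dots> = (4 / \<epsilon>3)\<^sup>2 * (16 + 2 * kappa) * ((ln (real n) / real n)\<^sup>2 * (sqrt (real n) * exp 1 * real n))"
      by (simp add: l2_def power_mult_distrib power_divide algebra_simps add_divide_distrib)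
    finally have r2: "(l2 n)\<^sup>2 * exp (l2 n * (3 * sqrt (4 * \<epsilon>2) * real n + 1)) * (8 * real n + real n * (8 + 2 * kappa))
      \<le> (4 / \<epsilon>3)\<^sup>2 * (16 + 2 * kappa) * ((ln (real n) / real n)\<^sup>2 * (sqrt (real n) * exp 1 * real n))" .
    have "real n * (martingale_fail (4 * \<epsilon>2) \<epsilon>3 (l2 n) n / 2)
      \<le> real n * exp (4 / \<epsilon>3 * (4 * (3 + kappa) / (4 * \<epsilon>2)\<^sup>2) * (ln (real n) / real n) +
        (4 / \<epsilon>3)\<^sup>2 * (16 + 2 * kappa) * ((ln (real n) / real n)\<^sup>2 * (sqrt (real n) * exp 1 * real n)) - 4 * ln (real n))"
      unfolding martingale_fail_def r1 l nonzero_mult_div_cancel_left[OF zero_neq_numeral[symmetric]]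
      by (intro mult_left_mono, subst exp_le_cancel_iff) (use r2 in linarith, simp)
    then show ?case using elim(1) by simp
  qed
  show ?thesis using ev1 ev2 ev3 ev4
  proof eventually_elim
    case (elim n)
    have "exp (3 * kappa + exp 4 * (2 * kappa + 10) - \<epsilon>2 * real n powr (1/20)) =
       exp (3 * kappa + exp 4 * (2 * kappa + 10)) * exp (- \<epsilon>2 * real n powr (1/20))"
      by (simp add: exp_add[symmetric])
    moreover have "exp (kappa + 3 - real n powr (1/10)) = exp (kappa + 3) * exp (- (real n powr (1/10)))"
      by (simp add: exp_add[symmetric])
    \<comment> \<open>The linear forms occur twice, inside the quadratic forms and on their own, and
      the two-sided martingale bound carries a factor 2. The four estimates thus add up to 1 + 1 + 2
      + 2 = 6.\<close>
    ultimately have "fail_bound \<epsilon>2 \<epsilon>3 (l1 n) (l2 n) (tau n) n = real n * spike_fail \<epsilon>2 (l1 n) (tau n) n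
      + exp (3 * kappa + exp 4 * (2 * kappa + 10)) * (real n * (2 * exp (- \<epsilon>2 * real n powr (1/20))))
      + 2 * (exp (kappa + 3) * (real n * (real n * (2 * exp (- (real n powr (1/10)))))))
      + 2 * (real n * (martingale_fail (4 * \<epsilon>2) \<epsilon>3 (l2 n) n / 2))"
      unfolding fail_bound_def quad_fail_def linear_fail_def by (simp add: algebra_simps)
    then show ?case using elim by linarith
  qed
qed

text \<open>The weight \<open>2 (N + 1)\<close> bounds the number of index pairs with maximum \<open>N\<close>.\<close>
lemma summable_tail:
  assumes "0 < \<eta>"
  shows "summable (\<lambda>N. 2 * (real N + 1) * measure D {y. \<eta> * sqrt (real N + 1) < \<bar>y\<bar>})"
proof (rule summableI_nonneg_bounded)
  fix m
  have S: "{y. \<eta> * sqrt (real N + 1) < \<bar>y\<bar>} \<in> sets D" for N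
    unfolding sets_D by measurable
  have pt: "(\<Sum>N<m. 2 * (real N + 1) * indicator {y. \<eta> * sqrt (real N + 1) < \<bar>y\<bar>} y) \<le> 2 / \<eta> ^ 4 * y ^ 4" for y :: real
  proof -
    define Z where "Z = y\<^sup>2 / \<eta>\<^sup>2"
    have Z0: "0 \<le> Z" by (simp add: Z_def)
    have iff: "\<eta> * sqrt (real N + 1) < \<bar>y\<bar> \<longleftrightarrow> real N + 1 < Z" for N
    proof -
      have "\<eta> * sqrt (real N + 1) < \<bar>y\<bar> \<longleftrightarrow> \<not> \<bar>y\<bar> \<le> \<bar>\<eta> * sqrt (real N + 1)\<bar>"
        using assms by auto
      also have "\<dots> \<longleftrightarrow> (\<eta> * sqrt (real N + 1))\<^sup>2 < y\<^sup>2"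
        by (simp only: abs_le_square_iff not_le)
      also have "\<dots> \<longleftrightarrow> real N + 1 < Z"
        using assms by (simp add: Z_def power_mult_distrib pos_less_divide_eq mult.commute)
      finally show ?thesis .
    qed
    define g where "g N = 2 * (real N + 1) * (indicator {y. \<eta> * sqrt (real N + 1) < \<bar>y\<bar>} y :: real)" for N
    have g: "g N = (if real N + 1 < Z then 2 * (real N + 1) else 0)" for N
      by (simp add: g_def indicator_def iff)
    \<comment> \<open>Only indices with \<open>N + 1 < Z\<close> contribute, and
      \<open>2 * (N + 1)\<close> is at most twice the difference of the squares of
      \<open>N + 1\<close> and \<open>N\<close>. So the sum is at most of order
      \<open>Z\<^sup>2\<close>, which is a multiple of \<open>y^4\<close>, and the fourth moment is
      just enough.\<close>
    have "(\<Sum>N<m. g N) \<le> 2 * (min Z (real m))\<^sup>2"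
    proof (induction m)
      case (Suc m)
      show ?case
      proof (cases "real m + 1 < Z")
        case True
        then have "min Z (real m) = real m" "min Z (real (Suc m)) = real m + 1" by auto
        then show ?thesis using Suc g[of m] True by (simp add: power2_eq_square algebra_simps)
      next
        case False
        have "(min Z (real m))\<^sup>2 \<le> (min Z (real (Suc m)))\<^sup>2"
          using Z0 by (intro power_mono) auto
        then show ?thesis using Suc False g[of m] by simp
      qed
    qed simp
    then have "(\<Sum>N<m. 2 * (real N + 1) * indicator {y. \<eta> * sqrt (real N + 1) < \<bar>y\<bar>} y) \<le> 2 * (min Z (real m))\<^sup>2"
      by (simp only: g_def)
    also have "\<dots> \<le> 2 * Z\<^sup>2" using Z0 by (intro mult_left_mono power_mono) auto
    finally show ?thesis by (simp add: Z_def power_divide)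
  qed
  have "(\<Sum>N<m. 2 * (real N + 1) * measure D {y. \<eta> * sqrt (real N + 1) < \<bar>y\<bar>}) =
     (\<integral>y. (\<Sum>N<m. 2 * (real N + 1) * indicator {y. \<eta> * sqrt (real N + 1) < \<bar>y\<bar>} y) \<partial>D)"
    using S by (subst Bochner_Integration.integral_sum) (auto simp: emeasure_eq_measure)
  also have "\<dots> \<le> (\<integral>y. 2 / \<eta> ^ 4 * y ^ 4 \<partial>D)"
    by (rule integral_mono'[OF _ pt]) (use int4 in auto)
  also have "\<dots> = 2 / \<eta> ^ 4 * kappa" by (simp add: kappa_def)
  finally show "(\<Sum>N<m. 2 * (real N + 1) * measure D {y. \<eta> * sqrt (real N + 1) < \<bar>y\<bar>}) \<le> 2 / \<eta> ^ 4 * kappa" .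
qed simp

end

locale iid_array = prob_space M for M :: "'a measure" +
  fixes e :: "nat \<Rightarrow> nat \<Rightarrow> 'a \<Rightarrow> real"
  assumes indep: "indep_vars (\<lambda>_. borel) (\<lambda>(i, j). e i j) UNIV"
    and ident: "\<And>i j. distr M borel (e i j) = distr M borel (e 0 0)"
    and std: "std_law (distr M borel (e 0 0))"
begin

sublocale L: std_law "distr M borel (e 0 0)" by (rule std)

abbreviation "col_law \<equiv> L.col_law"
abbreviation "arr_law \<equiv> L.arr_law"

lemma measurable_e [measurable]: "e i j \<in> borel_measurable M"
  using indep by (auto simp: indep_vars_def)

text \<open>Borel-Cantelli is applied to shells, each made of the entries whose larger index equals
  \<open>N\<close>, so that every entry is tested once and against the lowest threshold at which it
  occurs. Testing the whole array anew for each \<open>n\<close> would not give a summable series in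
  general.\<close>

lemma entries_small:
  assumes \<eta>: "0 < \<eta>"
  shows "AE \<omega> in M. eventually (\<lambda>n. \<forall>i<n. \<forall>l<n. \<bar>e l i \<omega>\<bar> \<le> \<eta> * sqrt (real n)) sequentially"
proof -
  define P where "P N = ({..N} \<times> {N}) \<union> ({N} \<times> {..N})" for N :: nat
  define A where "A N = (\<Union>z\<in>P N. {\<omega> \<in> space M. \<eta> * sqrt (real N + 1) < \<bar>e (fst z) (snd z) \<omega>\<bar>})" for N
  have fin: "finite (P N)" for N by (simp add: P_def)
  have card: "real (card (P N)) \<le> 2 * (real N + 1)" for N
    using card_Un_le[of "{..N} \<times> {N}" "{N} \<times> {..N}"] by (simp add: P_def card_cartesian_product)
  have Am [measurable]: "A N \<in> sets M" for N
    unfolding A_def by (intro sets.finite_UN fin) measurable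
  define q where "q N = measure (distr M borel (e 0 0)) {y. \<eta> * sqrt (real N + 1) < \<bar>y\<bar>}" for N
  have Aq: "measure M (A N) \<le> 2 * (real N + 1) * q N" for N
  proof -
    have "measure M (A N) \<le> (\<Sum>z\<in>P N. measure M {\<omega> \<in> space M. \<eta> * sqrt (real N + 1) < \<bar>e (fst z) (snd z) \<omega>\<bar>})"
      unfolding A_def by (rule finite_measure_subadditive_finite[OF fin]) auto
    also have "\<dots> = (\<Sum>z\<in>P N. q N)"
    proof (rule sum.cong[OF refl])
      fix z
      have "q N = measure (distr M borel (e (fst z) (snd z))) {y. \<eta> * sqrt (real N + 1) < \<bar>y\<bar>}"
        unfolding q_def ident[of "fst z" "snd z"] ..
      also have "\<dots> = measure M {\<omega> \<in> space M. \<eta> * sqrt (real N + 1) < \<bar>e (fst z) (snd z) \<omega>\<bar>}"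
        by (subst measure_distr) (auto intro!: arg_cong[where f = "measure M"])
      finally show "measure M {\<omega> \<in> space M. \<eta> * sqrt (real N + 1) < \<bar>e (fst z) (snd z) \<omega>\<bar>} = q N" ..
    qed
    also have "\<dots> \<le> 2 * (real N + 1) * q N"
      using card[of N] by (simp add: q_def mult_right_mono)
    finally show ?thesis .
  qed
  have "summable (\<lambda>N. measure M (A N))"
    by (rule summable_comparison_test'[OF L.summable_tail[OF \<eta>]]) (use Aq in \<open>auto simp: q_def\<close>)
  then have "AE \<omega> in M. eventually (\<lambda>N. \<omega> \<in> space M - A N) sequentially"
    by (intro borel_cantelli_AE1) (auto simp: emeasure_eq_measure)
  then show ?thesis
  proof eventually_elim
    case (elim \<omega>)
    then obtain N0 where N0: "\<And>N. N \<ge> N0 \<Longrightarrow> \<omega> \<in> space M - A N" by (auto simp: eventually_sequentially)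
    have large: "\<bar>e l i \<omega>\<bar> \<le> \<eta> * sqrt (real (max l i) + 1)" if "N0 \<le> max l i" for l i
    proof -
      have "(l, i) \<in> P (max l i)" by (auto simp: P_def max_def)
      then show ?thesis using N0[OF that] by (auto simp: A_def not_less)
    qed
    \<comment> \<open>The finitely many entries from shells before \<open>N0\<close> are bounded by
      a constant depending on \<open>\<omega>\<close>, which the threshold eventually
      exceeds.\<close>
    define c where "c = (\<Sum>l<N0. \<Sum>i<N0. \<bar>e l i \<omega>\<bar>)"
    have c: "\<bar>e l i \<omega>\<bar> \<le> c" if "l < N0" "i < N0" for l i
    proof -
      have "\<bar>e l i \<omega>\<bar> \<le> (\<Sum>i<N0. \<bar>e l i \<omega>\<bar>)" using that by (intro member_le_sum) auto
      also have "\<dots> \<le> c" unfolding c_def using that by (intro member_le_sum sum_nonneg) auto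
      finally show ?thesis .
    qed
    have "filterlim (\<lambda>n. \<eta> * sqrt (real n)) at_top sequentially" using \<eta> by real_asymp
    then have "eventually (\<lambda>n. c \<le> \<eta> * sqrt (real n)) sequentially" by (simp add: filterlim_at_top)
    then show ?case
    proof eventually_elim
      case (elim n)
      show ?case
      proof (intro allI impI)
        fix i l assume il: "i < n" "l < n"
        show "\<bar>e l i \<omega>\<bar> \<le> \<eta> * sqrt (real n)"
        proof (cases "N0 \<le> max l i")
          case True
          have "\<eta> * sqrt (real (max l i) + 1) \<le> \<eta> * sqrt (real n)"
            using \<eta> il by (intro mult_left_mono real_sqrt_le_mono) auto
          then show ?thesis using large[OF True] by simp
        next
          case False
          then have "l < N0" "i < N0" by auto
          from c[OF this] elim show ?thesis by linarith
        qed
      qed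
    qed
  qed
qed

text \<open>The column index comes first, so that a column of errors is one coordinate of the
  product space. The restrictions put the array into that space.\<close>

definition arrange :: "nat \<Rightarrow> nat \<Rightarrow> 'a \<Rightarrow> nat \<Rightarrow> nat \<Rightarrow> real" where
  "arrange n p \<omega> = (\<lambda>i\<in>{..<p}. \<lambda>l\<in>{..<n}. e l i \<omega>)"

text \<open>Independence of the double array is used in two groupings: blocks with a single entry
  give independence within a column, and blocks consisting of a column give independence of the
  columns. Both index sets must be nonempty for the passage to joint laws.\<close>

lemma distr_arrange:
  assumes n: "0 < n" and p: "0 < p"
  shows "arrange n p \<in> measurable M (arr_law n p)" "distr M (arr_law n p) (arrange n p) = arr_law n p"
proof -
  let ?D = "distr M borel (e 0 0)"
  have setsc: "sets (PiM {..<n} (\<lambda>_. borel)) = sets (col_law n)" by (intro sets_PiM_cong) auto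
  have setsa: "sets (PiM {..<p} (\<lambda>_. PiM {..<n} (\<lambda>_. borel))) = sets (arr_law n p)" by (intro sets_PiM_cong setsc) auto
  have comp: "(\<lambda>x. x z) \<in> borel_measurable (PiM K (\<lambda>_. borel))" if "z \<in> K" for z :: "nat \<times> nat" and K
    using measurable_component_singleton[OF that, of "\<lambda>_. borel"] by simp
  have row: "indep_vars (\<lambda>_. borel) (\<lambda>l. e l i) {..<n}" for i
  proof -
    have "indep_vars (\<lambda>l. PiM {(l, i)} (\<lambda>_. borel))
       (\<lambda>l \<omega>. restrict (\<lambda>z. (case z of (l, i) \<Rightarrow> e l i) \<omega>) {(l, i)}) {..<n}"
      by (rule indep_vars_restrict[OF indep]) (auto simp: disjoint_family_on_def)
    then have "indep_vars (\<lambda>_. borel)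
       (\<lambda>l \<omega>. (\<lambda>x. x (l, i)) (restrict (\<lambda>z. (case z of (l, i) \<Rightarrow> e l i) \<omega>) {(l, i)})) {..<n}"
      by (rule indep_vars_compose2) (auto intro: comp)
    then show ?thesis by simp
  qed
  have cold: "distr M (PiM {..<n} (\<lambda>_. borel)) (\<lambda>\<omega>. \<lambda>l\<in>{..<n}. e l i \<omega>) = col_law n" for i
  proof -
    have "distr M (PiM {..<n} (\<lambda>_. borel)) (\<lambda>\<omega>. \<lambda>l\<in>{..<n}. e l i \<omega>) = PiM {..<n} (\<lambda>l. distr M borel (e l i))"
      using row[of i] n by (subst (asm) indep_vars_iff_distr_eq_PiM') auto
    also have "\<dots> = col_law n" by (rule PiM_cong) (auto intro: ident)
    finally show ?thesis .
  qed
  have "indep_vars (\<lambda>i. PiM ({..<n} \<times> {i}) (\<lambda>_. borel))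
     (\<lambda>i \<omega>. restrict (\<lambda>z. (case z of (l, i) \<Rightarrow> e l i) \<omega>) ({..<n} \<times> {i})) {..<p}"
    by (rule indep_vars_restrict[OF indep]) (auto simp: disjoint_family_on_def)
  moreover have "(\<lambda>x. \<lambda>l\<in>{..<n}. x (l, i)) \<in>
     measurable (PiM ({..<n} \<times> {i}) (\<lambda>_. borel)) (PiM {..<n} (\<lambda>_. borel :: real measure))" for i :: nat
    by (rule measurable_restrict) (rule comp, simp)
  ultimately have "indep_vars (\<lambda>_. PiM {..<n} (\<lambda>_. borel))
     (\<lambda>i \<omega>. (\<lambda>x. \<lambda>l\<in>{..<n}. x (l, i)) (restrict (\<lambda>z. (case z of (l, i) \<Rightarrow> e l i) \<omega>) ({..<n} \<times> {i}))) {..<p}"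
    by (rule indep_vars_compose2)
  also have "(\<lambda>i \<omega>. (\<lambda>x. \<lambda>l\<in>{..<n}. x (l, i)) (restrict (\<lambda>z. (case z of (l, i) \<Rightarrow> e l i) \<omega>) ({..<n} \<times> {i}))) =
     (\<lambda>i \<omega>. \<lambda>l\<in>{..<n}. e l i \<omega>)"
    by (auto simp: fun_eq_iff restrict_def)
  finally have ind: "indep_vars (\<lambda>_. PiM {..<n} (\<lambda>_. borel)) (\<lambda>i \<omega>. \<lambda>l\<in>{..<n}. e l i \<omega>) {..<p}" .
  then have rv: "(\<lambda>\<omega>. \<lambda>l\<in>{..<n}. e l i \<omega>) \<in> measurable M (PiM {..<n} (\<lambda>_. borel))" if "i < p" for i
    using that by (auto simp: indep_vars_def)
  have m: "arrange n p \<in> measurable M (PiM {..<p} (\<lambda>_. PiM {..<n} (\<lambda>_. borel)))"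
    unfolding arrange_def[abs_def] using rv by (intro measurable_restrict) auto
  then show "arrange n p \<in> measurable M (arr_law n p)"
    using setsa by (simp cong: measurable_cong_sets)
  have "distr M (PiM {..<p} (\<lambda>_. PiM {..<n} (\<lambda>_. borel))) (\<lambda>\<omega>. \<lambda>i\<in>{..<p}. \<lambda>l\<in>{..<n}. e l i \<omega>) =
     PiM {..<p} (\<lambda>i. distr M (PiM {..<n} (\<lambda>_. borel)) (\<lambda>\<omega>. \<lambda>l\<in>{..<n}. e l i \<omega>))"
    using ind p rv by (subst (asm) indep_vars_iff_distr_eq_PiM') auto
  also have "\<dots> = arr_law n p" by (simp only: cold)
  finally have "distr M (PiM {..<p} (\<lambda>_. PiM {..<n} (\<lambda>_. borel))) (arrange n p) = arr_law n p"
    by (simp add: arrange_def[abs_def])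
  moreover have "distr M (arr_law n p) (arrange n p) = distr M (PiM {..<p} (\<lambda>_. PiM {..<n} (\<lambda>_. borel))) (arrange n p)"
    by (rule distr_cong) (simp_all add: setsa)
  ultimately show "distr M (arr_law n p) (arrange n p) = arr_law n p" by simp
qed


text \<open>The exceptional sets live on a different product space for each \<open>n\<close>. Pulled
  back to \<open>M\<close> they have summable probabilities, so Borel-Cantelli applies whatever the
  relation between the designs at different \<open>n\<close>.\<close>

lemma fit_almost_surely:
  fixes p k :: "nat \<Rightarrow> nat" and Q :: "nat \<Rightarrow> nat \<Rightarrow> nat \<Rightarrow> real"
    and u w :: "nat \<Rightarrow> nat \<Rightarrow> nat \<Rightarrow> real" and \<delta> :: "nat \<Rightarrow> nat \<Rightarrow> real"
  assumes p: "filterlim p at_top sequentially"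
    and c0: "0 < c0" "c0 \<le> 1" and dim: "eventually (\<lambda>n. c0 * real n \<le> real n - real (k n) - real (p n)) sequentially"
    and Q: "eventually (\<lambda>n. orth_proj n (Q n) \<and> tr n (Q n) = real n - real (k n)) sequentially"
    and uw: "eventually (\<lambda>n. \<forall>j<k n. (\<forall>a<n. mv n (Q n) (u n j) a = 0) \<and> ip n (u n j) (u n j) = 1 \<and>
      (\<Sum>i<p n. (w n j i)\<^sup>2) = real (p n) * \<delta> n j \<and> 0 \<le> \<delta> n j) sequentially"
    and \<epsilon>: "0 < \<epsilon>"
  shows "AE \<omega> in M. eventually (\<lambda>n. \<forall>j<k n. (\<forall>i<p n. pivot n (Q n) (\<lambda>i l. e l i \<omega>) i \<noteq> 0) \<and>
     \<bar>fit_sq n (Q n) (u n j) (w n j) (\<lambda>i l. e l i \<omega>) (p n)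
       - 1 - (1 + \<delta> n j) * (real (p n) / (real n - real (k n) - real (p n)))\<bar> \<le> \<epsilon> * (1 + \<delta> n j)) sequentially"
proof -
  define C where "C = 5 / c0"
  have C: "1 \<le> C" using c0 by (simp add: C_def)
  \<comment> \<open>The first bound is required by the deterministic estimate. The second makes
    \<open>\<epsilon>1 * (1 + C)\<close> at most half of \<open>\<epsilon> * c0\<close>; the other
    half is left for \<open>C / n\<close>.\<close>
  define \<epsilon>1 where "\<epsilon>1 = min (c0 / 4) (\<epsilon> * c0 / (2 * (1 + C)))"
  have \<epsilon>1: "0 < \<epsilon>1" "\<epsilon>1 \<le> c0 / 4" "\<epsilon>1 * (1 + C) \<le> \<epsilon> * c0 / 2"
  proof -
    show "0 < \<epsilon>1" using c0 \<epsilon> C by (simp add: \<epsilon>1_def)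
    show "\<epsilon>1 \<le> c0 / 4" unfolding \<epsilon>1_def by (rule min.cobounded1)
    have "\<epsilon>1 \<le> \<epsilon> * c0 / (2 * (1 + C))" unfolding \<epsilon>1_def by (rule min.cobounded2)
    from mult_right_mono[OF this, of "1 + C"] C
    have "\<epsilon>1 * (1 + C) \<le> \<epsilon> * c0 / (2 * (1 + C)) * (1 + C)" by simp
    also have "\<dots> = \<epsilon> * c0 / 2" using C by (simp add: divide_simps)
    finally show "\<epsilon>1 * (1 + C) \<le> \<epsilon> * c0 / 2" .
  qed
  define \<epsilon>3 where "\<epsilon>3 = \<epsilon>1 / C"
  have \<epsilon>3: "0 < \<epsilon>3" using \<epsilon>1 C by (simp add: \<epsilon>3_def)
  \<comment> \<open>The three bounds yield \<open>4 * \<epsilon>2 \<le> 1\<close>,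
    \<open>6 * sqrt \<epsilon>2 \<le> \<epsilon>1\<close> and, since
    \<open>3 * sqrt (4 * \<epsilon>2) = 6 * sqrt \<epsilon>2\<close>, the condition with
    \<open>\<epsilon>3 / 8\<close>; hence 48 = 6 * 8.\<close>
  define \<epsilon>2 where "\<epsilon>2 = min (1/4) (min ((\<epsilon>1 / 6)\<^sup>2) ((\<epsilon>3 / 48)\<^sup>2))"
  have \<epsilon>2: "0 < \<epsilon>2" "4 * \<epsilon>2 \<le> 1" using \<epsilon>1 \<epsilon>3 by (auto simp: \<epsilon>2_def)
  have "sqrt \<epsilon>2 \<le> sqrt ((\<epsilon>1 / 6)\<^sup>2)" by (rule real_sqrt_le_mono) (simp add: \<epsilon>2_def)
  then have \<epsilon>26: "6 * sqrt \<epsilon>2 \<le> \<epsilon>1" using \<epsilon>1 by (simp add: real_sqrt_abs)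
  have "sqrt \<epsilon>2 \<le> sqrt ((\<epsilon>3 / 48)\<^sup>2)" by (rule real_sqrt_le_mono) (simp add: \<epsilon>2_def)
  then have b: "3 * sqrt (4 * \<epsilon>2) \<le> \<epsilon>3 / 8" using \<epsilon>3 by (simp add: real_sqrt_mult real_sqrt_abs)
  define l1 where "l1 n = 4 * ln (real n) / (\<epsilon>2 * real n)" for n :: nat
  define l2 where "l2 n = 4 * ln (real n) / (\<epsilon>3 * real n)" for n :: nat
  define tau where "tau n = sqrt (\<epsilon>2 / 8 * real n)" for n :: nat
  define fb where "fb n = L.fail_bound \<epsilon>2 \<epsilon>3 (l1 n) (l2 n) (tau n) n" for n
  have fb: "eventually (\<lambda>n. fb n \<le> 6 * (1 / (real n)\<^sup>2)) sequentially"
    unfolding fb_def l1_def l2_def tau_def by (rule L.eventually_fail_bound_le[OF \<epsilon>2(1) \<epsilon>3 b])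
  have "filterlim (\<lambda>n. c0 * real n / 4) at_top sequentially" using c0 by real_asymp
  then have ev1: "eventually (\<lambda>n. 1 \<le> c0 * real n / 4) sequentially" unfolding filterlim_at_top by blast
  have "filterlim (\<lambda>n. \<epsilon> * c0 * real n / (2 * C)) at_top sequentially" using c0 \<epsilon> C by real_asymp
  then have ev2: "eventually (\<lambda>n. 1 \<le> \<epsilon> * c0 * real n / (2 * C)) sequentially" unfolding filterlim_at_top by blast
  have "filterlim (\<lambda>n. \<epsilon>2 * real n powr (1/5)) at_top sequentially" using \<epsilon>2 by real_asymp
  then have ev3: "eventually (\<lambda>n. 1 \<le> \<epsilon>2 * real n powr (1/5)) sequentially" unfolding filterlim_at_top by blast
  have ev4: "eventually (\<lambda>n. 1 \<le> p n) sequentially" using p unfolding filterlim_at_top by blast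
  define good where "good n \<longleftrightarrow> 1 \<le> c0 * real n / 4 \<and> 1 \<le> \<epsilon> * c0 * real n / (2 * C) \<and> 1 \<le> \<epsilon>2 * real n powr (1/5) \<and>
     1 \<le> p n \<and> fb n \<le> 6 * (1 / (real n)\<^sup>2) \<and> c0 * real n \<le> real n - real (k n) - real (p n) \<and>
     orth_proj n (Q n) \<and> tr n (Q n) = real n - real (k n) \<and>
     (\<forall>j<k n. (\<forall>a<n. mv n (Q n) (u n j) a = 0) \<and> ip n (u n j) (u n j) = 1 \<and>
      (\<Sum>i<p n. (w n j i)\<^sup>2) = real (p n) * \<delta> n j \<and> 0 \<le> \<delta> n j)" for n
  have good: "eventually good sequentially"
    unfolding good_def[abs_def] using ev1 ev2 ev3 ev4 fb dim Q uw by eventually_elim auto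
  define ok where "ok n x \<longleftrightarrow> (\<forall>j<k n. (\<forall>i<p n. pivot n (Q n) x i \<noteq> 0) \<and>
     \<bar>fit_sq n (Q n) (u n j) (w n j) x (p n)
       - 1 - (1 + \<delta> n j) * (real (p n) / (real n - real (k n) - real (p n)))\<bar> \<le> \<epsilon> * (1 + \<delta> n j))" for n x
  have "\<exists>B. B \<in> sets (arr_law n (p n)) \<and> (good n \<longrightarrow> measure (arr_law n (p n)) B \<le> 6 * (1 / (real n)\<^sup>2) \<and>
      (\<forall>x \<in> space (arr_law n (p n)) - B. (\<forall>i<p n. \<forall>l<n. \<bar>x i l\<bar> \<le> tau n) \<longrightarrow> ok n x))" for n
  proof (cases "good n")
    \<comment> \<open>Nothing is claimed for such \<open>n\<close>, but a set has to be chosen for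
      every \<open>n\<close>; \<open>good\<close> holds eventually.\<close>
    case False
    then show ?thesis by (intro exI[of _ "{}"]) auto
  next
    case True
    note g = True[unfolded good_def]
    have n0: "0 < real n" using g c0 by (metis div_0 mult_zero_right not_gr_zero not_one_le_zero of_nat_0 of_nat_0_less_iff)
    then have n1: "1 \<le> n" by simp
    have "0 < c0 * real n" using c0 n0 by simp
    then have pk: "p n \<le> n" "k n \<le> n" using g by linarith+
    have pw: "real n powr (4/5) \<le> \<epsilon>2 * real n"
    proof -
      have "real n powr (4/5) * 1 \<le> real n powr (4/5) * (\<epsilon>2 * real n powr (1/5))"
        using g by (intro mult_left_mono) auto
      also have "\<dots> = \<epsilon>2 * real n" using n0 by (simp add: powr_add[symmetric] mult.left_commute)
      finally show ?thesis by simp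
    qed
    have Qn: "orth_proj n (Q n)" and trQ: "tr n (Q n) = real n - real (k n)" using g by auto
    have w: "\<And>j. j < k n \<Longrightarrow> (\<Sum>i<p n. (w n j i)\<^sup>2) = real (p n) * \<delta> n j"
      and d: "\<And>j. j < k n \<Longrightarrow> 0 \<le> \<delta> n j" and u0: "\<And>j a. j < k n \<Longrightarrow> a < n \<Longrightarrow> mv n (Q n) (u n j) a = 0"
      and u1: "\<And>j. j < k n \<Longrightarrow> ip n (u n j) (u n j) = 1" using g by auto
    have l: "0 \<le> l1 n" "0 \<le> l2 n" "0 \<le> tau n"
      using n1 \<epsilon>2 \<epsilon>3 by (auto simp: l1_def l2_def tau_def intro!: divide_nonneg_pos)
    have "\<exists>B \<in> sets (arr_law n (p n)). measure (arr_law n (p n)) B \<le> L.fail_bound \<epsilon>2 (\<epsilon>1 / C) (l1 n) (l2 n) (tau n) n \<and>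
      (\<forall>x \<in> space (arr_law n (p n)) - B. (\<forall>i<p n. \<forall>l<n. \<bar>x i l\<bar> \<le> tau n) \<longrightarrow>
        (\<forall>i<p n. \<bar>pivot n (Q n) x i - tr n (res n (Q n) x i)\<bar> \<le> \<epsilon>1 * real n) \<and>
        (\<forall>j<k n. \<bar>\<Sum>i<p n. if fit_sq n (Q n) (u n j) (w n j) x i \<le> C * (1 + \<delta> n j)
          then drift n (Q n) (u n j) (w n j) x i else 0\<bar> \<le> \<epsilon>1 * real n * (1 + \<delta> n j)))"
      by (rule L.bad_event) (use Qn n1 pk w d C \<epsilon>1 \<epsilon>2 \<epsilon>26 pw l in auto)
    then obtain B where B: "B \<in> sets (arr_law n (p n))"
      "measure (arr_law n (p n)) B \<le> L.fail_bound \<epsilon>2 (\<epsilon>1 / C) (l1 n) (l2 n) (tau n) n"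
      and Bx: "\<forall>x \<in> space (arr_law n (p n)) - B. (\<forall>i<p n. \<forall>l<n. \<bar>x i l\<bar> \<le> tau n) \<longrightarrow>
        (\<forall>i<p n. \<bar>pivot n (Q n) x i - tr n (res n (Q n) x i)\<bar> \<le> \<epsilon>1 * real n) \<and>
        (\<forall>j<k n. \<bar>\<Sum>i<p n. if fit_sq n (Q n) (u n j) (w n j) x i \<le> C * (1 + \<delta> n j)
          then drift n (Q n) (u n j) (w n j) x i else 0\<bar> \<le> \<epsilon>1 * real n * (1 + \<delta> n j))"
      by blast
    have "ok n x" if x: "x \<in> space (arr_law n (p n)) - B" and small: "\<forall>i<p n. \<forall>l<n. \<bar>x i l\<bar> \<le> tau n" for x
      unfolding ok_def
    proof (intro allI impI)
      fix j assume j: "j < k n"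
      have tr1: "c0 * real n \<le> tr n (Q n) - real (p n)" "tr n (Q n) \<le> real n" "1 \<le> c0 * real n / 4"
        using g by auto
      from Bx x small j have A: "\<And>i. i < p n \<Longrightarrow> \<bar>pivot n (Q n) x i - tr n (res n (Q n) x i)\<bar> \<le> \<epsilon>1 * real n"
        and S: "\<bar>\<Sum>i<p n. if fit_sq n (Q n) (u n j) (w n j) x i \<le> C * (1 + \<delta> n j)
          then drift n (Q n) (u n j) (w n j) x i else 0\<bar> \<le> \<epsilon>1 * real n * (1 + \<delta> n j)"
        by blast+
      note est = fit_estimate[where u = "u n j" and w = "w n j" and \<delta> = "\<delta> n j",
          OF Qn u0[OF j] u1[OF j] w[OF j] d[OF j] c0 tr1 less_imp_le[OF \<epsilon>1(1)] \<epsilon>1(2) C_def A S, unfolded trQ]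
      have "(\<epsilon>1 + (\<epsilon>1 + 1 / real n) * C) / c0 \<le> \<epsilon>"
      proof -
        have "C / real n \<le> \<epsilon> * c0 / 2" using g n0 C by (simp add: field_simps)
        then have "\<epsilon>1 + (\<epsilon>1 + 1 / real n) * C \<le> \<epsilon> * c0"
        proof -
          have "\<epsilon>1 + (\<epsilon>1 + 1 / real n) * C = \<epsilon>1 * (1 + C) + C / real n" by (simp add: algebra_simps)
          with \<epsilon>1(3) \<open>C / real n \<le> \<epsilon> * c0 / 2\<close> show ?thesis by linarith
        qed
        then show ?thesis using c0 by (simp add: pos_divide_le_eq)
      qed
      then have "(\<epsilon>1 + (\<epsilon>1 + 1 / real n) * C) / c0 * (1 + \<delta> n j) \<le> \<epsilon> * (1 + \<delta> n j)"
        using d[OF j] by (intro mult_right_mono) auto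
      then show "(\<forall>i<p n. pivot n (Q n) x i \<noteq> 0) \<and>
     \<bar>fit_sq n (Q n) (u n j) (w n j) x (p n)
       - 1 - (1 + \<delta> n j) * (real (p n) / (real n - real (k n) - real (p n)))\<bar> \<le> \<epsilon> * (1 + \<delta> n j)"
        by (intro conjI allI impI est(1) order_trans[OF est(2)])
    qed
    moreover have "measure (arr_law n (p n)) B \<le> 6 * (1 / (real n)\<^sup>2)"
      using B(2) g by (simp add: fb_def \<epsilon>3_def)
    ultimately show ?thesis using B(1) by blast
  qed
  then obtain B where B: "\<And>n. B n \<in> sets (arr_law n (p n))"
    "\<And>n. good n \<Longrightarrow> measure (arr_law n (p n)) (B n) \<le> 6 * (1 / (real n)\<^sup>2)"
    "\<And>n x. good n \<Longrightarrow> x \<in> space (arr_law n (p n)) - B n \<Longrightarrow> (\<forall>i<p n. \<forall>l<n. \<bar>x i l\<bar> \<le> tau n) \<Longrightarrow> ok n x"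
    by metis
  define S where "S n = (if good n then arrange n (p n) -` B n \<inter> space M else {})" for n
  have npos: "0 < n" "0 < p n" if "good n" for n
    using that c0 unfolding good_def by (auto intro!: Nat.gr0I)
  have Sm: "S n \<in> sets M" for n
    using distr_arrange(1)[OF npos] B(1)[of n] by (auto simp: S_def intro: measurable_sets)
  have Sb: "measure M (S n) \<le> 6 * (1 / (real n)\<^sup>2)" for n
  proof (cases "good n")
    case True
    have "measure M (S n) = measure (distr M (arr_law n (p n)) (arrange n (p n))) (B n)"
      using True by (simp add: S_def measure_distr[OF distr_arrange(1)[OF npos[OF True]] B(1)])
    then show ?thesis using B(2)[OF True] distr_arrange(2)[OF npos[OF True]] by simp
  qed (simp add: S_def)
  have "summable (\<lambda>n. measure M (S n))"
  proof (rule summable_comparison_test')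
    show "summable (\<lambda>n. 6 * (1 / (real n)\<^sup>2))"
      using inverse_power_summable[of 2, where ?'a = real] by (intro summable_mult) (simp add: inverse_eq_divide)
    show "norm (measure M (S n)) \<le> 6 * (1 / (real n)\<^sup>2)" for n using Sb[of n] by simp
  qed
  then have "AE \<omega> in M. eventually (\<lambda>n. \<omega> \<in> space M - S n) sequentially"
    using Sm by (intro borel_cantelli_AE1) (auto simp: emeasure_eq_measure)
  moreover have "AE \<omega> in M. eventually (\<lambda>n. \<forall>i<n. \<forall>l<n. \<bar>e l i \<omega>\<bar> \<le> sqrt (\<epsilon>2 / 8) * sqrt (real n)) sequentially"
    by (rule entries_small) (use \<epsilon>2 in simp)
  ultimately have "AE \<omega> in M. eventually (\<lambda>n. ok n (\<lambda>i l. e l i \<omega>)) sequentially"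
  proof eventually_elim
    case (elim \<omega>)
    from elim(1,2) good show ?case
    proof eventually_elim
      case (elim n)
      have n0: "0 < n" "0 < p n" using npos[OF elim(3)] by auto
      have pn: "p n \<le> n"
      proof -
        have "0 < c0 * real n" using c0 n0 by simp
        then show ?thesis using elim(3) unfolding good_def by linarith
      qed
      define x where "x = arrange n (p n) \<omega>"
      have "x \<in> space (arr_law n (p n))"
        unfolding x_def using measurable_space[OF distr_arrange(1)[OF n0]] elim(1) by auto
      moreover have "x \<notin> B n" using elim(1,3) by (auto simp: S_def x_def)
      moreover have xe: "x i l = e l i \<omega>" if "i < p n" "l < n" for i l
        using that by (simp add: x_def arrange_def)
      moreover have "\<forall>i<p n. \<forall>l<n. \<bar>x i l\<bar> \<le> tau n"
        using elim(2) pn xe by (auto simp: tau_def real_sqrt_mult[symmetric])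
      ultimately have "ok n x" using B(3)[OF elim(3)] by blast
      moreover have "fit n (Q n) (u n j) (w n j) x (p n) = fit n (Q n) (u n j) (w n j) (\<lambda>i l. e l i \<omega>) (p n)" for j
        by (rule fit_cong) (use xe in auto)
      moreover have "pivot n (Q n) x i = pivot n (Q n) (\<lambda>i l. e l i \<omega>) i" if "i < p n" for i
        by (rule pivot_cong) (use xe that in auto)
      ultimately show ?case unfolding ok_def by simp
    qed
  qed
  then show ?thesis unfolding ok_def .
qed

end

section \<open>Knocking out one regressor\<close>

lemma mv_sum: "mv n R (\<lambda>l. \<Sum>m\<in>I. t m * x m l) a = (\<Sum>m\<in>I. t m * mv n R (x m) a)"
  unfolding mv_def by (rule ip_sum_right)

lemma mat_inv_det:
  fixes A :: "real mat"
  assumes A: "A \<in> carrier_mat m m" and "det A \<noteq> 0"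
  shows "mat_inv A \<in> carrier_mat m m" "A * mat_inv A = 1\<^sub>m m" "mat_inv A * A = 1\<^sub>m m"
proof -
  have "A \<in> Units (ring_mat TYPE(real) m ())" by (rule det_non_zero_imp_unit[OF assms])
  then have "mat_inverse A \<noteq> None" using mat_inverse(1)[OF A, of "()"] by auto
  then obtain B where B: "mat_inverse A = Some B" by auto
  from mat_inverse(2)[OF A B] B
  show "mat_inv A \<in> carrier_mat m m" "A * mat_inv A = 1\<^sub>m m" "mat_inv A * A = 1\<^sub>m m"
    by (auto simp: mat_inv_def)
qed

lemma index_mult_sum:
  "A \<in> carrier_mat r m \<Longrightarrow> B \<in> carrier_mat m q \<Longrightarrow> a < r \<Longrightarrow> b < q \<Longrightarrow>
    (A * B) $$ (a, b) = (\<Sum>l<m. A $$ (a, l) * B $$ (l, b))"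
  by (simp add: scalar_prod_def lessThan_atLeast0)

lemma det_solvable:
  fixes A :: "real mat"
  assumes A: "A \<in> carrier_mat m m" and "det A \<noteq> 0"
  shows "\<exists>c. \<forall>a<m. (\<Sum>b<m. A $$ (a, b) * c b) = z a"
proof -
  note G = mat_inv_det[OF assms]
  have "(\<Sum>b<m. A $$ (a, b) * (\<Sum>d<m. mat_inv A $$ (b, d) * z d)) = z a" if a: "a < m" for a
  proof -
    have "(\<Sum>b<m. A $$ (a, b) * (\<Sum>d<m. mat_inv A $$ (b, d) * z d)) =
       (\<Sum>d<m. (\<Sum>b<m. A $$ (a, b) * mat_inv A $$ (b, d)) * z d)"
      unfolding sum_distrib_left sum_distrib_right
      by (subst sum.swap) (simp add: mult.assoc)
    also have "\<dots> = (\<Sum>d<m. (if a = d then 1 else 0) * z d)"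
      using index_mult_sum[OF A G(1) a] G(2) a by (intro sum.cong refl) simp
    also have "\<dots> = (\<Sum>d<m. if a = d then z d else 0)"
      by (intro sum.cong refl) simp
    also have "\<dots> = z a" using a by simp
    finally show ?thesis .
  qed
  then show ?thesis by (intro exI[of _ "\<lambda>b. \<Sum>d<m. mat_inv A $$ (b, d) * z d"]) auto
qed

text \<open>Together with the converse above, this exchanges nonsingularity for solvability of
  linear systems, which is what the recursion delivers.\<close>

lemma solvable_det:
  fixes A :: "real mat"
  assumes A: "A \<in> carrier_mat m m" and sol: "\<And>z. \<exists>c. \<forall>a<m. (\<Sum>b<m. A $$ (a, b) * c b) = z a"
  shows "det A \<noteq> 0"
proof -
  have "\<forall>d. \<exists>c. \<forall>a<m. (\<Sum>b<m. A $$ (a, b) * c b) = (if a = d then 1 else 0)"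
    by (intro allI) (rule sol)
  then obtain c where c: "\<And>d a. a < m \<Longrightarrow> (\<Sum>b<m. A $$ (a, b) * c d b) = (if a = d then 1 else 0)"
    by metis
  define B where "B = mat m m (\<lambda>(b, d). c d b)"
  have B: "B \<in> carrier_mat m m" by (simp add: B_def)
  have "A * B = 1\<^sub>m m"
  proof (rule eq_matI)
    fix a d assume "a < dim_row (1\<^sub>m m :: real mat)" "d < dim_col (1\<^sub>m m :: real mat)"
    then have ad: "a < m" "d < m" by auto
    have "(A * B) $$ (a, d) = (\<Sum>b<m. A $$ (a, b) * c d b)"
      unfolding index_mult_sum[OF A B ad] using ad by (intro sum.cong refl) (simp add: B_def)
    then show "(A * B) $$ (a, d) = 1\<^sub>m m $$ (a, d)" using c[OF ad(1)] ad by simp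
  qed (use A B in auto)
  then have "det A * det B = 1" using det_mult[OF A B] by simp
  then show ?thesis by auto
qed

lemma scalar_prod_self_eq_0D:
  fixes v :: "real vec"
  assumes v: "v \<in> carrier_vec n" and "v \<bullet> v = 0"
  shows "v = 0\<^sub>v n"
proof (rule eq_vecI)
  fix i assume i: "i < dim_vec (0\<^sub>v n :: real vec)"
  have "(\<Sum>i<n. v $ i * v $ i) = 0" using assms by (simp add: scalar_prod_def lessThan_atLeast0)
  then show "v $ i = 0\<^sub>v n $ i" using i by (simp add: sum_nonneg_eq_0_iff)
qed (use v in simp)

lemma pos_def_independent:
  assumes X: "X \<in> carrier_mat n k" and pd: "pos_def k (transpose_mat X * X)"
    and c: "\<And>a. a < n \<Longrightarrow> (\<Sum>i<k. c i * X $$ (a, i)) = 0" and i: "i < k"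
  shows "c i = 0"
proof -
  define v where "v = vec k c"
  have v: "v \<in> carrier_vec k" by (simp add: v_def)
  have "X *\<^sub>v v = 0\<^sub>v n"
    using X c by (intro eq_vecI) (auto simp: v_def scalar_prod_def lessThan_atLeast0 mult.commute)
  then have "transpose_mat X * X *\<^sub>v v = 0\<^sub>v k"
    using X v by (simp add: assoc_mult_mat_vec[of _ k n _ k]) (intro eq_vecI, auto)
  then have "v \<bullet> (transpose_mat X * X *\<^sub>v v) = 0" using v by simp
  then have "v = 0\<^sub>v k" using pd v unfolding pos_def_def by force
  then have "v $ i = 0" using i by simp
  then show ?thesis using i by (simp add: v_def)
qed

definition resid_fun :: "real mat \<Rightarrow> nat set \<Rightarrow> nat \<Rightarrow> nat \<Rightarrow> real" where
  "resid_fun X J a b = resid_mat X J $$ (a, b)"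

text \<open>The columns of a submatrix are numbered by \<open>pick\<close>; the bijection turns sums
  over these numbers into sums over \<open>J\<close>.\<close>

lemma bij_betw_pick: "finite J \<Longrightarrow> bij_betw (pick J) {..<card J} J"
proof -
  assume J: "finite J"
  have inj: "inj_on (pick J) {..<card J}"
  proof (rule inj_onI)
    fix c d assume cd: "c \<in> {..<card J}" "d \<in> {..<card J}" "pick J c = pick J d"
    have "card {a \<in> J. a < pick J c} = c" "card {a \<in> J. a < pick J d} = d"
      by (rule card_pick_le, use cd(1,2) in simp)+
    then show "c = d" unfolding cd(3) by (rule subst)
  qed
  have "pick J ` {..<card J} \<subseteq> J" by (rule image_subsetI) (rule pick_in_set_le, simp)
  then have "pick J ` {..<card J} = J"
    using J card_image[OF inj] by (intro card_subset_eq) auto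
  then show ?thesis using inj by (simp add: bij_betw_def)
qed

text \<open>The projection is handled only through these properties from here on. The Gram matrix
  \<open>W\<close> is nonsingular because a vector in its kernel gives a vanishing combination of
  the columns in \<open>J\<close>, and extended by zeros this contradicts the independence of all
  columns of \<open>X\<close>.\<close>

lemma resid_props:
  assumes X: "X \<in> carrier_mat n k" and pd: "pos_def k (transpose_mat X * X)" and J: "J \<subseteq> {..<k}"
  shows "resid_mat X J \<in> carrier_mat n n" "orth_proj n (resid_fun X J)"
    "\<And>i a. i \<in> J \<Longrightarrow> a < n \<Longrightarrow> mv n (resid_fun X J) (\<lambda>a. X $$ (a, i)) a = 0"
    "\<And>v. \<exists>c. \<forall>a<n. v a - mv n (resid_fun X J) v a = (\<Sum>i\<in>J. c i * X $$ (a, i))"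
    "tr n (resid_fun X J) = real n - real (card J)"
proof -
  have fin: "finite J" using J finite_subset by auto
  define m where "m = card J"
  define XJ where "XJ = col_submat X J"
  have Jset: "{c. c < k \<and> c \<in> J} = J" using J by auto
  have XJ: "XJ \<in> carrier_mat n m"
    unfolding XJ_def col_submat_def m_def carrier_mat_def using X Jset by (simp add: dim_submatrix)
  have XJi: "XJ $$ (a, c) = X $$ (a, pick J c)" if "a < n" "c < m" for a c
    using X that Jset unfolding XJ_def col_submat_def m_def
    by (subst submatrix_index) (simp_all add: pick_UNIV)
  note bij = bij_betw_pick[OF fin, folded m_def]
  define idx where "idx i = card {a \<in> J. a < i}" for i
  have idx: "idx (pick J c) = c" if "c < m" for c
    using card_pick_le that by (simp add: idx_def m_def)
  have sumJ: "(\<Sum>c<m. g c * X $$ (a, pick J c)) = (\<Sum>i\<in>J. g (idx i) * X $$ (a, i))" for g a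
  proof -
    have "(\<Sum>i\<in>J. g (idx i) * X $$ (a, i)) = (\<Sum>c<m. g (idx (pick J c)) * X $$ (a, pick J c))"
      by (rule sum.reindex_bij_betw[OF bij, symmetric])
    then show ?thesis by (simp add: idx)
  qed
  define W where "W = transpose_mat XJ * XJ"
  have W: "W \<in> carrier_mat m m" using XJ by (simp add: W_def)
  have "det W \<noteq> 0"
  proof
    assume "det W = 0"
    then obtain v where v: "v \<in> carrier_vec m" "v \<noteq> 0\<^sub>v m" "W *\<^sub>v v = 0\<^sub>v m"
      using det_0_iff_vec_prod_zero_field[OF W] by blast
    have Xv: "XJ *\<^sub>v v \<in> carrier_vec n" using XJ v by simp
    have "(XJ *\<^sub>v v) \<bullet> (XJ *\<^sub>v v) = v \<bullet> (W *\<^sub>v v)"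
      using XJ v(1) Xv transpose_vec_mult_scalar[OF XJ v(1) Xv]
      by (simp add: W_def assoc_mult_mat_vec[of _ m n _ m] comm_scalar_prod[of v m])
    also have "\<dots> = 0" using v by simp
    finally have "XJ *\<^sub>v v = 0\<^sub>v n" by (rule scalar_prod_self_eq_0D[OF Xv])
    then have "(\<Sum>c<m. v $ c * X $$ (a, pick J c)) = 0" if "a < n" for a
    proof -
      have "(XJ *\<^sub>v v) $ a = (\<Sum>c<m. XJ $$ (a, c) * v $ c)"
        using XJ v(1) that by (simp add: scalar_prod_def lessThan_atLeast0)
      also have "\<dots> = (\<Sum>c<m. v $ c * X $$ (a, pick J c))"
        using XJi that by (intro sum.cong refl) simp
      finally show ?thesis using \<open>XJ *\<^sub>v v = 0\<^sub>v n\<close> that by simp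
    qed
    then have z: "(\<Sum>i\<in>J. v $ idx i * X $$ (a, i)) = 0" if "a < n" for a
      using that sumJ[of "\<lambda>c. v $ c" a] by simp
    have "(\<Sum>i<k. (if i \<in> J then v $ idx i else 0) * X $$ (a, i)) = 0" if "a < n" for a
    proof -
      have "(\<Sum>i<k. (if i \<in> J then v $ idx i else 0) * X $$ (a, i)) =
         (\<Sum>i\<in>J. (if i \<in> J then v $ idx i else 0) * X $$ (a, i))"
        using J by (intro sum.mono_neutral_right) auto
      then show ?thesis using z[OF that] by simp
    qed
    from pos_def_independent[OF X pd this]
    have "(if i \<in> J then v $ idx i else 0) = 0" if "i < k" for i using that by blast
    then have "v $ idx i = 0" if "i \<in> J" for i using that J by (metis lessThan_iff subsetD)
    then have "v $ c = 0" if "c < m" for c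
      using idx[OF that] bij that by (metis bij_betwE lessThan_iff)
    then have "v = 0\<^sub>v m" using v(1) by (intro eq_vecI) auto
    then show False using v by simp
  qed
  note G = mat_inv_det[OF W this]
  define G where "G = mat_inv W"
  have Gc: "G \<in> carrier_mat m m" and WG: "W * G = 1\<^sub>m m" and GW: "G * W = 1\<^sub>m m"
    using G by (simp_all add: G_def)
  have Wt: "transpose_mat W = W" using XJ by (simp add: W_def transpose_mult[of _ m n _ m])
  have Gt: "transpose_mat G = G"
  proof -
    have "transpose_mat G * W = 1\<^sub>m m"
      using transpose_mult[OF W Gc] WG Wt by simp
    then have "transpose_mat G * W * G = G" using Gc by simp
    moreover have "transpose_mat G * W * G = transpose_mat G * (W * G)"
      using Gc W by (intro assoc_mult_mat) auto
    ultimately show ?thesis using WG Gc by simp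
  qed
  define N where "N = G * transpose_mat XJ"
  have N: "N \<in> carrier_mat m n" using Gc XJ by (simp add: N_def)
  define P where "P = XJ * N"
  have P: "P \<in> carrier_mat n n" using XJ N by (simp add: P_def)
  have Pd: "proj_mat X J = P"
    using XJ Gc by (simp add: proj_mat_def Let_def P_def N_def XJ_def[symmetric] W_def[symmetric] G_def[symmetric]
      assoc_mult_mat[of _ n m _ m _ n])
  have Rm: "resid_mat X J = 1\<^sub>m n - P" using X by (simp add: resid_mat_def Pd)
  then show "resid_mat X J \<in> carrier_mat n n" using P by (simp add: minus_carrier_mat)
  have R: "resid_fun X J a b = (if a = b then 1 else 0) - P $$ (a, b)" if "a < n" "b < n" for a b
    using that P by (simp add: resid_fun_def Rm)
  have Pt: "transpose_mat P = P"
  proof -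
    have "transpose_mat P = transpose_mat N * transpose_mat XJ" using XJ N by (simp add: P_def transpose_mult)
    also have "transpose_mat N = XJ * G" using XJ Gc Gt by (simp add: N_def transpose_mult[of _ m m _ n])
    also have "XJ * G * transpose_mat XJ = P" unfolding P_def N_def using XJ Gc by (intro assoc_mult_mat) auto
    finally show ?thesis .
  qed
  have Psym: "P $$ (a, b) = P $$ (b, a)" if "a < n" "b < n" for a b
    using that P Pt by (metis carrier_matD index_transpose_mat(1))
  have NX: "N * XJ = 1\<^sub>m m"
  proof -
    have "N * XJ = G * (transpose_mat XJ * XJ)" unfolding N_def using XJ Gc by (intro assoc_mult_mat) auto
    then show ?thesis using GW by (simp add: W_def)
  qed
  have PX: "P * XJ = XJ"
  proof -
    have "P * XJ = XJ * (N * XJ)" unfolding P_def using XJ N by (intro assoc_mult_mat) auto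
    then show ?thesis using NX XJ by simp
  qed
  have PP: "P * P = P"
  proof -
    have "P * P = P * XJ * N" using XJ N P by (subst (2) P_def) (simp add: assoc_mult_mat[of _ n n _ m _ n])
    then show ?thesis using PX by (simp add: P_def)
  qed
  show "orth_proj n (resid_fun X J)"
    unfolding orth_proj_def
  proof (intro conjI allI impI)
    fix a b assume ab: "a < n" "b < n"
    show "resid_fun X J a b = resid_fun X J b a" using Psym ab by (simp add: R)
    have "(\<Sum>l<n. resid_fun X J a l * resid_fun X J l b) =
      (\<Sum>l<n. (if a = l then (if l = b then 1 else 0) - P $$ (l, b) else 0) - (if l = b then P $$ (a, l) else 0) + P $$ (a, l) * P $$ (l, b))"
      using ab by (intro sum.cong refl) (simp add: R algebra_simps)
    also have "\<dots> = (if a = b then 1 else 0) - P $$ (a, b) - P $$ (a, b) + (P * P) $$ (a, b)"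
      using ab by (simp add: sum.distrib sum_subtractf index_mult_sum[OF P P])
    finally show "(\<Sum>l<n. resid_fun X J a l * resid_fun X J l b) = resid_fun X J a b"
      using ab by (simp add: PP R)
  qed
  have mvR: "mv n (resid_fun X J) v a = v a - (\<Sum>l<n. P $$ (a, l) * v l)" if "a < n" for a v
  proof -
    have "mv n (resid_fun X J) v a = (\<Sum>l<n. (if a = l then v l else 0) - P $$ (a, l) * v l)"
      unfolding mv_def ip_def using that by (intro sum.cong refl) (simp add: R algebra_simps)
    then show ?thesis using that by (simp add: sum_subtractf)
  qed
  show "mv n (resid_fun X J) (\<lambda>a. X $$ (a, i)) a = 0" if i: "i \<in> J" and a: "a < n" for i a
  proof -
    obtain c where c: "c < m" "pick J c = i" using bij i unfolding bij_betw_def by (metis imageE lessThan_iff)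
    have "(\<Sum>l<n. P $$ (a, l) * X $$ (l, i)) = (P * XJ) $$ (a, c)"
      unfolding index_mult_sum[OF P XJ a c(1)] using XJi c by (intro sum.cong refl) simp
    then show ?thesis using a c XJi by (simp add: mvR PX)
  qed
  show "\<exists>c. \<forall>a<n. v a - mv n (resid_fun X J) v a = (\<Sum>i\<in>J. c i * X $$ (a, i))" for v
  proof -
    define d where "d c = (\<Sum>l<n. N $$ (c, l) * v l)" for c
    have "v a - mv n (resid_fun X J) v a = (\<Sum>i\<in>J. d (idx i) * X $$ (a, i))" if a: "a < n" for a
    proof -
      have "v a - mv n (resid_fun X J) v a = (\<Sum>l<n. (\<Sum>c<m. XJ $$ (a, c) * N $$ (c, l)) * v l)"
        using a index_mult_sum[OF XJ N a] by (simp add: mvR P_def)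
      also have "\<dots> = (\<Sum>c<m. d c * XJ $$ (a, c))"
        unfolding d_def sum_distrib_left sum_distrib_right by (subst sum.swap) (simp add: mult_ac)
      also have "\<dots> = (\<Sum>c<m. d c * X $$ (a, pick J c))"
        using XJi[OF a] by (intro sum.cong refl) (simp only: lessThan_iff)
      finally show ?thesis by (simp add: sumJ)
    qed
    then show ?thesis by (intro exI[of _ "\<lambda>i. d (idx i)"] allI impI)
  qed
  have "(\<Sum>a<n. P $$ (a, a)) = (\<Sum>a<n. \<Sum>c<m. XJ $$ (a, c) * N $$ (c, a))"
    using index_mult_sum[OF XJ N] by (simp add: P_def)
  also have "\<dots> = (\<Sum>c<m. \<Sum>a<n. N $$ (c, a) * XJ $$ (a, c))"
    by (subst sum.swap) (simp add: mult.commute)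
  also have "\<dots> = (\<Sum>c<m. (N * XJ) $$ (c, c))"
    using index_mult_sum[OF N XJ] by simp
  also have "\<dots> = real m" by (simp add: NX)
  finally show "tr n (resid_fun X J) = real n - real (card J)"
    by (simp add: tr_def R sum_subtractf m_def)
qed

text \<open>The part of \<open>x_j\<close> orthogonal to the other regressors. Its squared length is
  the factor \<open>x_j' Q_j x_j\<close> of the noncentrality, and normalised it is the direction
  \<open>u\<close> by which the two residual projections differ.\<close>

definition ko_dir :: "real mat \<Rightarrow> nat \<Rightarrow> nat \<Rightarrow> real" where
  "ko_dir X j = mv (dim_row X) (resid_fun X ({..<dim_col X} - {j})) (\<lambda>a. X $$ (a, j))"

definition ko_len :: "real mat \<Rightarrow> nat \<Rightarrow> real" where
  "ko_len X j = sqrt (ip (dim_row X) (ko_dir X j) (ko_dir X j))"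

definition ko_unit :: "real mat \<Rightarrow> nat \<Rightarrow> nat \<Rightarrow> real" where
  "ko_unit X j a = (1 / ko_len X j) * ko_dir X j a"

text \<open>For the last claim, let \<open>D\<close> be the difference of the two sides as a
  function of \<open>a\<close>. It lies in the span of the regressors, since each residual differs
  from \<open>v\<close> by an element of this span and \<open>u\<close> belongs to it; it is also
  orthogonal to every regressor. Hence \<open>D\<close> is orthogonal to itself.\<close>

lemma ko_props:
  assumes X: "X \<in> carrier_mat n k" and pd: "pos_def k (transpose_mat X * X)" and j: "j < k"
  shows "ip n (\<lambda>a. X $$ (a, j)) (mv n (resid_fun X ({..<k} - {j})) (\<lambda>a. X $$ (a, j))) = (ko_len X j)\<^sup>2"
    "ip n (ko_unit X j) (ko_unit X j) = 1"
    "\<And>a. a < n \<Longrightarrow> mv n (resid_fun X {..<k}) (ko_unit X j) a = 0"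
    "\<And>i. i < k \<Longrightarrow> ip n (ko_unit X j) (\<lambda>a. X $$ (a, i)) = (if i = j then ko_len X j else 0)"
    "\<And>v a. a < n \<Longrightarrow> mv n (resid_fun X ({..<k} - {j})) v a =
        mv n (resid_fun X {..<k}) v a + ip n (ko_unit X j) v * ko_unit X j a"
proof -
  define R where "R = resid_fun X {..<k}"
  define Rj where "Rj = resid_fun X ({..<k} - {j})"
  define x where "x i = (\<lambda>a. X $$ (a, i))" for i
  note pR = resid_props[OF X pd, of "{..<k}", folded R_def x_def]
  note pRj = resid_props[OF X pd, of "{..<k} - {j}", folded Rj_def x_def]
  have R: "orth_proj n R" and Rj: "orth_proj n Rj" using pR pRj by auto
  have Rx: "mv n R (x i) a = 0" if "i < k" "a < n" for i a using pR(3) that by simp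
  have Rjx: "mv n Rj (x i) a = 0" if "i < k" "i \<noteq> j" "a < n" for i a using pRj(3) that by simp
  define z where "z = mv n Rj (x j)"
  define s where "s = sqrt (ip n z z)"
  define u where "u a = (1 / s) * z a" for a
  have zd: "ko_dir X j = z" using X by (simp add: ko_dir_def z_def Rj_def x_def)
  have sd: "ko_len X j = s" using X by (simp add: ko_len_def s_def zd)
  have ud: "ko_unit X j = u" by (rule ext) (simp add: ko_unit_def u_def sd zd)
  obtain d where d: "\<forall>a<n. x j a - z a = (\<Sum>i\<in>{..<k} - {j}. d i * X $$ (a, i))"
    using pRj(4)[of "x j"] by (auto simp: z_def)
  have xz: "ip n (x j) z = ip n z z" unfolding z_def by (rule ip_mv_self[OF Rj])
  have zz: "0 < ip n z z"
  proof (rule ccontr)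
    assume "\<not> 0 < ip n z z"
    then have "ip n z z = 0" using ip_self_nonneg[of n z] by simp
    then have z0: "z a = 0" if "a < n" for a using that by (rule ip_self_eq_0D)
    \<comment> \<open>If the residual of \<open>x_j\<close> vanished, \<open>x_j\<close> would be a
      combination of the other regressors, giving a relation whose \<open>j\<close>-th coefficient
      is 1.\<close>
    have "(\<Sum>i<k. (if i = j then 1 else - d i) * X $$ (a, i)) = 0" if a: "a < n" for a
    proof -
      have "(\<Sum>i<k. (if i = j then 1 else - d i) * X $$ (a, i)) =
        X $$ (a, j) + (\<Sum>i\<in>{..<k} - {j}. (if i = j then 1 else - d i) * X $$ (a, i))"
        using j by (subst sum.remove[of _ j]) auto
      also have "(\<Sum>i\<in>{..<k} - {j}. (if i = j then 1 else - d i) * X $$ (a, i)) = - (\<Sum>i\<in>{..<k} - {j}. d i * X $$ (a, i))"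
        unfolding sum_negf[symmetric] by (intro sum.cong refl) auto
      finally show ?thesis using d a z0[OF a] by (auto simp: x_def)
    qed
    from pos_def_independent[OF X pd this j] show False by simp
  qed
  have s: "0 < s" "s\<^sup>2 = ip n z z" using zz by (simp_all add: s_def)
  have zx: "ip n z (x i) = (if i = j then s\<^sup>2 else 0)" if "i < k" for i
  proof (cases "i = j")
    case True
    then show ?thesis using xz s by (simp add: ip_commute)
  next
    case False
    have "ip n z (x i) = ip n (x j) (mv n Rj (x i))" unfolding z_def by (rule ip_mv_sym[OF Rj])
    also have "\<dots> = 0" by (rule ip_zero_right) (use Rjx that False in auto)
    finally show ?thesis using False by simp
  qed
  have ipu: "ip n u v = ip n z v / s" for v
    unfolding u_def[abs_def] ip_scale_left by simp
  have ux: "ip n u (x i) = (if i = j then s else 0)" if "i < k" for i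
    unfolding ipu zx[OF that] using s(1) by (simp add: power2_eq_square)
  show "ip n (\<lambda>a. X $$ (a, j)) (mv n (resid_fun X ({..<k} - {j})) (\<lambda>a. X $$ (a, j))) = (ko_len X j)\<^sup>2"
    using xz s by (simp add: sd z_def x_def Rj_def)
  have "ip n u u = ip n z z / s / s" unfolding ipu unfolding u_def[abs_def] ip_scale_right by simp
  then show "ip n (ko_unit X j) (ko_unit X j) = 1" using s zz by (simp add: ud power2_eq_square[symmetric] divide_divide_eq_left)
  show "mv n (resid_fun X {..<k}) (ko_unit X j) a = 0" if a: "a < n" for a
  proof -
    have "mv n R z a = mv n R (\<lambda>b. x j b - (\<Sum>i\<in>{..<k} - {j}. d i * x i b)) a"
      by (rule mv_cong) (use d in \<open>auto simp: x_def\<close>)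
    also have "\<dots> = 0" using Rx a j by (simp add: mv_diff mv_sum)
    finally show ?thesis unfolding ud u_def[abs_def] mv_scale R_def[symmetric] by simp
  qed
  show "ip n (ko_unit X j) (\<lambda>a. X $$ (a, i)) = (if i = j then ko_len X j else 0)" if "i < k" for i
    using ux[OF that] by (simp add: ud sd x_def)
  show "mv n (resid_fun X ({..<k} - {j})) v a =
        mv n (resid_fun X {..<k}) v a + ip n (ko_unit X j) v * ko_unit X j a" if a: "a < n" for v a
  proof -
    define D where "D a = mv n Rj v a - mv n R v a - ip n u v * u a" for a
    obtain c where c: "\<forall>a<n. v a - mv n R v a = (\<Sum>i<k. c i * X $$ (a, i))" using pR(4)[of v] by auto
    obtain c' where c': "\<forall>a<n. v a - mv n Rj v a = (\<Sum>i\<in>{..<k} - {j}. c' i * X $$ (a, i))" using pRj(4)[of v] by auto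
    define t where "t = ip n u v / s"
    define h where "h i = c i - (if i = j then t else c' i - t * d i)" for i
    have Dspan: "D a = (\<Sum>i<k. h i * x i a)" if a: "a < n" for a
    proof -
      have "(\<Sum>i<k. (if i = j then t else c' i - t * d i) * x i a) =
         t * x j a + (\<Sum>i\<in>{..<k} - {j}. (if i = j then t else c' i - t * d i) * x i a)"
        using j by (subst sum.remove[of _ j]) auto
      also have "(\<Sum>i\<in>{..<k} - {j}. (if i = j then t else c' i - t * d i) * x i a) =
         (\<Sum>i\<in>{..<k} - {j}. c' i * X $$ (a, i)) - t * (\<Sum>i\<in>{..<k} - {j}. d i * X $$ (a, i))"
        unfolding sum_distrib_left sum_subtractf[symmetric]
        by (intro sum.cong refl) (auto simp: x_def algebra_simps)
      also have "\<dots> = (v a - mv n Rj v a) - t * (x j a - z a)" using c' d a by simp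
      finally have "(\<Sum>i<k. (if i = j then t else c' i - t * d i) * x i a) = v a - mv n Rj v a + t * z a"
        by (simp add: algebra_simps)
      moreover have "(\<Sum>i<k. c i * x i a) = v a - mv n R v a" using c a by (simp add: x_def)
      ultimately have "(\<Sum>i<k. h i * x i a) = mv n Rj v a - mv n R v a - t * z a"
        unfolding h_def left_diff_distrib sum_subtractf by simp
      then show ?thesis by (simp add: D_def t_def u_def)
    qed
    have Dx: "ip n D (x i) = 0" if i: "i < k" for i
    proof -
      have "ip n D (x i) = ip n (mv n Rj v) (x i) - ip n (mv n R v) (x i) - ip n u v * ip n u (x i)"
        unfolding D_def[abs_def] ip_diff_left ip_scale_left ..
      also have "ip n (mv n R v) (x i) = 0"
        unfolding ip_mv_sym[OF R] by (rule ip_zero_right) (use Rx i in auto)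
      also have "ip n (mv n Rj v) (x i) = ip n u v * ip n u (x i)"
      proof (cases "i = j")
        case True
        then have "ip n (mv n Rj v) (x i) = ip n v z" unfolding ip_mv_sym[OF Rj] by (simp add: z_def)
        then show ?thesis using True ux[OF i] s by (simp add: ipu ip_commute)
      next
        case False
        then have "ip n (mv n Rj v) (x i) = 0"
          unfolding ip_mv_sym[OF Rj] by (intro ip_zero_right) (use Rjx i in auto)
        then show ?thesis using False ux[OF i] by simp
      qed
      finally show ?thesis by simp
    qed
    have "ip n D D = ip n D (\<lambda>a. \<Sum>i<k. h i * x i a)" by (rule ip_cong) (use Dspan in auto)
    also have "\<dots> = 0" using Dx by (simp add: ip_sum_right)
    finally have "D a = 0" using a by (rule ip_self_eq_0D)
    then show ?thesis by (simp add: D_def ud R_def Rj_def)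
  qed
qed

text \<open>Knocking out \<open>j\<close> adds \<open>z z' / n\<close> to the covariance estimate
  \<open>S\<close>, where \<open>z = Y' u\<close>, so the statistic is \<open>z' c'\<close> with
  \<open>S c' = z / n\<close>. As \<open>Q\<close> annihilates all regressors and \<open>u\<close>
  is orthogonal to all but \<open>x_j\<close>, both \<open>S\<close> and \<open>z\<close> factor
  through \<open>H\<close>. With \<open>c = H c'\<close> the equation becomes the normal equation of
  \<open>fit_solves\<close>, in which \<open>H\<close> no longer occurs.\<close>

lemma koo_stat_eq_fit:
  assumes X: "X \<in> carrier_mat n k" and pd: "pos_def k (transpose_mat X * X)" and j: "j < k" and n: "0 < n"
    and T: "T \<in> carrier_mat k p" and H: "H \<in> carrier_mat p p" and dH: "det H \<noteq> 0" and E: "E \<in> carrier_mat n p"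
    and x: "\<And>i l. i < p \<Longrightarrow> l < n \<Longrightarrow> E $$ (l, i) = x i l"
    and w: "\<And>a. a < p \<Longrightarrow> (\<Sum>m<p. H $$ (m, a) * w m) = ko_len X j * T $$ (j, a)"
    and piv: "\<And>i. i < p \<Longrightarrow> pivot n (resid_fun X {..<k}) x i \<noteq> 0"
  shows "koo_stat X (X * T + E * H) j =
    fit_sq n (resid_fun X {..<k}) (ko_unit X j) w x p - 1"
proof -
  define R where "R = resid_fun X {..<k}"
  define Rj where "Rj = resid_fun X ({..<k} - {j})"
  define u where "u = ko_unit X j"
  define Y where "Y = X * T + E * H"
  note ko = ko_props[OF X pd j, folded R_def Rj_def u_def]
  note pR = resid_props[OF X pd, of "{..<k}", folded R_def]
  note pRj = resid_props[OF X pd, of "{..<k} - {j}", folded Rj_def]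
  have R: "orth_proj n R" using pR by auto
  have Yc: "Y \<in> carrier_mat n p" using X T E H by (simp add: Y_def)
  define y where "y b = (\<lambda>l. Y $$ (l, b))" for b
  have ye: "y b l = (\<Sum>i<k. T $$ (i, b) * X $$ (l, i)) + (\<Sum>m<p. H $$ (m, b) * x m l)" if "b < p" "l < n" for b l
  proof -
    have "y b l = (X * T) $$ (l, b) + (E * H) $$ (l, b)" using X T E H that by (simp add: y_def Y_def)
    also have "\<dots> = (\<Sum>i<k. X $$ (l, i) * T $$ (i, b)) + (\<Sum>m<p. E $$ (l, m) * H $$ (m, b))"
      using index_mult_sum[OF X T that(2,1)] index_mult_sum[OF E H that(2,1)] by simp
    finally show ?thesis using x that by (simp add: mult.commute)
  qed
  have Ry: "mv n R (y b) a = (\<Sum>m<p. H $$ (m, b) * mv n R (x m) a)" if b: "b < p" and a: "a < n" for a b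
  proof -
    have "mv n R (y b) a = mv n R (\<lambda>l. (\<Sum>i<k. T $$ (i, b) * X $$ (l, i)) - (-1) * (\<Sum>m<p. H $$ (m, b) * x m l)) a"
      by (rule mv_cong) (use ye b in auto)
    also have "\<dots> = (\<Sum>i<k. T $$ (i, b) * mv n R (\<lambda>l. X $$ (l, i)) a) + (\<Sum>m<p. H $$ (m, b) * mv n R (x m) a)"
      unfolding mv_diff mv_scale mv_sum mv_sum[where x = "\<lambda>i l. X $$ (l, i)"] by simp
    also have "(\<Sum>i<k. T $$ (i, b) * mv n R (\<lambda>l. X $$ (l, i)) a) = 0"
      using pR(3) a by simp
    finally show ?thesis by simp
  qed
  define z where "z b = ip n u (y b)" for b
  have ze: "z b = (\<Sum>m<p. H $$ (m, b) * (w m + ip n u (x m)))" if b: "b < p" for b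
  proof -
    have "z b = ip n u (\<lambda>l. (\<Sum>i<k. T $$ (i, b) * X $$ (l, i)) - (-1) * (\<Sum>m<p. H $$ (m, b) * x m l))"
      unfolding z_def by (rule ip_cong) (use ye b in auto)
    also have "\<dots> = (\<Sum>i<k. T $$ (i, b) * ip n u (\<lambda>l. X $$ (l, i))) + (\<Sum>m<p. H $$ (m, b) * ip n u (x m))"
      unfolding ip_diff_right ip_scale_right ip_sum_right ip_sum_right[where x = "\<lambda>i l. X $$ (l, i)"] by simp
    also have "(\<Sum>i<k. T $$ (i, b) * ip n u (\<lambda>l. X $$ (l, i))) = (\<Sum>i<k. if i = j then T $$ (i, b) * ko_len X j else 0)"
      by (intro sum.cong refl) (simp add: ko(4))
    also have "\<dots> = (\<Sum>m<p. H $$ (m, b) * w m)" using j w[OF b] by simp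
    finally show ?thesis by (simp add: distrib_left sum.distrib)
  qed
  define S where "S = Sigma_hat X Y {..<k}"
  define Sj where "Sj = Sigma_hat X Y ({..<k} - {j})"
  have entry: "Sigma_hat X Y J $$ (a, b) = (1 / real n) * ip n (y a) (mv n (resid_fun X J) (y b))"
    if J: "J \<subseteq> {..<k}" and "a < p" "b < p" for J a b
  proof -
    note Rc = resid_props(1)[OF X pd J]
    have RYc: "resid_mat X J * Y \<in> carrier_mat n p" using Rc Yc by simp
    have YR: "transpose_mat Y * resid_mat X J * Y = transpose_mat Y * (resid_mat X J * Y)"
      using Rc Yc by (intro assoc_mult_mat) auto
    have "(transpose_mat Y * (resid_mat X J * Y)) $$ (a, b) = (\<Sum>l<n. Y $$ (l, a) * (resid_mat X J * Y) $$ (l, b))"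
      using index_mult_sum[of "transpose_mat Y" p n "resid_mat X J * Y" p a b] Yc RYc that by simp
    also have "\<dots> = ip n (y a) (mv n (resid_fun X J) (y b))"
      unfolding ip_def mv_def using index_mult_sum[OF Rc Yc _ that(3)]
      by (intro sum.cong refl) (simp add: y_def resid_fun_def)
    finally show "Sigma_hat X Y J $$ (a, b) = (1 / real n) * ip n (y a) (mv n (resid_fun X J) (y b))"
      using X Yc Rc that by (simp add: Sigma_hat_def YR)
  qed
  have carr: "Sigma_hat X Y J \<in> carrier_mat p p" if "J \<subseteq> {..<k}" for J
    using resid_props(1)[OF X pd that] Yc X by (simp add: Sigma_hat_def)
  have Sc: "S \<in> carrier_mat p p" and Sjc: "Sj \<in> carrier_mat p p" by (auto simp: S_def Sj_def intro!: carr)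
  have Se: "S $$ (a, b) = (1 / real n) * ip n (y a) (mv n R (y b))" if "a < p" "b < p" for a b
    using entry[of "{..<k}" a b] that by (simp add: S_def R_def)
  have Sje: "Sj $$ (a, b) = S $$ (a, b) + (1 / real n) * (z a * z b)" if "a < p" "b < p" for a b
  proof -
    have "ip n (y a) (mv n Rj (y b)) = ip n (y a) (\<lambda>l. mv n R (y b) l - (- z b) * u l)"
      by (rule ip_cong) (simp_all add: ko(5) z_def)
    also have "\<dots> = ip n (y a) (mv n R (y b)) + z a * z b"
      unfolding ip_diff_right ip_scale_right by (simp add: z_def[of a] ip_commute)
    finally show ?thesis
      using entry[of "{..<k} - {j}" a b] Se[OF that] that by (auto simp: Sj_def Rj_def distrib_left)
  qed
  \<comment> \<open>The substitution \<open>c = H c'\<close>: every solution of the normal equations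
    for the columns of \<open>E\<close> is carried over to the system with matrix
    \<open>S\<close>.\<close>
  have solve: "\<exists>c'. (\<forall>a<p. (\<Sum>b<p. S $$ (a, b) * c' b) = (1 / real n) * (\<Sum>m<p. H $$ (m, a) * v m)) \<and>
      (\<forall>m<p. (\<Sum>b<p. H $$ (m, b) * c' b) = c m)"
    if c: "\<And>m. m < p \<Longrightarrow> ip n (x m) (mv n R (\<lambda>l. \<Sum>i<p. c i * x i l)) = v m" for c v
  proof -
    obtain c' where c': "\<forall>m<p. (\<Sum>b<p. H $$ (m, b) * c' b) = c m" using det_solvable[OF H dH] by blast
    have "(\<Sum>b<p. S $$ (a, b) * c' b) = (1 / real n) * (\<Sum>m<p. H $$ (m, a) * v m)" if a: "a < p" for a
    proof -
      have "(\<Sum>b<p. S $$ (a, b) * c' b) = (1 / real n) * (\<Sum>b<p. c' b * ip n (y a) (mv n R (y b)))"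
        unfolding sum_distrib_left using a by (intro sum.cong refl) (simp add: Se)
      also have "(\<Sum>b<p. c' b * ip n (y a) (mv n R (y b))) = ip n (y a) (\<lambda>l. \<Sum>b<p. c' b * mv n R (y b) l)"
        by (rule ip_sum_right[symmetric])
      also have "\<dots> = ip n (y a) (mv n R (\<lambda>l. \<Sum>i<p. c i * x i l))"
      proof (rule ip_cong[OF refl])
        fix l assume l: "l < n"
        have "(\<Sum>b<p. c' b * mv n R (y b) l) = (\<Sum>b<p. \<Sum>m<p. c' b * (H $$ (m, b) * mv n R (x m) l))"
          using Ry l by (simp add: sum_distrib_left)
        also have "\<dots> = (\<Sum>m<p. (\<Sum>b<p. H $$ (m, b) * c' b) * mv n R (x m) l)"
          by (subst sum.swap) (simp add: sum_distrib_right sum_distrib_left mult_ac)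
        also have "\<dots> = mv n R (\<lambda>l. \<Sum>i<p. c i * x i l) l"
          using c' by (simp add: mv_sum)
        finally show "(\<Sum>b<p. c' b * mv n R (y b) l) = mv n R (\<lambda>l. \<Sum>i<p. c i * x i l) l" .
      qed
      also have "\<dots> = ip n (mv n R (y a)) (\<lambda>l. \<Sum>i<p. c i * x i l)" by (rule ip_mv_sym[OF R, symmetric])
      also have "\<dots> = ip n (\<lambda>l. \<Sum>i<p. c i * x i l) (\<lambda>l. \<Sum>m<p. H $$ (m, a) * mv n R (x m) l)"
        by (subst ip_commute, rule ip_cong) (use Ry a in auto)
      also have "\<dots> = (\<Sum>m<p. H $$ (m, a) * ip n (\<lambda>l. \<Sum>i<p. c i * x i l) (mv n R (x m)))"
        by (rule ip_sum_right)
      also have "\<dots> = (\<Sum>m<p. H $$ (m, a) * v m)"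
      proof (intro sum.cong refl)
        fix m assume "m \<in> {..<p}"
        then show "H $$ (m, a) * ip n (\<lambda>l. \<Sum>i<p. c i * x i l) (mv n R (x m)) = H $$ (m, a) * v m"
          using c[of m] ip_mv_sym[OF R, of "x m" "\<lambda>l. \<Sum>i<p. c i * x i l"]
            ip_commute[of n "\<lambda>l. \<Sum>i<p. c i * x i l" "mv n R (x m)"] by simp
      qed
      finally show ?thesis .
    qed
    then show ?thesis using c' by blast
  qed
  have piv': "\<And>i. i < p \<Longrightarrow> pivot n R x i \<noteq> 0" using piv by (simp add: R_def)
  have "det S \<noteq> 0"
  proof (rule solvable_det[OF Sc])
    fix zz
    have Ht: "transpose_mat H \<in> carrier_mat p p" "det (transpose_mat H) \<noteq> 0"
      using H dH det_transpose[OF H] by auto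
    obtain v where v: "\<forall>a<p. (\<Sum>b<p. transpose_mat H $$ (a, b) * v b) = real n * zz a"
      using det_solvable[OF Ht, of "\<lambda>a. real n * zz a"] by blast
    \<comment> \<open>With \<open>u = 0\<close> the recursion solves the system for an arbitrary
      right-hand side, so nonvanishing pivots already make \<open>S\<close> nonsingular.\<close>
    obtain c where c: "\<And>m. m < p \<Longrightarrow> ip n (x m) (mv n R (\<lambda>l. \<Sum>i<p. c i * x i l)) = v m + ip n (\<lambda>_. 0) (x m)"
      by (rule fit_solves[OF R _ piv', where u = "\<lambda>_. 0" and w = v]) (auto simp: mv_def ip_def)
    then have c0: "ip n (x m) (mv n R (\<lambda>l. \<Sum>i<p. c i * x i l)) = v m" if "m < p" for m
      using that by (simp add: ip_def[of n "\<lambda>_. 0"])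
    obtain c' where c': "\<forall>a<p. (\<Sum>b<p. S $$ (a, b) * c' b) = (1 / real n) * (\<Sum>m<p. H $$ (m, a) * v m)"
      using solve[OF c0] by blast
    have "(\<Sum>m<p. H $$ (m, a) * v m) = real n * zz a" if "a < p" for a
      using v H that by simp
    with c' n have "\<forall>a<p. (\<Sum>b<p. S $$ (a, b) * c' b) = zz a" by simp
    then show "\<exists>c. \<forall>a<p. (\<Sum>b<p. S $$ (a, b) * c b) = zz a" by blast
  qed
  note G = mat_inv_det[OF Sc this]
  obtain c where c: "\<And>m. m < p \<Longrightarrow> ip n (x m) (mv n R (\<lambda>l. \<Sum>i<p. c i * x i l)) = w m + ip n u (x m)"
    and K: "fit_sq n R u w x p - ip n u u = (\<Sum>i<p. c i * (w i + ip n u (x i)))"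
    by (rule fit_solves[OF R ko(3) piv', where w = w]) auto
  obtain c' where c': "\<And>a. a < p \<Longrightarrow> (\<Sum>b<p. S $$ (a, b) * c' b) = (1 / real n) * (\<Sum>m<p. H $$ (m, a) * (w m + ip n u (x m)))"
    "\<And>m. m < p \<Longrightarrow> (\<Sum>b<p. H $$ (m, b) * c' b) = c m"
    using solve[OF c] by blast
  have zS: "(1 / real n) * z a = (\<Sum>b<p. S $$ (a, b) * c' b)" if "a < p" for a
    using c'(1)[OF that] ze[OF that] by simp
  have Gz: "(\<Sum>b<p. mat_inv S $$ (a, b) * ((1 / real n) * z b)) = c' a" if a: "a < p" for a
  proof -
    have "(\<Sum>b<p. mat_inv S $$ (a, b) * ((1 / real n) * z b)) =
       (\<Sum>b<p. mat_inv S $$ (a, b) * (\<Sum>d<p. S $$ (b, d) * c' d))" using zS by simp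
    also have "\<dots> = (\<Sum>d<p. (\<Sum>b<p. mat_inv S $$ (a, b) * S $$ (b, d)) * c' d)"
      unfolding sum_distrib_left sum_distrib_right by (subst sum.swap) (simp add: mult.assoc)
    also have "\<dots> = (\<Sum>d<p. (if a = d then 1 else 0) * c' d)"
      using index_mult_sum[OF G(1) Sc a] G(3) a by (intro sum.cong refl) simp
    also have "\<dots> = (\<Sum>d<p. if a = d then c' d else 0)" by (intro sum.cong refl) simp
    also have "\<dots> = c' a" using a by simp
    finally show ?thesis .
  qed
  have "mat_trace (mat_inv S * Sj) = (\<Sum>a<p. \<Sum>b<p. mat_inv S $$ (a, b) * Sj $$ (b, a))"
    using G(1) Sjc index_mult_sum[OF G(1) Sjc] by (simp add: mat_trace_def)
  also have "\<dots> = (\<Sum>a<p. (\<Sum>b<p. mat_inv S $$ (a, b) * S $$ (b, a)) + (\<Sum>b<p. mat_inv S $$ (a, b) * ((1 / real n) * z b)) * z a)"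
    unfolding sum_distrib_right sum.distrib[symmetric]
    by (intro sum.cong refl) (simp add: Sje algebra_simps)
  also have "\<dots> = (\<Sum>a<p. (mat_inv S * S) $$ (a, a) + c' a * z a)"
  proof (intro sum.cong refl)
    fix a assume "a \<in> {..<p}"
    then have a: "a < p" by simp
    show "(\<Sum>b<p. mat_inv S $$ (a, b) * S $$ (b, a)) + (\<Sum>b<p. mat_inv S $$ (a, b) * ((1 / real n) * z b)) * z a =
      (mat_inv S * S) $$ (a, a) + c' a * z a"
      by (simp only: Gz[OF a] index_mult_sum[OF G(1) Sc a a])
  qed
  also have "\<dots> = real p + (\<Sum>a<p. c' a * z a)" by (simp add: G(3) sum.distrib)
  also have "(\<Sum>a<p. c' a * z a) = (\<Sum>a<p. \<Sum>m<p. c' a * (H $$ (m, a) * (w m + ip n u (x m))))"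
    by (simp add: ze sum_distrib_left)
  also have "\<dots> = (\<Sum>m<p. (\<Sum>a<p. H $$ (m, a) * c' a) * (w m + ip n u (x m)))"
    by (subst sum.swap) (simp add: sum_distrib_right sum_distrib_left mult_ac)
  also have "\<dots> = (\<Sum>m<p. c m * (w m + ip n u (x m)))" by (simp add: c')
  also have "\<dots> = fit_sq n R u w x p - 1" using K ko(2) by simp
  finally show ?thesis
    using X Yc H by (simp add: koo_stat_def S_def Sj_def R_def u_def Y_def)
qed

text \<open>With \<open>s\<close> the residual length of \<open>x_j\<close>, the vector
  \<open>w\<close> is \<open>s\<close> times the inverse root of the covariance applied to
  \<open>\<theta>_j\<close>. Writing it as \<open>s * H q\<close> with \<open>q\<close> the inverse
  covariance applied to \<open>\<theta>_j\<close> avoids the inverse root, and symmetry of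
  \<open>H\<close> turns \<open>|H q|^2\<close> into \<open>\<theta>_j' q\<close>.\<close>

lemma koo_delta_eq:
  assumes X: "X \<in> carrier_mat n k" and pd: "pos_def k (transpose_mat X * X)" and j: "j < k" and p: "0 < p"
    and T: "T \<in> carrier_mat k p" and H: "H \<in> carrier_mat p p" and Ht: "transpose_mat H = H" and dH: "det H \<noteq> 0"
    and S: "H * H = S"
    and w: "\<And>a. a < p \<Longrightarrow> (\<Sum>m<p. H $$ (m, a) * w m) = ko_len X j * T $$ (j, a)"
  shows "(\<Sum>i<p. (w i)\<^sup>2) = real p * koo_delta X T S j"
proof -
  define s where "s = ko_len X j"
  have Sc: "S \<in> carrier_mat p p" using H S by auto
  have dS: "det S \<noteq> 0" using det_mult[OF H H] dH S by auto
  note G = mat_inv_det[OF Sc dS]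
  define th where "th = row T j"
  have th: "th \<in> carrier_vec p" using T j by (simp add: th_def)
  have the: "th $ a = T $$ (j, a)" if "a < p" for a using T j that by (simp add: th_def)
  define q where "q = mat_inv S *\<^sub>v th"
  have q: "q \<in> carrier_vec p" using G th by (simp add: q_def)
  define wv where "wv = vec p w"
  have wv: "wv \<in> carrier_vec p" by (simp add: wv_def)
  have Hsym: "H $$ (m, a) = H $$ (a, m)" if "m < p" "a < p" for m a
    using that H Ht by (metis carrier_matD index_transpose_mat(1))
  have Hw: "H *\<^sub>v wv = s \<cdot>\<^sub>v th"
  proof (rule eq_vecI)
    fix a assume "a < dim_vec (s \<cdot>\<^sub>v th)"
    then have a: "a < p" using th by simp
    have "(H *\<^sub>v wv) $ a = (\<Sum>m<p. H $$ (a, m) * w m)"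
      using H a by (simp add: wv_def scalar_prod_def lessThan_atLeast0)
    also have "\<dots> = (\<Sum>m<p. H $$ (m, a) * w m)" using Hsym a by (intro sum.cong refl) simp
    finally show "(H *\<^sub>v wv) $ a = (s \<cdot>\<^sub>v th) $ a" using w[OF a] the[OF a] a th by (simp add: s_def)
  qed (use H th in simp)
  have Hq: "H *\<^sub>v (H *\<^sub>v q) = th"
  proof -
    have "H *\<^sub>v (H *\<^sub>v q) = S *\<^sub>v q" using H q S by (simp add: assoc_mult_mat_vec[of H p p H p, symmetric])
    also have "\<dots> = (S * mat_inv S) *\<^sub>v th" unfolding q_def by (rule assoc_mult_mat_vec[symmetric]) (use Sc G th in auto)
    finally show ?thesis using G th by simp
  qed
  have Hinj: "v = v'" if "H *\<^sub>v v = H *\<^sub>v v'" "v \<in> carrier_vec p" "v' \<in> carrier_vec p" for v v'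
  proof -
    note HI = mat_inv_det[OF H dH]
    have "mat_inv H *\<^sub>v (H *\<^sub>v y) = y" if "y \<in> carrier_vec p" for y
      using assoc_mult_mat_vec[OF HI(1) H that] HI(3) that by simp
    then show ?thesis using that by metis
  qed
  have Hqc: "H *\<^sub>v q \<in> carrier_vec p" using H q by simp
  have wq: "wv = s \<cdot>\<^sub>v (H *\<^sub>v q)"
    by (rule Hinj) (use Hw Hq H q wv Hqc in \<open>auto simp: mult_mat_vec[of H p p]\<close>)
  have "th \<bullet> q = (H *\<^sub>v (H *\<^sub>v q)) \<bullet> q" by (simp add: Hq)
  also have "\<dots> = (H *\<^sub>v q) \<bullet> (H *\<^sub>v q)"
    using transpose_vec_mult_scalar[OF H q Hqc] Ht comm_scalar_prod[OF Hqc] by simp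
  finally have thq: "th \<bullet> q = (H *\<^sub>v q) \<bullet> (H *\<^sub>v q)" .
  have "(\<Sum>i<p. (w i)\<^sup>2) = wv \<bullet> wv"
    by (simp add: wv_def scalar_prod_def lessThan_atLeast0 power2_eq_square)
  also have "\<dots> = s\<^sup>2 * (th \<bullet> q)" unfolding wq thq using Hqc by (simp add: power2_eq_square)
  also have "s\<^sup>2 = col X j \<bullet> (resid_mat X ({..<k} - {j}) *\<^sub>v col X j)"
  proof -
    note Rc = resid_props(1)[OF X pd, of "{..<k} - {j}", simplified]
    have "col X j \<bullet> (resid_mat X ({..<k} - {j}) *\<^sub>v col X j) =
      ip n (\<lambda>a. X $$ (a, j)) (mv n (resid_fun X ({..<k} - {j})) (\<lambda>a. X $$ (a, j)))"
      using X j Rc by (simp add: scalar_prod_def lessThan_atLeast0 ip_def mv_def resid_fun_def)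
    then show ?thesis using ko_props(1)[OF X pd j] by (simp add: s_def)
  qed
  finally show ?thesis using X T p by (simp add: koo_delta_def th_def q_def)
qed

section \<open>The KOO statistics\<close>

text \<open>Countably many tolerances suffice, so the almost sure statements can be intersected over
  \<open>m\<close> before passing to the limit.\<close>

lemma max_over_tendsto_0:
  assumes fin: "\<And>n. finite (J n)"
    and g: "\<And>n j. 0 \<le> g n j"
    and ev: "\<And>m. eventually (\<lambda>n. \<forall>j\<in>J n. g n j \<le> 1 / real (Suc m)) sequentially"
  shows "(\<lambda>n. max_over (J n) (g n)) \<longlonglongrightarrow> 0"
proof (rule tendstoI)
  fix \<epsilon> :: real assume "0 < \<epsilon>"
  then obtain m where m: "1 / real (Suc m) < \<epsilon>" using nat_approx_posE by blast
  from ev[of m] show "eventually (\<lambda>n. dist (max_over (J n) (g n)) 0 < \<epsilon>) sequentially"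
  proof eventually_elim
    case (elim n)
    have "0 \<le> max_over (J n) (g n)" using fin[of n] by (simp add: max_over_def)
    moreover have "max_over (J n) (g n) \<le> 1 / real (Suc m)"
      using fin[of n] elim by (auto simp: max_over_def)
    ultimately show ?case using m by (simp add: dist_real_def)
  qed
qed

theorem theorem2p1:
  fixes M :: "'a measure"
    and e :: "nat \<Rightarrow> nat \<Rightarrow> 'a \<Rightarrow> real"
    and p k :: "nat \<Rightarrow> nat"
    and X \<Theta> \<Sigma> \<Sigma>_half :: "nat \<Rightarrow> real mat"
    and Y :: "nat \<Rightarrow> 'a \<Rightarrow> real mat"
    and jstar :: "nat \<Rightarrow> nat set"
    and c \<alpha> :: real
  assumes prob: "prob_space M"
    \<comment> \<open>the model\<close>
    and X_dim: "\<And>n. X n \<in> carrier_mat n (k n)"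
    and \<Theta>_dim: "\<And>n. \<Theta> n \<in> carrier_mat (k n) (p n)"
    and \<Sigma>_cov: "\<And>n. full_rank_covariance (p n) (\<Sigma> n)"
    and \<Sigma>_half: "\<And>n. is_mat_sqrt (p n) (\<Sigma> n) (\<Sigma>_half n)"
    and Y_eq: "\<And>n \<omega>. \<omega> \<in> space M \<Longrightarrow>
                 Y n \<omega> = X n * \<Theta> n + error_mat e n (p n) \<omega> * \<Sigma>_half n"
    and true_model: "\<And>n j. j \<in> {..<k n} - jstar n \<Longrightarrow> row (\<Theta> n) j = 0\<^sub>v (p n)"
    \<comment> \<open>(C1)\<close>
    and p_lim: "filterlim p at_top sequentially"
    and k_lim: "filterlim k at_top sequentially"
    and c_lim: "(\<lambda>n. real (p n) / real n) \<longlonglongrightarrow> c"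
    and c_range: "0 < c" "c < 1"
    and \<alpha>_lim: "(\<lambda>n. real (k n) / real n) \<longlonglongrightarrow> \<alpha>"
    and \<alpha>_range: "0 \<le> \<alpha>" "\<alpha> < 1"
    and \<alpha>_c: "\<alpha> + c < 1"
    \<comment> \<open>(C2)\<close>
    and jstar_sub: "\<And>n. jstar n \<subseteq> {..<k n}"
    \<comment> \<open>(C3)\<close>
    and e_indep: "prob_space.indep_vars M (\<lambda>_. borel) (\<lambda>(i, j). e i j) UNIV"
    and e_ident: "\<And>i j. distr M borel (e i j) = distr M borel (e 0 0)"
    and e_fourth: "\<And>i j. integrable M (\<lambda>\<omega>. (e i j \<omega>) ^ 4)"
    and e_mean: "\<And>i j. prob_space.expectation M (e i j) = 0"
    and e_var: "\<And>i j. prob_space.variance M (e i j) = 1"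
    \<comment> \<open>(C4)\<close>
    and X_pd: "\<And>n. n > k n + p n \<Longrightarrow> pos_def (k n) (transpose_mat (X n) * X n)"
  shows "AE \<omega> in M.
      (\<lambda>n. max_over ({..<k n} - jstar n)
              (\<lambda>j. \<bar>koo_stat (X n) (Y n \<omega>) j
                    - (real (p n) / real n)
                        / (1 - real (p n) / real n - real (k n) / real n)\<bar>))
        \<longlonglongrightarrow> 0
    \<and> (\<lambda>n. max_over (jstar n)
              (\<lambda>j. \<bar>koo_stat (X n) (Y n \<omega>) j / (1 + koo_delta (X n) (\<Theta> n) (\<Sigma> n) j)
                    - (real (p n) / real n)
                        / (1 - real (p n) / real n - real (k n) / real n)\<bar>))
        \<longlonglongrightarrow> 0"
proof -
  interpret prob_space M by (rule prob)
  have em: "e i j \<in> borel_measurable M" for i j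
    using e_indep by (auto simp: indep_vars_def)
  have law: "std_law (distr M borel (e 0 0))"
  proof (unfold std_law_def std_law_axioms_def, intro conjI)
    show "prob_space (distr M borel (e 0 0))" by (rule prob_space_distr[OF em])
    show "sets (distr M borel (e 0 0)) = sets borel" by simp
    show "integrable (distr M borel (e 0 0)) (\<lambda>x. x ^ 4)"
      using e_fourth by (subst integrable_distr_eq[OF em]) auto
    show "(\<integral>x. x \<partial>distr M borel (e 0 0)) = 0"
      using e_mean by (subst integral_distr[OF em]) auto
    show "(\<integral>x. x\<^sup>2 \<partial>distr M borel (e 0 0)) = 1"
      using e_var[of 0 0] e_mean[of 0 0] by (subst integral_distr[OF em]) auto
  qed
  interpret iid_array M e
    by (intro iid_array.intro iid_array_axioms.intro prob e_indep e_ident law)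
  \<comment> \<open>Half of the limiting gap \<open>1 - \<alpha> - c\<close>, so that
    \<open>n - k - p\<close> is eventually at least \<open>c0 * n\<close>.\<close>
  define c0 where "c0 = (1 - \<alpha> - c) / 2"
  have c0: "0 < c0" "c0 \<le> 1" using \<alpha>_c \<alpha>_range c_range by (simp_all add: c0_def)
  have dim: "eventually (\<lambda>n. c0 * real n \<le> real n - real (k n) - real (p n)) sequentially"
  proof -
    have "(\<lambda>n. real (k n) / real n + real (p n) / real n) \<longlonglongrightarrow> \<alpha> + c" by (intro tendsto_add \<alpha>_lim c_lim)
    moreover have "\<alpha> + c < 1 - c0" using \<alpha>_c by (simp add: c0_def field_simps)
    ultimately have "eventually (\<lambda>n. real (k n) / real n + real (p n) / real n < 1 - c0) sequentially"
      by (rule order_tendstoD(2))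
    then show ?thesis using eventually_gt_at_top[of 0]
    proof eventually_elim
      case (elim n)
      then have "(real (k n) + real (p n)) / real n < 1 - c0" by (simp add: add_divide_distrib)
      then have "real (k n) + real (p n) < (1 - c0) * real n" using elim by (simp add: pos_divide_less_eq)
      then show ?case by (simp add: algebra_simps)
    qed
  qed
  have p0: "eventually (\<lambda>n. 0 < p n) sequentially"
    using p_lim[unfolded filterlim_at_top, rule_format, of 1] by eventually_elim simp
  \<comment> \<open>The dimension bound implies \<open>n > k + p\<close>, where (C4) applies; the
    remaining \<open>n\<close> are finitely many.\<close>
  define reg where "reg n \<longleftrightarrow> c0 * real n \<le> real n - real (k n) - real (p n) \<and> 0 < p n \<and> 0 < n" for n
  have reg: "eventually reg sequentially"
    unfolding reg_def[abs_def] using dim p0 eventually_gt_at_top[of 0] by eventually_elim auto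
  have pd: "pos_def (k n) (transpose_mat (X n) * X n)" if "reg n" for n
  proof (rule X_pd)
    have "0 < c0 * real n" using that c0 by (simp add: reg_def)
    then show "k n + p n < n" using that unfolding reg_def by linarith
  qed
  have H: "\<Sigma>_half n \<in> carrier_mat (p n) (p n)" "transpose_mat (\<Sigma>_half n) = \<Sigma>_half n"
    "\<Sigma>_half n * \<Sigma>_half n = \<Sigma> n" for n
    using \<Sigma>_half[of n] by (auto simp: is_mat_sqrt_def pos_semidef_def)
  have dH: "Determinant.det (\<Sigma>_half n) \<noteq> 0" for n
  proof -
    have "\<Sigma> n \<in> carrier_mat (p n) (p n)" "vec_space.rank (p n) (\<Sigma> n) = p n"
      using \<Sigma>_cov[of n] by (auto simp: full_rank_covariance_def pos_semidef_def)
    then have "Determinant.det (\<Sigma> n) \<noteq> 0" using vec_space.det_rank_iff by blast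
    then show ?thesis using det_mult[OF H(1) H(1), of n] H(3)[of n] by auto
  qed
  define Q where "Q n = resid_fun (X n) {..<k n}" for n
  define u where "u n = ko_unit (X n)" for n
  have "\<exists>w. \<forall>a<p n. (\<Sum>m<p n. \<Sigma>_half n $$ (a, m) * w m) = ko_len (X n) j * \<Theta> n $$ (j, a)" for n j
    by (rule det_solvable[OF H(1) dH])
  then obtain w0 where w0: "\<And>n j a. a < p n \<Longrightarrow>
      (\<Sum>m<p n. \<Sigma>_half n $$ (a, m) * w0 n j m) = ko_len (X n) j * \<Theta> n $$ (j, a)"
    by metis
  have w: "(\<Sum>m<p n. \<Sigma>_half n $$ (m, a) * w0 n j m) = ko_len (X n) j * \<Theta> n $$ (j, a)" if a: "a < p n" for n j a
  proof -
    have "\<Sigma>_half n $$ (m, a) = \<Sigma>_half n $$ (a, m)" if "m < p n" for m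
      using that a H[of n] by (metis carrier_matD index_transpose_mat(1))
    then show ?thesis using w0[OF a, of j] by simp
  qed
  define \<delta> where "\<delta> n j = koo_delta (X n) (\<Theta> n) (\<Sigma> n) j" for n j
  have ws: "(\<Sum>i<p n. (w0 n j i)\<^sup>2) = real (p n) * \<delta> n j" if "reg n" "j < k n" for n j
    unfolding \<delta>_def using that
    by (intro koo_delta_eq[OF X_dim pd _ _ \<Theta>_dim H(1,2) dH H(3) w]) (auto simp: reg_def)
  have \<delta>0: "0 \<le> \<delta> n j" if "reg n" "j < k n" for n j
  proof -
    have "0 \<le> real (p n) * \<delta> n j" unfolding ws[OF that, symmetric] by (intro sum_nonneg) simp
    then show ?thesis using that by (simp add: reg_def zero_le_mult_iff)
  qed
  have Qe: "eventually (\<lambda>n. orth_proj n (Q n) \<and> tr n (Q n) = real n - real (k n)) sequentially"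
    using reg
  proof eventually_elim
    case (elim n)
    show ?case using resid_props(2,5)[OF X_dim pd[OF elim] order_refl] by (simp add: Q_def)
  qed
  have ue: "eventually (\<lambda>n. \<forall>j<k n. (\<forall>a<n. mv n (Q n) (u n j) a = 0) \<and> ip n (u n j) (u n j) = 1 \<and>
      (\<Sum>i<p n. (w0 n j i)\<^sup>2) = real (p n) * \<delta> n j \<and> 0 \<le> \<delta> n j) sequentially"
    using reg
  proof eventually_elim
    case (elim n)
    show ?case
      using ko_props(2,3)[OF X_dim pd[OF elim]] ws[OF elim] \<delta>0[OF elim] by (auto simp: Q_def u_def)
  qed
  define lim where "lim n = (real (p n) / real n) / (1 - real (p n) / real n - real (k n) / real n)" for n
  have lim: "lim n = real (p n) / (real n - real (k n) - real (p n))" if "reg n" for n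
  proof -
    have "1 - real (p n) / real n - real (k n) / real n = (real n - real (k n) - real (p n)) / real n"
      using that by (simp add: reg_def diff_divide_distrib)
    then show ?thesis using that by (simp add: lim_def reg_def)
  qed
  define good where "good m n \<omega> \<longleftrightarrow> (\<forall>j<k n. (\<forall>i<p n. pivot n (Q n) (\<lambda>i l. e l i \<omega>) i \<noteq> 0) \<and>
     \<bar>fit_sq n (Q n) (u n j) (w0 n j) (\<lambda>i l. e l i \<omega>) (p n)
       - 1 - (1 + \<delta> n j) * (real (p n) / (real n - real (k n) - real (p n)))\<bar> \<le> 1 / real (Suc m) * (1 + \<delta> n j))" for m n \<omega>
  have "AE \<omega> in M. \<forall>m. eventually (\<lambda>n. good m n \<omega>) sequentially"
    unfolding AE_all_countable good_def
    by (intro allI fit_almost_surely[OF p_lim c0 dim Qe ue]) simp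
  then show ?thesis
  proof (rule AE_mp, intro AE_I2 impI)
    fix \<omega> assume \<omega>: "\<omega> \<in> space M" and good: "\<forall>m. eventually (\<lambda>n. good m n \<omega>) sequentially"
    have key: "eventually (\<lambda>n. \<forall>j<k n. \<bar>koo_stat (X n) (Y n \<omega>) j / (1 + \<delta> n j) - lim n\<bar> \<le> 1 / real (Suc m)) sequentially" for m
      using good[rule_format, of m] reg
    proof eventually_elim
      case (elim n)
      show ?case
      proof (intro allI impI)
        fix j assume j: "j < k n"
        define K where "K = koo_stat (X n) (Y n \<omega>) j"
        define d where "d = 1 + \<delta> n j"
        have d: "0 < d" using \<delta>0[OF elim(2) j] by (simp add: d_def)
        have E: "error_mat e n (p n) \<omega> \<in> carrier_mat n (p n)" by (simp add: error_mat_def)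
        have n: "0 < n" using elim(2) by (simp add: reg_def)
        have K: "K = fit_sq n (Q n) (u n j) (w0 n j) (\<lambda>i l. e l i \<omega>) (p n) - 1"
          unfolding K_def Y_eq[OF \<omega>] Q_def u_def
        proof (rule koo_stat_eq_fit[OF X_dim pd[OF elim(2)] j n \<Theta>_dim H(1) dH E _ w])
          show "error_mat e n (p n) \<omega> $$ (l, i) = e l i \<omega>" if "i < p n" "l < n" for i l
            using that by (simp add: error_mat_def)
          show "pivot n (resid_fun (X n) {..<k n}) (\<lambda>i l. e l i \<omega>) i \<noteq> 0" if "i < p n" for i
            using elim(1) j that by (auto simp: good_def Q_def)
        qed
        have "\<bar>K - d * lim n\<bar> \<le> 1 / real (Suc m) * d"
          using elim(1) j unfolding good_def K lim[OF elim(2)] d_def by blast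
        moreover have "K - d * lim n = (K / d - lim n) * d" using d by (simp add: field_simps)
        ultimately have "\<bar>(K / d - lim n) * d\<bar> \<le> 1 / real (Suc m) * d" by simp
        then have "\<bar>K / d - lim n\<bar> * d \<le> 1 / real (Suc m) * d" using d by (simp add: abs_mult)
        then show "\<bar>koo_stat (X n) (Y n \<omega>) j / (1 + \<delta> n j) - lim n\<bar> \<le> 1 / real (Suc m)"
          using d unfolding K_def d_def by (rule mult_right_le_imp_le)
      qed
    qed
    \<comment> \<open>Outside the true model the noncentrality vanishes, so division by
      \<open>1 + \<delta>\<close> changes nothing and \<open>key\<close> covers both cases of the
      theorem.\<close>
    have \<delta>z: "\<delta> n j = 0" if "reg n" "j \<in> {..<k n} - jstar n" for n j
    proof -
      have r: "row (\<Theta> n) j = 0\<^sub>v (p n)" by (rule true_model[OF that(2)])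
      have "\<Sigma> n \<in> carrier_mat (p n) (p n)" using H(1,3)[of n] by (metis mult_carrier_mat)
      moreover have "Determinant.det (\<Sigma> n) \<noteq> 0" using det_mult[OF H(1) H(1), of n] H(3)[of n] dH[of n] by auto
      ultimately have "mat_inv (\<Sigma> n) \<in> carrier_mat (p n) (p n)" by (rule mat_inv_det)
      then show ?thesis unfolding \<delta>_def koo_delta_def r by simp
    qed
    have "(\<lambda>n. max_over ({..<k n} - jstar n) (\<lambda>j. \<bar>koo_stat (X n) (Y n \<omega>) j - lim n\<bar>)) \<longlonglongrightarrow> 0"
    proof (rule max_over_tendsto_0)
      show "eventually (\<lambda>n. \<forall>j\<in>{..<k n} - jstar n. \<bar>koo_stat (X n) (Y n \<omega>) j - lim n\<bar> \<le> 1 / real (Suc m)) sequentially" for m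
        using key[of m] reg
      proof eventually_elim
        case (elim n)
        show ?case
        proof
          fix j assume j: "j \<in> {..<k n} - jstar n"
          then show "\<bar>koo_stat (X n) (Y n \<omega>) j - lim n\<bar> \<le> 1 / real (Suc m)"
            using elim(1)[rule_format, of j] \<delta>z[OF elim(2) j] by simp
        qed
      qed
    qed auto
    moreover have "(\<lambda>n. max_over (jstar n) (\<lambda>j. \<bar>koo_stat (X n) (Y n \<omega>) j / (1 + \<delta> n j) - lim n\<bar>)) \<longlonglongrightarrow> 0"
    proof (rule max_over_tendsto_0)
      show "finite (jstar n)" for n using jstar_sub[of n] finite_subset by blast
      show "eventually (\<lambda>n. \<forall>j\<in>jstar n. \<bar>koo_stat (X n) (Y n \<omega>) j / (1 + \<delta> n j) - lim n\<bar> \<le> 1 / real (Suc m)) sequentially" for m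
        using key[of m] by eventually_elim (use jstar_sub in auto)
    qed auto
    ultimately show "(\<lambda>n. max_over ({..<k n} - jstar n)
              (\<lambda>j. \<bar>koo_stat (X n) (Y n \<omega>) j
                    - (real (p n) / real n)
                        / (1 - real (p n) / real n - real (k n) / real n)\<bar>))
        \<longlonglongrightarrow> 0
    \<and> (\<lambda>n. max_over (jstar n)
              (\<lambda>j. \<bar>koo_stat (X n) (Y n \<omega>) j / (1 + koo_delta (X n) (\<Theta> n) (\<Sigma> n) j)
                    - (real (p n) / real n)
                        / (1 - real (p n) / real n - real (k n) / real n)\<bar>))
        \<longlonglongrightarrow> 0"
      unfolding lim_def \<delta>_def by (rule conjI)
  qed
qed

end
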